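(* Let $N_{\max}\ge 1$ be an integer, let $\mathscr{H}=\bigoplus_{N=0}^{N_{\max}}\mathscr{H}^{(N)}$ be the truncated Fock space over $L^2(\mathbb{R}^3,\mathbb{C}^4)$ (either bosonic or fermionic), let $H^{\mathrm{free}}$ be the truncated second quantization of the free Dirac Hamiltonian, and let $(H^\circ,D^\circ)$ be the restriction of $H^{\mathrm{free}}$ to $$D^\circ=\{0\}\oplus\cdots\oplus\{0\}\oplus S_\pm C_c^\infty\bigl((\mathbb{R}^3\setminus\{\boldsymbol 0\})^{N_{\max}},(\mathbb{C}^4)^{\otimes N_{\max}}\bigr)\subset\mathscr{H}.$$ Then for every self-adjoint extension $(H,D)$ of $(H^\circ,D^\circ)$ in $\mathscr{H}$, the highest sector decouples from the other sectors; that is, $H$ is block diagonal with respect to the decomposition $\mathscr{H}=\mathscr{H}^{(<N_{\max})}\oplus\mathscr{H}^{(N_{\max})}$, where $\mathscr{H}^{(<N_{\max})}=\mathscr{H}^{(0)}\oplus\cdots\oplus\mathscr{H}^{(N_{\max}-1)}$.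
   Context: Fix constants $c,\hbar>0$ and $m\ge 0$. $\boldsymbol\alpha=(\alpha_1,\alpha_2,\alpha_3)$ and $\beta$ are the usual $4\times4$ Hermitian Dirac matrices. The sign $\pm$ is fixed once and for all; $S_+$ (resp. $S_-$) denotes the symmetrization (resp. anti-symmetrization) operator on functions of $N$ variables in $\mathbb{R}^3$ with values in $(\mathbb{C}^4)^{\otimes N}$ (permuting variables and spin indices simultaneously), and $S_\pm X$ denotes the image of a space $X$ under $S_\pm$. Fock space: $\mathscr{H}^{(0)}=\mathbb{C}$ and $\mathscr{H}^{(N)}=S_\pm\, L^2(\mathbb{R}^3,\mathbb{C}^4)^{\otimes N}=S_\pm L^2(\mathbb{R}^{3N},(\mathbb{C}^4)^{\otimes N})$; elements are $\psi=(\psi^{(0)},\ldots,\psi^{(N_{\max})})$. Free Hamiltonian: the one-particle operator is $H_1=-ic\hbar\,\boldsymbol\alpha\cdot\nabla+mc^2\beta$, self-adjoint on $H^1(\mathbb{R}^3,\mathbb{C}^4)$ (first Sobolev space). $H^{\mathrm{free}}_N=\sum_{j=1}^N H_{1j}$, where $H_{1j}$ is $H_1$ acting on the $j$-th particle, is self-adjoint on its domain $D(H^{\mathrm{free}}_N)\subset L^2(\mathbb{R}^{3N},(\mathbb{C}^4)^{\otimes N})$. $H^{\mathrm{free}}$ acts as $(H^{\mathrm{free}}\psi)^{(N)}=H^{\mathrm{free}}_N\psi^{(N)}$ on $\bigoplus_{N=0}^{N_{\max}}S_\pm D(H^{\mathrm{free}}_N)$. $C_c^\infty$ denotes smooth compactly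 supported functions. For sets that are not Hilbert spaces, $\oplus$ denotes the Cartesian product as a subset of $\mathscr{H}$. The subspace $D^\circ$ is not dense in $\mathscr{H}$. "Self-adjoint" always includes "densely defined". A self-adjoint extension of $(H^\circ,D^\circ)$ is a self-adjoint operator $(H,D)$ in $\mathscr{H}$ with $D^\circ\subset D$ and $H|_{D^\circ}=H^\circ$. An operator $(H,D)$ is block diagonal with respect to $\mathscr{H}=\mathscr{H}_a\oplus\mathscr{H}_b$ if $D=D_a\oplus D_b$ with subspaces $D_a\subset\mathscr{H}_a$, $D_b\subset\mathscr{H}_b$, and $H(\psi_a,\psi_b)=(H_a\psi_a,H_b\psi_b)$ for some operators $H_a:D_a\to\mathscr{H}_a$, $H_b:D_b\to\mathscr{H}_b$. *)

theory Defs
  imports "HOL-Analysis.Analysis" "HOL-Combinatorics.Permutations"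
begin

subsection \<open>N-particle wave functions\<close>

text \<open>
  The number of particles is a term-level parameter, so points of \<open>(\<real>\<^sup>3)\<^sup>N\<close> and spin multi-indices
  are extensional functions on \<open>{..<N}\<close>. A function with values in the \<open>N\<close>-fold tensor power
  of \<open>\<complex>\<^sup>4\<close> is given by its components, indexed by \<open>spins N\<close>. The values of a \<open>wavefun\<close> outside
  \<open>confs N \<times> spins N\<close> are never used.  For \<open>N = 0\<close> there is one configuration, of mass 1, and one
  multi-index, so that the zero-particle space is \<open>\<complex>\<close>.
\<close>

type_synonym conf = "nat \<Rightarrow> real^3"
type_synonym spin = "nat \<Rightarrow> 4"
type_synonym wavefun = "conf \<Rightarrow> spin \<Rightarrow> complex"

definition confs :: "nat \<Rightarrow> conf set"
  where "confs N = PiE {..<N} (\<lambda>_. UNIV)"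

definition spins :: "nat \<Rightarrow> spin set"
  where "spins N = PiE {..<N} (\<lambda>_. UNIV)"

definition lebN :: "nat \<Rightarrow> conf measure"
  where "lebN N = PiM {..<N} (\<lambda>_. lborel)"

definition L2 :: "nat \<Rightarrow> wavefun set"
  where "L2 N = {\<psi>. \<forall>s\<in>spins N. (\<lambda>x. \<psi> x s) \<in> borel_measurable (lebN N) \<and>
                                integrable (lebN N) (\<lambda>x. (cmod (\<psi> x s))\<^sup>2)}"

definition ae_eq :: "nat \<Rightarrow> wavefun \<Rightarrow> wavefun \<Rightarrow> bool"
  where "ae_eq N \<psi> \<phi> \<longleftrightarrow> (\<forall>s\<in>spins N. AE x in lebN N. \<psi> x s = \<phi> x s)"

definition l2_inner :: "nat \<Rightarrow> wavefun \<Rightarrow> wavefun \<Rightarrow> complex"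
  where "l2_inner N \<psi> \<phi> = (\<Sum>s\<in>spins N. LINT x|lebN N. cnj (\<psi> x s) * \<phi> x s)"

definition l2_norm :: "nat \<Rightarrow> wavefun \<Rightarrow> real"
  where "l2_norm N \<psi> = sqrt (Re (l2_inner N \<psi> \<psi>))"

datatype statistics = Bose | Fermi

fun exchange_sign :: "statistics \<Rightarrow> (nat \<Rightarrow> nat) \<Rightarrow> complex"
  where
    "exchange_sign Bose \<pi> = 1"
  | "exchange_sign Fermi \<pi> = of_int (sign \<pi>)"

definition symmetrize :: "statistics \<Rightarrow> nat \<Rightarrow> wavefun \<Rightarrow> wavefun"
  where "symmetrize st N \<psi> = (\<lambda>x s.
    (\<Sum>\<pi> | \<pi> permutes {..<N}. exchange_sign st \<pi> * \<psi> (x \<circ> \<pi>) (s \<circ> \<pi>)) / of_nat (fact N))"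


subsection \<open>Smooth functions with compact support\<close>

text \<open>\<open>line j k f x\<close> is \<open>f\<close> along the line through \<open>x\<close> in the \<open>k\<close>-th direction of the \<open>j\<close>-th particle.\<close>

definition line :: "nat \<Rightarrow> 3 \<Rightarrow> (conf \<Rightarrow> complex) \<Rightarrow> conf \<Rightarrow> real \<Rightarrow> complex"
  where "line j k f x t = f (x(j := x j + t *\<^sub>R axis k 1))"

definition pderiv :: "nat \<Rightarrow> 3 \<Rightarrow> (conf \<Rightarrow> complex) \<Rightarrow> conf \<Rightarrow> complex"
  where "pderiv j k f x = vector_derivative (line j k f x) (at 0)"

primrec pderivs :: "(nat \<times> 3) list \<Rightarrow> (conf \<Rightarrow> complex) \<Rightarrow> conf \<Rightarrow> complex"
  where
    "pderivs [] f = f"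
  | "pderivs (d # ds) f = pderiv (fst d) (snd d) (pderivs ds f)"

definition smoothN :: "nat \<Rightarrow> (conf \<Rightarrow> complex) \<Rightarrow> bool"
  where "smoothN N f \<longleftrightarrow>
    (\<forall>ds. set ds \<subseteq> {..<N} \<times> UNIV \<longrightarrow>
       continuous_on (confs N) (pderivs ds f) \<and>
       (\<forall>j<N. \<forall>k. \<forall>x\<in>confs N. line j k (pderivs ds f) x differentiable at 0))"

text \<open>
  Scalar functions in \<open>C\<^sub>c\<^sup>\<infinity>(A\<^sup>N)\<close> for open \<open>A \<subseteq> \<real>\<^sup>3\<close>, extended by zero to \<open>(\<real>\<^sup>3)\<^sup>N\<close>; the topology on
  \<open>conf\<close> is the product topology, which on \<open>confs N\<close> is the Euclidean one.
\<close>

definition Cc_infty :: "nat \<Rightarrow> (real^3) set \<Rightarrow> (conf \<Rightarrow> complex) set"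
  where "Cc_infty N A = {f. smoothN N f \<and>
    (\<exists>K. compact K \<and> K \<subseteq> PiE {..<N} (\<lambda>_. A) \<and> (\<forall>x\<in>confs N - K. f x = 0))}"

definition Cc_infty_spinor :: "nat \<Rightarrow> (real^3) set \<Rightarrow> wavefun set"
  where "Cc_infty_spinor N A = {\<psi>. \<forall>s\<in>spins N. (\<lambda>x. \<psi> x s) \<in> Cc_infty N A}"


subsection \<open>The free Dirac Hamiltonian\<close>

definition dirac_alpha :: "3 \<Rightarrow> complex^4^4"
  where "dirac_alpha k =
   (if k = 1 then
      vector [vector [0, 0, 0, 1],
              vector [0, 0, 1, 0],
              vector [0, 1, 0, 0],
              vector [1, 0, 0, 0]]
    else if k = 2 then
      vector [vector [0, 0, 0, - \<i>],
              vector [0, 0, \<i>, 0],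
              vector [0, - \<i>, 0, 0],
              vector [\<i>, 0, 0, 0]]
    else
      vector [vector [0, 0, 1, 0],
              vector [0, 0, 0, - 1],
              vector [1, 0, 0, 0],
              vector [0, - 1, 0, 0]])"

definition dirac_beta :: "complex^4^4"
  where "dirac_beta =
      vector [vector [1, 0, 0, 0],
              vector [0, 1, 0, 0],
              vector [0, 0, - 1, 0],
              vector [0, 0, 0, - 1]]"

definition spin_op :: "nat \<Rightarrow> complex^4^4 \<Rightarrow> wavefun \<Rightarrow> wavefun"
  where "spin_op j A \<psi> = (\<lambda>x s. \<Sum>b\<in>UNIV. A $ s j $ b * \<psi> x (s(j := b)))"

definition weak_pderiv :: "nat \<Rightarrow> nat \<Rightarrow> 3 \<Rightarrow> wavefun \<Rightarrow> wavefun \<Rightarrow> bool"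
  where "weak_pderiv N j k \<psi> \<xi> \<longleftrightarrow> \<psi> \<in> L2 N \<and> \<xi> \<in> L2 N \<and>
    (\<forall>\<eta>\<in>Cc_infty N UNIV. \<forall>s\<in>spins N.
       (LINT x|lebN N. pderiv j k \<eta> x * \<psi> x s) = - (LINT x|lebN N. \<eta> x * \<xi> x s))"

text \<open>
  The remaining operators are given by their graphs, on representatives. The domain of the
  one-particle operator acting on particle \<open>j\<close> consists of the functions that are \<open>H\<^sup>1\<close> in the
  \<open>j\<close>-th variable (for \<open>N = 1\<close>: the Sobolev space \<open>H\<^sup>1(\<real>\<^sup>3, \<complex>\<^sup>4)\<close>).
\<close>

definition dirac_particle ::
    "real \<Rightarrow> real \<Rightarrow> real \<Rightarrow> nat \<Rightarrow> nat \<Rightarrow> wavefun \<Rightarrow> wavefun \<Rightarrow> bool"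
  where "dirac_particle c hbar m N j \<psi> \<phi> \<longleftrightarrow> \<phi> \<in> L2 N \<and>
    (\<exists>\<xi>. (\<forall>k. weak_pderiv N j k \<psi> (\<xi> k)) \<and>
         ae_eq N \<phi> (\<lambda>x s.
           - \<i> * of_real (c * hbar) * (\<Sum>k\<in>UNIV. spin_op j (dirac_alpha k) (\<xi> k) x s)
           + of_real (m * c\<^sup>2) * spin_op j dirac_beta \<psi> x s))"

definition dirac_sum ::
    "real \<Rightarrow> real \<Rightarrow> real \<Rightarrow> nat \<Rightarrow> wavefun \<Rightarrow> wavefun \<Rightarrow> bool"
  where "dirac_sum c hbar m N \<psi> \<phi> \<longleftrightarrow> \<psi> \<in> L2 N \<and> \<phi> \<in> L2 N \<and>
    (\<exists>\<Phi>. (\<forall>j<N. dirac_particle c hbar m N j \<psi> (\<Phi> j)) \<and>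
         ae_eq N \<phi> (\<lambda>x s. \<Sum>j<N. \<Phi> j x s))"

text \<open>
  As usual for sums of operators acting on different tensor factors, the self-adjoint sum is
  the closure of the sum on the common domain.
\<close>

definition dirac_free ::
    "real \<Rightarrow> real \<Rightarrow> real \<Rightarrow> nat \<Rightarrow> wavefun \<Rightarrow> wavefun \<Rightarrow> bool"
  where "dirac_free c hbar m N \<psi> \<phi> \<longleftrightarrow> \<psi> \<in> L2 N \<and> \<phi> \<in> L2 N \<and>
    (\<exists>\<psi>s \<phi>s. (\<forall>n. dirac_sum c hbar m N (\<psi>s n) (\<phi>s n)) \<and>
       (\<lambda>n. l2_norm N (\<lambda>x s. \<psi>s n x s - \<psi> x s)) \<longlonglongrightarrow> 0 \<and>
       (\<lambda>n. l2_norm N (\<lambda>x s. \<phi>s n x s - \<phi> x s)) \<longlonglongrightarrow> 0)"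

definition dirac_free_dom :: "real \<Rightarrow> real \<Rightarrow> real \<Rightarrow> nat \<Rightarrow> wavefun set"
  where "dirac_free_dom c hbar m N = {\<psi>. \<exists>\<phi>. dirac_free c hbar m N \<psi> \<phi>}"


subsection \<open>Truncated Fock space\<close>

lemma L2_zero: "(\<lambda>x s. 0) \<in> L2 N"
  by (simp add: L2_def)

lemma L2_scale:
  assumes "\<psi> \<in> L2 N"
  shows "(\<lambda>x s. a * \<psi> x s) \<in> L2 N"
  using assms by (auto simp: L2_def norm_mult power_mult_distrib)

lemma L2_add:
  assumes "\<psi> \<in> L2 N" "\<phi> \<in> L2 N"
  shows "(\<lambda>x s. \<psi> x s + \<phi> x s) \<in> L2 N"
proof -
  have "integrable (lebN N) (\<lambda>x. (cmod (\<psi> x s + \<phi> x s))\<^sup>2)" if s: "s \<in> spins N" for s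
  proof (rule Bochner_Integration.integrable_bound)
    show "integrable (lebN N) (\<lambda>x. 2 * (cmod (\<psi> x s))\<^sup>2 + 2 * (cmod (\<phi> x s))\<^sup>2)"
      using assms s by (auto simp: L2_def)
    have [measurable]: "(\<lambda>x. \<psi> x s) \<in> borel_measurable (lebN N)"
      "(\<lambda>x. \<phi> x s) \<in> borel_measurable (lebN N)"
      using assms s by (auto simp: L2_def)
    show "(\<lambda>x. (cmod (\<psi> x s + \<phi> x s))\<^sup>2) \<in> borel_measurable (lebN N)"
      by measurable
    have "(cmod (a + b))\<^sup>2 \<le> 2 * (cmod a)\<^sup>2 + 2 * (cmod b)\<^sup>2" for a b :: complex
    proof -
      have "(cmod (a + b))\<^sup>2 \<le> (cmod a + cmod b)\<^sup>2"
        by (intro power_mono norm_triangle_ineq) auto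
      also have "\<dots> \<le> 2 * (cmod a)\<^sup>2 + 2 * (cmod b)\<^sup>2"
        using sum_squares_bound[of "cmod a" "cmod b"] by (simp add: power2_sum)
      finally show ?thesis .
    qed
    then show "AE x in lebN N. norm ((cmod (\<psi> x s + \<phi> x s))\<^sup>2)
        \<le> norm (2 * (cmod (\<psi> x s))\<^sup>2 + 2 * (cmod (\<phi> x s))\<^sup>2)"
      by simp
  qed
  with assms show ?thesis
    by (auto simp: L2_def intro!: borel_measurable_add)
qed

lemma L2_uminus: "\<psi> \<in> L2 N \<Longrightarrow> (\<lambda>x s. - \<psi> x s) \<in> L2 N"
  by (auto simp: L2_def)

lemma L2_diff: "\<psi> \<in> L2 N \<Longrightarrow> \<phi> \<in> L2 N \<Longrightarrow> (\<lambda>x s. \<psi> x s - \<phi> x s) \<in> L2 N"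
  using L2_add[OF _ L2_uminus, of \<psi> N \<phi>] by simp

lemma ae_eq_refl: "ae_eq N \<psi> \<psi>"
  by (simp add: ae_eq_def)

lemma ae_eq_sym: "ae_eq N \<psi> \<phi> \<Longrightarrow> ae_eq N \<phi> \<psi>"
  by (simp add: ae_eq_def eq_commute)

lemma ae_eq_map2:
  assumes "ae_eq N \<psi> \<psi>'" "ae_eq N \<phi> \<phi>'"
  shows "ae_eq N (\<lambda>x s. F (\<psi> x s) (\<phi> x s)) (\<lambda>x s. F (\<psi>' x s) (\<phi>' x s))"
  unfolding ae_eq_def
proof
  fix s assume "s \<in> spins N"
  then have "AE x in lebN N. \<psi> x s = \<psi>' x s" "AE x in lebN N. \<phi> x s = \<phi>' x s"
    using assms by (auto simp: ae_eq_def)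
  then show "AE x in lebN N. F (\<psi> x s) (\<phi> x s) = F (\<psi>' x s) (\<phi>' x s)"
    by eventually_elim simp
qed

lemma ae_eq_map: "ae_eq N \<psi> \<psi>' \<Longrightarrow> ae_eq N (\<lambda>x s. F (\<psi> x s)) (\<lambda>x s. F (\<psi>' x s))"
  using ae_eq_map2[of N \<psi> \<psi>' \<psi> \<psi>' "\<lambda>a _. F a"] by simp

lemma ae_eq_trans:
  assumes "ae_eq N \<psi> \<phi>" "ae_eq N \<phi> \<xi>"
  shows "ae_eq N \<psi> \<xi>"
  unfolding ae_eq_def
proof
  fix s assume "s \<in> spins N"
  then have "AE x in lebN N. \<psi> x s = \<phi> x s" "AE x in lebN N. \<phi> x s = \<xi> x s"
    using assms by (auto simp: ae_eq_def)
  then show "AE x in lebN N. \<psi> x s = \<xi> x s"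
    by eventually_elim simp
qed

lemma l2_inner_cong:
  assumes "\<psi> \<in> L2 N" "\<psi>' \<in> L2 N" "\<phi> \<in> L2 N" "\<phi>' \<in> L2 N"
    and "ae_eq N \<psi> \<psi>'" "ae_eq N \<phi> \<phi>'"
  shows "l2_inner N \<psi> \<phi> = l2_inner N \<psi>' \<phi>'"
  unfolding l2_inner_def
proof (rule sum.cong[OF refl])
  fix s assume s: "s \<in> spins N"
  have [measurable]: "(\<lambda>x. \<psi> x s) \<in> borel_measurable (lebN N)"
    "(\<lambda>x. \<psi>' x s) \<in> borel_measurable (lebN N)"
    "(\<lambda>x. \<phi> x s) \<in> borel_measurable (lebN N)"
    "(\<lambda>x. \<phi>' x s) \<in> borel_measurable (lebN N)"
    using assms s by (auto simp: L2_def)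
  have cnj[measurable]: "cnj \<in> borel_measurable borel"
    by (intro borel_measurable_continuous_onI continuous_intros)
  have "ae_eq N (\<lambda>x s. cnj (\<psi> x s) * \<phi> x s) (\<lambda>x s. cnj (\<psi>' x s) * \<phi>' x s)"
    using ae_eq_map2[OF assms(5,6), of "\<lambda>a b. cnj a * b"] .
  then show "(LINT x|lebN N. cnj (\<psi> x s) * \<phi> x s) = (LINT x|lebN N. cnj (\<psi>' x s) * \<phi>' x s)"
    by (intro integral_cong_AE) (use s in \<open>auto simp: ae_eq_def\<close>)
qed

text \<open>
  Sequences of \<open>L\<^sup>2\<close> wave functions with component \<open>N\<close> in \<open>L2 N\<close>, modulo almost everywhere
  equality. Symmetry and the truncation of the number of particles are imposed in \<open>fock\<close> below.
\<close>

definition ae_eq_seq :: "(nat \<Rightarrow> wavefun) \<Rightarrow> (nat \<Rightarrow> wavefun) \<Rightarrow> bool"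
  where "ae_eq_seq \<Psi> \<Phi> \<longleftrightarrow> (\<forall>N. \<Psi> N \<in> L2 N \<and> \<Phi> N \<in> L2 N \<and> ae_eq N (\<Psi> N) (\<Phi> N))"

quotient_type fockvec = "nat \<Rightarrow> wavefun" / partial: ae_eq_seq
proof (rule part_equivpI)
  show "\<exists>\<Psi>. ae_eq_seq \<Psi> \<Psi>"
    by (rule exI[of _ "\<lambda>N x s. 0"]) (simp add: ae_eq_seq_def ae_eq_refl L2_zero)
  show "symp ae_eq_seq"
    by (auto simp: symp_def ae_eq_seq_def intro: ae_eq_sym)
  show "transp ae_eq_seq"
    unfolding transp_def ae_eq_seq_def by (blast intro: ae_eq_trans)
qed

instantiation fockvec :: ab_group_add
begin

lift_definition zero_fockvec :: fockvec is "\<lambda>N x s. 0"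
  by (simp add: ae_eq_seq_def ae_eq_refl L2_zero)

lift_definition plus_fockvec :: "fockvec \<Rightarrow> fockvec \<Rightarrow> fockvec"
  is "\<lambda>\<Psi> \<Phi> N x s. \<Psi> N x s + \<Phi> N x s"
  unfolding ae_eq_seq_def by (simp add: L2_add ae_eq_map2)

lift_definition minus_fockvec :: "fockvec \<Rightarrow> fockvec \<Rightarrow> fockvec"
  is "\<lambda>\<Psi> \<Phi> N x s. \<Psi> N x s - \<Phi> N x s"
  unfolding ae_eq_seq_def by (simp add: L2_diff ae_eq_map2)

lift_definition uminus_fockvec :: "fockvec \<Rightarrow> fockvec"
  is "\<lambda>\<Psi> N x s. - \<Psi> N x s"
  unfolding ae_eq_seq_def by (simp add: L2_uminus ae_eq_map)

instance
proof
  fix a b c :: fockvec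
  show "a + b + c = a + (b + c)"
    by transfer (simp add: ae_eq_seq_def L2_add ae_eq_refl add.assoc)
  show "a + b = b + a"
    by transfer (simp add: ae_eq_seq_def L2_add ae_eq_refl add.commute)
  show "0 + a = a"
    by transfer (simp add: ae_eq_seq_def ae_eq_refl)
  show "- a + a = 0"
    by transfer (simp add: ae_eq_seq_def ae_eq_refl L2_zero)
  show "a - b = a + - b"
    by transfer (simp add: ae_eq_seq_def ae_eq_refl L2_diff)
qed

end

lift_definition fock_scale :: "complex \<Rightarrow> fockvec \<Rightarrow> fockvec"
  is "\<lambda>a \<Psi> N x s. a * \<Psi> N x s"
  unfolding ae_eq_seq_def by (simp add: L2_scale ae_eq_map)

text \<open>\<open>sector \<Psi> N \<psi>\<close>: the function \<open>\<psi>\<close> represents the \<open>N\<close>-particle component of \<open>\<Psi>\<close>.\<close>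

lift_definition sector :: "fockvec \<Rightarrow> nat \<Rightarrow> wavefun \<Rightarrow> bool"
  is "\<lambda>\<Psi> N \<psi>. \<psi> \<in> L2 N \<and> ae_eq N (\<Psi> N) \<psi>"
  unfolding ae_eq_seq_def by (blast intro: ae_eq_trans ae_eq_sym)

lift_definition sector_inner :: "nat \<Rightarrow> fockvec \<Rightarrow> fockvec \<Rightarrow> complex"
  is "\<lambda>N \<Psi> \<Phi>. l2_inner N (\<Psi> N) (\<Phi> N)"
  unfolding ae_eq_seq_def by (blast intro: l2_inner_cong)

definition fock_inner :: "nat \<Rightarrow> fockvec \<Rightarrow> fockvec \<Rightarrow> complex"
  where "fock_inner Nmax \<Psi> \<Phi> = (\<Sum>N\<le>Nmax. sector_inner N \<Psi> \<Phi>)"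

definition fock_norm :: "nat \<Rightarrow> fockvec \<Rightarrow> real"
  where "fock_norm Nmax \<Psi> = sqrt (Re (fock_inner Nmax \<Psi> \<Psi>))"

definition fock :: "statistics \<Rightarrow> nat \<Rightarrow> fockvec set"
  where "fock st Nmax = {\<Psi>. (\<forall>N\<le>Nmax. \<exists>\<psi>\<in>symmetrize st N ` L2 N. sector \<Psi> N \<psi>) \<and>
                             (\<forall>N>Nmax. sector \<Psi> N (\<lambda>x s. 0))}"

definition fock_below :: "statistics \<Rightarrow> nat \<Rightarrow> fockvec set"
  where "fock_below st Nmax = {\<Psi> \<in> fock st Nmax. sector \<Psi> Nmax (\<lambda>x s. 0)}"

definition fock_top :: "statistics \<Rightarrow> nat \<Rightarrow> fockvec set"
  where "fock_top st Nmax = {\<Psi> \<in> fock st Nmax. \<forall>N<Nmax. sector \<Psi> N (\<lambda>x s. 0)}"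


subsection \<open>Operators in Fock space, represented by their graphs\<close>

definition is_operator :: "fockvec set \<Rightarrow> fockvec rel \<Rightarrow> bool"
  where "is_operator X G \<longleftrightarrow> G \<subseteq> X \<times> X \<and> single_valued G \<and> (0, 0) \<in> G \<and>
    (\<forall>(\<Psi>, \<Phi>)\<in>G. \<forall>(\<Psi>', \<Phi>')\<in>G. (\<Psi> + \<Psi>', \<Phi> + \<Phi>') \<in> G) \<and>
    (\<forall>a. \<forall>(\<Psi>, \<Phi>)\<in>G. (fock_scale a \<Psi>, fock_scale a \<Phi>) \<in> G)"

definition densely_defined :: "statistics \<Rightarrow> nat \<Rightarrow> fockvec rel \<Rightarrow> bool"
  where "densely_defined st Nmax G \<longleftrightarrow>
    (\<forall>\<Psi>\<in>fock st Nmax. \<forall>\<epsilon>>0. \<exists>\<Phi>\<in>Domain G. fock_norm Nmax (\<Psi> - \<Phi>) < \<epsilon>)"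

definition adjoint_graph :: "statistics \<Rightarrow> nat \<Rightarrow> fockvec rel \<Rightarrow> fockvec rel"
  where "adjoint_graph st Nmax G = {(\<Phi>, \<Theta>) \<in> fock st Nmax \<times> fock st Nmax.
    \<forall>(\<Psi>, \<Omega>)\<in>G. fock_inner Nmax \<Phi> \<Omega> = fock_inner Nmax \<Theta> \<Psi>}"

definition self_adjoint :: "statistics \<Rightarrow> nat \<Rightarrow> fockvec rel \<Rightarrow> bool"
  where "self_adjoint st Nmax G \<longleftrightarrow> is_operator (fock st Nmax) G \<and>
    densely_defined st Nmax G \<and> adjoint_graph st Nmax G = G"

definition restrict_to :: "fockvec rel \<Rightarrow> fockvec set \<Rightarrow> fockvec rel"
  where "restrict_to G D = {(\<Psi>, \<Phi>) \<in> G. \<Psi> \<in> D}"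

definition block_diagonal :: "fockvec set \<Rightarrow> fockvec set \<Rightarrow> fockvec rel \<Rightarrow> bool"
  where "block_diagonal X Y G \<longleftrightarrow>
    (\<exists>A B. is_operator X A \<and> is_operator Y B \<and>
       G = {(\<Psi> + \<Psi>', \<Phi> + \<Phi>') |\<Psi> \<Psi>' \<Phi> \<Phi>'. (\<Psi>, \<Phi>) \<in> A \<and> (\<Psi>', \<Phi>') \<in> B})"

definition H_free :: "real \<Rightarrow> real \<Rightarrow> real \<Rightarrow> statistics \<Rightarrow> nat \<Rightarrow> fockvec rel"
  where "H_free c hbar m st Nmax = {(\<Psi>, \<Phi>) \<in> fock st Nmax \<times> fock st Nmax.
    \<forall>N\<le>Nmax. \<exists>\<psi>\<in>symmetrize st N ` dirac_free_dom c hbar m N. \<exists>\<phi>.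
      sector \<Psi> N \<psi> \<and> sector \<Phi> N \<phi> \<and> dirac_free c hbar m N \<psi> \<phi>}"

definition D_circ :: "statistics \<Rightarrow> nat \<Rightarrow> fockvec set"
  where "D_circ st Nmax = {\<Psi> \<in> fock_top st Nmax.
    \<exists>\<psi>\<in>symmetrize st Nmax ` Cc_infty_spinor Nmax (- {0}). sector \<Psi> Nmax \<psi>}"

definition H_circ :: "real \<Rightarrow> real \<Rightarrow> real \<Rightarrow> statistics \<Rightarrow> nat \<Rightarrow> fockvec rel"
  where "H_circ c hbar m st Nmax = restrict_to (H_free c hbar m st Nmax) (D_circ st Nmax)"

definition self_adjoint_extension ::
    "real \<Rightarrow> real \<Rightarrow> real \<Rightarrow> statistics \<Rightarrow> nat \<Rightarrow> fockvec rel \<Rightarrow> bool"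
  where "self_adjoint_extension c hbar m st Nmax H \<longleftrightarrow> self_adjoint st Nmax H \<and>
    D_circ st Nmax \<subseteq> Domain H \<and>
    restrict_to H (D_circ st Nmax) = H_circ c hbar m st Nmax"

end

theory Submission
  imports Defs
begin

text \<open>
  Let \<open>W\<close> be the set of pairs \<open>(u, v)\<close> of square-integrable \<open>N\<close>-particle functions such that
  \<open>\<langle>u, D \<phi>\<rangle> = \<langle>v, \<phi>\<rangle>\<close> for all test functions \<open>\<phi>\<close> supported away from the origins \<open>x j = 0\<close>, where
  \<open>D\<close> is the \<open>N\<close>-particle Dirac operator.
  If \<open>H\<close> is a self-adjoint extension, then the top components of \<open>\<Psi>\<close> and \<open>H \<Psi>\<close> form a pair in \<open>W\<close>.
  If \<open>W\<close> is symmetric, in the sense that \<open>\<langle>v, u'\<rangle> = \<langle>u, v'\<rangle>\<close> for any two of its pairs, it follows that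
  these top components belong to the graph of \<open>H\<^sup>* = H\<close>.  So the projection to the top sector maps the
  graph of \<open>H\<close> into itself, which is the asserted decoupling.

  The set \<open>x j = 0\<close> has codimension 3, so cutting off a test function in a neighbourhood of size
  \<open>1 / n\<close> costs a gradient of \<open>L\<^sup>2\<close> norm of order \<open>n\<^sup>-\<^sup>1\<^sup>/\<^sup>2\<close>; hence pairs in \<open>W\<close> satisfy the weak equation
  for all test functions.  Since \<open>D\<close> is a symmetric first-order operator with constant coefficients,
  symmetry of \<open>W\<close> now follows by doubling of variables: test with \<open>\<rho> (x - y) \<eta> x \<eta> y\<close>, where the
  derivatives of \<open>\<rho>\<close> cancel, and let the cutoff \<open>\<eta>\<close> tend to 1 and the mollifier \<open>\<rho>\<close> to the delta
  distribution.
\<close>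

subsection \<open>A smooth function flat at the origin and smooth test functions\<close>

text \<open>The argument only plugs in explicit real test functions, built from coordinates and
  e^(-1/t). They lie in an algebra \<open>smooth_alg\<close> closed under partial derivatives, so
  smoothness of all orders costs one induction. Its members are functions on all of
  \<open>conf\<close>, because a difference of two configurations is no longer extensional. A
  self-adjoint extension gives the weak equation only against symmetrized test functions.
  Symmetrization is a self-adjoint projection that commutes with the \<open>N\<close>-particle
  operator and fixes the top components, so the equation holds against all test functions, and the
  analysis can ignore symmetry and treat one spin component at a time. In a pair of \<open>W\<close>
  only the sum of the particle operators is controlled, not the derivatives in a single variable.
  Hence the functions themselves are never differentiated: all derivatives in the doubled integral
  fall on the kernel. The cutoff is removed for a fixed mollifier, before the mollifier is
  concentrated, so that no bound has to be uniform in its width.\<close>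

definition smooth1 :: "(real \<Rightarrow> real) \<Rightarrow> bool"
  where "smooth1 h \<longleftrightarrow> (\<exists>d. d 0 = h \<and> (\<forall>n t. (d n has_real_derivative d (Suc n) t) (at t)))"

lemma smooth1_deriv:
  assumes "smooth1 h"
  shows "\<exists>h'. smooth1 h' \<and> (\<forall>t. (h has_real_derivative h' t) (at t))"
proof -
  obtain d where "d 0 = h" and d: "\<And>n t. (d n has_real_derivative d (Suc n) t) (at t)"
    using assms by (auto simp: smooth1_def)
  then have "smooth1 (d 1)" "\<And>t. (h has_real_derivative d 1 t) (at t)"
    using d[of 0] by (auto simp: smooth1_def intro!: exI[of _ "\<lambda>n. d (Suc n)"])
  then show ?thesis by blast
qed

text \<open>The classical function e^(-1/t), extended by 0 to t \<le> 0, with a polynomial in 1/t in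
  front. The polynomial makes the family closed under differentiation; the constructions below use
  \<open>flat 1\<close>.\<close>

definition flat :: "real poly \<Rightarrow> real \<Rightarrow> real"
  where "flat p t = (if t > 0 then poly p (1 / t) * exp (- (1 / t)) else 0)"

lemma poly_exp_tendsto_0: "((\<lambda>s. poly p s * exp (- s)) \<longlongrightarrow> (0::real)) at_top"
proof -
  have "((\<lambda>s. \<Sum>i\<le>degree p. coeff p i * (s ^ i / exp s)) \<longlongrightarrow> (\<Sum>i\<le>degree p. coeff p i * 0)) at_top"
    by (intro tendsto_intros tendsto_power_div_exp_0)
  then show ?thesis
    by (simp add: poly_altdef sum_distrib_right exp_minus divide_inverse mult.assoc)
qed

text \<open>For t > 0 the derivative of p(1/t) e^(-1/t) is (1/t)^2 (p - p')(1/t) e^(-1/t), and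
  \<open>monom 1 2\<close> supplies the square. At 0 the right difference quotient has the same form
  with X p in place of p, so it tends to 0.\<close>

lemma flat_has_derivative:
  "(flat p has_real_derivative flat (monom 1 2 * (p - Polynomial.pderiv p)) t) (at t)"
proof -
  consider "t > 0" | "t < 0" | "t = 0" by linarith
  then show ?thesis
  proof cases
    case 1
    have "((\<lambda>t. poly p (1 / t) * exp (- (1 / t))) has_real_derivative
        flat (monom 1 2 * (p - Polynomial.pderiv p)) t) (at t)"
      using 1 by (auto intro!: derivative_eq_intros poly_DERIV[THEN DERIV_chain2]
          simp: flat_def poly_monom field_simps power2_eq_square)
    then show ?thesis
      by (rule has_field_derivative_transform_within_open[of _ _ _ "{0<..}"])
        (use 1 in \<open>auto simp: flat_def\<close>)
  next
    case 2
    have "((\<lambda>t. 0) has_real_derivative flat (monom 1 2 * (p - Polynomial.pderiv p)) t) (at t)"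
      using 2 by (auto simp: flat_def)
    then show ?thesis
      by (rule has_field_derivative_transform_within_open[of _ _ _ "{..<0}"])
        (use 2 in \<open>auto simp: flat_def\<close>)
  next
    case 3
    have "((\<lambda>t. flat p t / t) \<longlongrightarrow> 0) (at_right 0)"
    proof -
      have "((\<lambda>t. poly (pCons 0 p) (inverse t) * exp (- inverse t)) \<longlongrightarrow> 0) (at_right 0)"
        by (rule filterlim_compose[OF poly_exp_tendsto_0 filterlim_inverse_at_top_right])
      then show ?thesis
        by (rule Lim_transform_eventually)
          (auto simp: flat_def eventually_at_right_less field_simps
            intro!: eventually_mono[OF eventually_at_right_less])
    qed
    moreover have "((\<lambda>t. flat p t / t) \<longlongrightarrow> 0) (at_left 0)"
      by (rule Lim_transform_eventually[OF tendsto_const])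
        (auto simp: flat_def eventually_at_filter)
    ultimately have "((\<lambda>t. flat p t / t) \<longlongrightarrow> 0) (at 0)"
      by (simp add: filterlim_split_at)
    then show ?thesis
      unfolding 3 DERIV_def by (simp add: flat_def)
  qed
qed

lemma smooth1_flat: "smooth1 (flat p)"
proof -
  define d where "d n = flat (((\<lambda>p. monom 1 2 * (p - Polynomial.pderiv p)) ^^ n) p)" for n
  have "(d n has_real_derivative d (Suc n) t) (at t)" for n t
    unfolding d_def using flat_has_derivative by simp
  then show ?thesis
    unfolding smooth1_def by (intro exI[of _ d]) (auto simp: d_def)
qed

lemma flat_1_nonneg: "flat 1 t \<ge> 0"
  and flat_1_eq_0_iff: "flat 1 t = 0 \<longleftrightarrow> t \<le> 0"
  by (auto simp: flat_def)

section \<open>An algebra of smooth functions closed under partial derivatives\<close>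

inductive smooth_alg :: "nat set \<Rightarrow> (conf \<Rightarrow> real) \<Rightarrow> bool" for J
  where
    const: "smooth_alg J (\<lambda>x. a)"
  | coord: "j \<in> J \<Longrightarrow> smooth_alg J (\<lambda>x. x j $ k)"
  | add: "smooth_alg J f \<Longrightarrow> smooth_alg J g \<Longrightarrow> smooth_alg J (\<lambda>x. f x + g x)"
  | mult: "smooth_alg J f \<Longrightarrow> smooth_alg J g \<Longrightarrow> smooth_alg J (\<lambda>x. f x * g x)"
  | comp: "smooth_alg J f \<Longrightarrow> smooth1 h \<Longrightarrow> smooth_alg J (\<lambda>x. h (f x))"

definition pd :: "nat \<Rightarrow> 3 \<Rightarrow> (conf \<Rightarrow> real) \<Rightarrow> conf \<Rightarrow> real"
  where "pd j k f x = deriv (\<lambda>t. f (x(j := x j + t *\<^sub>R axis k 1))) 0"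

text \<open>Each generating rule has a derivative rule whose result is built by the same rules; the
  chain rule stays inside because the derivative of a \<open>smooth1\<close> function is again
  \<open>smooth1\<close>.\<close>

lemma smooth_alg_deriv_ex:
  assumes "smooth_alg J f"
  shows "\<exists>f'. smooth_alg J f' \<and>
    (\<forall>x. ((\<lambda>t. f (x(j := x j + t *\<^sub>R axis k 1))) has_real_derivative f' x) (at 0))"
    (is "\<exists>f'. _ \<and> (\<forall>x. ?D f f' x)")
  using assms
proof induction
  case (const a)
  have "?D (\<lambda>x. a) (\<lambda>x. 0) x" for x
    by simp
  then show ?case
    using smooth_alg.const[of J 0] by (intro exI[of _ "\<lambda>x. 0"]) simp
next
  case (coord i l)
  have "?D (\<lambda>x. x i $ l) (\<lambda>x. if i = j \<and> l = k then 1 else 0) x" for x :: conf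
    by (cases "i = j"; cases "l = k") (auto simp: axis_def intro!: derivative_eq_intros)
  then show ?case
    using smooth_alg.const[of J "if i = j \<and> l = k then 1 else 0"]
    by (intro exI[of _ "\<lambda>x. if i = j \<and> l = k then 1 else 0"]) simp
next
  case (add f g)
  obtain f' where f': "smooth_alg J f'" "\<forall>x. ?D f f' x"
    using add.IH(1) by (elim exE conjE)
  obtain g' where g': "smooth_alg J g'" "\<forall>x. ?D g g' x"
    using add.IH(2) by (elim exE conjE)
  have "?D (\<lambda>x. f x + g x) (\<lambda>x. f' x + g' x) x" for x
    by (rule DERIV_add[OF f'(2)[rule_format] g'(2)[rule_format]])
  then show ?case
    using smooth_alg.add[OF f'(1) g'(1)] by (intro exI[of _ "\<lambda>x. f' x + g' x"]) simp
next
  case (mult f g)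
  obtain f' where f': "smooth_alg J f'" "\<forall>x. ?D f f' x"
    using mult.IH(1) by (elim exE conjE)
  obtain g' where g': "smooth_alg J g'" "\<forall>x. ?D g g' x"
    using mult.IH(2) by (elim exE conjE)
  have "?D (\<lambda>x. f x * g x) (\<lambda>x. f' x * g x + g' x * f x) x" for x
    using DERIV_mult[OF f'(2)[rule_format] g'(2)[rule_format], of x x] by (simp del: fun_upd_apply)
  moreover have "smooth_alg J (\<lambda>x. f' x * g x + g' x * f x)"
    by (rule smooth_alg.add[OF smooth_alg.mult[OF f'(1) mult.hyps(2)] smooth_alg.mult[OF g'(1) mult.hyps(1)]])
  ultimately show ?case
    by (intro exI[of _ "\<lambda>x. f' x * g x + g' x * f x"]) (simp del: fun_upd_apply)
next
  case (comp f h)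
  obtain f' where f': "smooth_alg J f'" "\<forall>x. ?D f f' x"
    using comp.IH by (elim exE conjE)
  obtain h' where h': "smooth1 h'" "\<forall>t. (h has_real_derivative h' t) (at t)"
    using smooth1_deriv[OF comp.hyps(2)] by (elim exE conjE)
  have "?D (\<lambda>x. h (f x)) (\<lambda>x. h' (f x) * f' x) x" for x
    using DERIV_chain2[OF h'(2)[rule_format] f'(2)[rule_format], of x] by (simp del: fun_upd_apply)
  moreover have "smooth_alg J (\<lambda>x. h' (f x) * f' x)"
    by (rule smooth_alg.mult[OF smooth_alg.comp[OF comp.hyps(1) h'(1)] f'(1)])
  ultimately show ?case
    by (intro exI[of _ "\<lambda>x. h' (f x) * f' x"]) (simp del: fun_upd_apply)
qed

lemma smooth_alg_has_pd:
  assumes "smooth_alg J f"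
  shows "((\<lambda>t. f (x(j := x j + t *\<^sub>R axis k 1))) has_real_derivative pd j k f x) (at 0)"
  using smooth_alg_deriv_ex[OF assms, of j k] DERIV_imp_deriv unfolding pd_def by metis

lemma smooth_alg_pd:
  assumes "smooth_alg J f"
  shows "smooth_alg J (pd j k f)"
proof -
  obtain f' where "smooth_alg J f'"
    and "\<And>x. ((\<lambda>t. f (x(j := x j + t *\<^sub>R axis k 1))) has_real_derivative f' x) (at 0)"
    using smooth_alg_deriv_ex[OF assms, of j k] by blast
  moreover from this have "pd j k f = f'"
    unfolding pd_def using DERIV_imp_deriv by blast
  ultimately show ?thesis by simp
qed

lemma pd_eqI:
  assumes "\<And>x. ((\<lambda>t. f (x(j := x j + t *\<^sub>R axis k 1))) has_real_derivative f' x) (at 0)"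
  shows "pd j k f = f'"
  unfolding pd_def using assms DERIV_imp_deriv by blast

lemma pd_mult:
  assumes "smooth_alg J f" "smooth_alg J g"
  shows "pd j k (\<lambda>x. f x * g x) = (\<lambda>x. pd j k f x * g x + f x * pd j k g x)"
proof (rule pd_eqI)
  fix x
  show "((\<lambda>t. f (x(j := x j + t *\<^sub>R axis k 1)) * g (x(j := x j + t *\<^sub>R axis k 1)))
      has_real_derivative pd j k f x * g x + f x * pd j k g x) (at 0)"
    using DERIV_mult[OF smooth_alg_has_pd[OF assms(1)] smooth_alg_has_pd[OF assms(2)], of x j k]
    by (simp add: mult.commute add.commute)
qed

text \<open>Covers the dilations of cutoffs and mollifiers, the translations
  \<open>x i - y i\<close> for fixed \<open>y\<close>, and the reflection
  \<open>- x i\<close>.\<close>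

lemma smooth_alg_affine:
  assumes "smooth_alg J f"
  shows "smooth_alg J (\<lambda>x. f (\<lambda>i. a *\<^sub>R x i + w i))"
  using assms
proof induction
  case (coord j k)
  have "smooth_alg J (\<lambda>x. a * x j $ k + w j $ k)"
    by (intro smooth_alg.add smooth_alg.mult smooth_alg.const smooth_alg.coord coord)
  then show ?case by simp
qed (auto intro: smooth_alg.intros)

lemma pd_affine:
  assumes "smooth_alg J f"
  shows "pd j k (\<lambda>x. f (\<lambda>i. a *\<^sub>R x i + w i)) = (\<lambda>x. a * pd j k f (\<lambda>i. a *\<^sub>R x i + w i))"
proof (rule pd_eqI)
  fix x :: conf
  let ?y = "\<lambda>i. a *\<^sub>R x i + w i"
  have "((\<lambda>t. f (?y(j := ?y j + t *\<^sub>R axis k 1))) has_real_derivative pd j k f ?y) (at (a * 0))"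
    using smooth_alg_has_pd[OF assms] by simp
  then have "((\<lambda>t. f (?y(j := ?y j + (a * t) *\<^sub>R axis k 1))) has_real_derivative pd j k f ?y * a) (at 0)"
    by (rule DERIV_chain2) (auto intro!: derivative_eq_intros)
  moreover have "?y(j := ?y j + (a * t) *\<^sub>R axis k 1) = (\<lambda>i. a *\<^sub>R (x(j := x j + t *\<^sub>R axis k 1)) i + w i)" for t
    by (auto simp: algebra_simps)
  ultimately show "((\<lambda>t. f (\<lambda>i. a *\<^sub>R (x(j := x j + t *\<^sub>R axis k 1)) i + w i)) has_real_derivative
      a * pd j k f ?y) (at 0)"
    by (simp add: mult.commute)
qed

lemma smooth_alg_prod:
  "finite A \<Longrightarrow> (\<And>i. i \<in> A \<Longrightarrow> smooth_alg J (f i)) \<Longrightarrow> smooth_alg J (\<lambda>x. \<Prod>i\<in>A. f i x)"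
  by (induction A rule: finite_induct) (auto intro: smooth_alg.intros)

lemma smooth_alg_mono: "smooth_alg J f \<Longrightarrow> J \<subseteq> J' \<Longrightarrow> smooth_alg J' f"
  by (induction rule: smooth_alg.induct) (auto intro: smooth_alg.intros)

text \<open>\<open>J\<close> lists the particles on which a member may depend. Values at
  non-extensional arguments, such as differences of configurations, are therefore determined by the
  coordinates in \<open>J\<close>.\<close>

lemma smooth_alg_cong:
  "smooth_alg J f \<Longrightarrow> (\<And>i. i \<in> J \<Longrightarrow> x i = y i) \<Longrightarrow> f x = f y"
  by (induction rule: smooth_alg.induct) auto

lemma smooth_alg_continuous:
  "smooth_alg J f \<Longrightarrow> continuous_on A f"
proof (induction rule: smooth_alg.induct)
  case (coord j k)
  have "continuous_on UNIV (\<lambda>x::conf. x j)"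
    by (rule continuous_on_product_coordinates)
  then show ?case
    by (intro continuous_on_component) (erule continuous_on_subset, simp)
next
  case (comp f h)
  obtain h' where h': "smooth1 h'" "\<And>t. (h has_real_derivative h' t) (at t)"
    using smooth1_deriv[OF comp.hyps(2)] by blast
  then have "continuous_on UNIV h"
    by (meson DERIV_continuous_on has_field_derivative_at_within)
  then show ?case
    using comp.IH by (rule continuous_on_compose2) auto
qed (auto intro: continuous_intros)

section \<open>Supports, boundedness, and the passage to complex test functions\<close>

text \<open>With \<open>J = {m}\<close> the support is bounded in the position of one particle only,
  which is the situation of a cutoff around the origin.\<close>

definition csupp :: "nat set \<Rightarrow> real \<Rightarrow> (conf \<Rightarrow> real) \<Rightarrow> bool"
  where "csupp J L f \<longleftrightarrow> (\<forall>x. \<forall>j\<in>J. \<forall>k. L < \<bar>x j $ k\<bar> \<longrightarrow> f x = 0)"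

lemma pd_zeroI:
  assumes "smooth_alg J f" and "eventually (\<lambda>t. f (x(j := x j + t *\<^sub>R axis k 1)) = 0) (nhds 0)"
  shows "pd j k f x = 0"
proof -
  have "((\<lambda>t. f (x(j := x j + t *\<^sub>R axis k 1))) has_real_derivative 0) (at 0)"
    using DERIV_cong_ev[OF refl assms(2) refl, of 0] by simp
  then show ?thesis
    using smooth_alg_has_pd[OF assms(1)] DERIV_unique by blast
qed

lemma eventually_line_coord:
  fixes x :: conf
  assumes "open U" "x i $ l \<in> U"
  shows "eventually (\<lambda>t. (x(j := x j + t *\<^sub>R axis k 1)) i $ l \<in> U) (nhds 0)"
proof -
  have "isCont (\<lambda>t. (x(j := x j + t *\<^sub>R axis k 1)) i $ l) 0"
    by (cases "i = j") (auto intro!: continuous_intros)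
  then show ?thesis
    using assms unfolding continuous_at_open by (auto simp: eventually_nhds)
qed

lemma csupp_pd:
  assumes "smooth_alg J' f" "csupp J L f"
  shows "csupp J L (pd j k f)"
  unfolding csupp_def
proof (intro allI ballI impI)
  fix x :: conf and i and l :: 3
  assume *: "i \<in> J" "L < \<bar>x i $ l\<bar>"
  \<comment> \<open>The strict inequality in \<open>csupp\<close> describes an open region, so
    \<open>f\<close> vanishes on a whole piece of the line through \<open>x\<close>, and its
    derivative vanishes at \<open>x\<close>.\<close>
  have "open {t::real. L < \<bar>t\<bar>}"
    by (intro open_Collect_less continuous_intros)
  then have "eventually (\<lambda>t. (x(j := x j + t *\<^sub>R axis k 1)) i $ l \<in> {t. L < \<bar>t\<bar>}) (nhds 0)"
    by (rule eventually_line_coord) (use * in simp)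
  then have "eventually (\<lambda>t. f (x(j := x j + t *\<^sub>R axis k 1)) = 0) (nhds 0)"
    using assms(2) *(1) unfolding csupp_def by (auto elim!: eventually_mono simp del: fun_upd_apply)
  then show "pd j k f x = 0"
    by (rule pd_zeroI[OF assms(1)])
qed

lemma csupp_mult: "csupp J L f \<Longrightarrow> csupp J L (\<lambda>x. f x * g x)"
  by (auto simp: csupp_def)

text \<open>Extensionality means lying in the compact singleton \<open>{undefined}\<close> at every
  index outside \<open>I\<close>, so Tychonoff's theorem for the full product applies.\<close>

lemma compact_PiE:
  fixes K :: "'i \<Rightarrow> 'a::topological_space set"
  assumes "\<And>i. i \<in> I \<Longrightarrow> compact (K i)"
  shows "compact (PiE I K)"
proof -
  have "PiE I K = PiE UNIV (\<lambda>i. if i \<in> I then K i else {undefined})"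
    by (fastforce simp: PiE_def Pi_def extensional_def split: if_splits)
  moreover have "compactin (product_topology (\<lambda>_. euclidean) UNIV)
      (PiE UNIV (\<lambda>i. if i \<in> I then K i else {undefined}))"
    using assms by (subst compactin_PiE) (auto simp: compactin_euclidean_iff)
  ultimately show ?thesis
    unfolding euclidean_product_topology compactin_euclidean_iff by (rule ssubst)
qed

lemma compact_cube: "compact {p::real^3. \<forall>k. \<bar>p $ k\<bar> \<le> L}"
proof -
  have "{p::real^3. \<forall>k. \<bar>p $ k\<bar> \<le> L} = cbox (\<chi> k. - L) (\<chi> k. L)"
    by (auto simp: mem_box_cart abs_le_iff) (metis minus_le_iff)+
  then show ?thesis by simp
qed

lemma smooth_alg_bounded:
  assumes "smooth_alg J f" "csupp J L f"
  obtains M where "M > 0" "\<And>x. \<bar>f x\<bar> \<le> M"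
proof -
  let ?K = "PiE J (\<lambda>_. {p. \<forall>k. \<bar>p $ k\<bar> \<le> L})"
  have "compact (f ` ?K)"
    by (intro compact_continuous_image smooth_alg_continuous[OF assms(1)] compact_PiE compact_cube)
  then obtain M where M: "\<And>x. x \<in> ?K \<Longrightarrow> \<bar>f x\<bar> \<le> M"
    using compact_imp_bounded bounded_iff by (metis image_eqI real_norm_def)
  have "\<bar>f x\<bar> \<le> max M 1" for x
  proof (cases "\<forall>j\<in>J. \<forall>k. \<bar>x j $ k\<bar> \<le> L")
    case True
    \<comment> \<open>\<open>x\<close> itself need not lie in \<open>?K\<close>, whose elements are
      extensional on \<open>J\<close>; \<open>f\<close> does not see the difference.\<close>
    then have "\<bar>f (restrict x J)\<bar> \<le> M"
      by (intro M) auto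
    then show ?thesis
      using smooth_alg_cong[OF assms(1), of "restrict x J" x] by simp
  next
    case False
    then show ?thesis
      using assms(2) by (force simp: csupp_def not_le)
  qed
  then show ?thesis
    using that[of "max M 1"] by simp
qed

lemma line_of_real_has_derivative:
  assumes "smooth_alg J f"
  shows "(line j k (\<lambda>x. complex_of_real (f x)) x has_vector_derivative complex_of_real (pd j k f x)) (at 0)"
  unfolding line_def using smooth_alg_has_pd[OF assms, of x j k]
  by (intro has_vector_derivative_of_real) (simp add: has_real_derivative_iff_has_vector_derivative)

lemma pderiv_of_real:
  assumes "smooth_alg J f"
  shows "pderiv j k (\<lambda>x. complex_of_real (f x)) = (\<lambda>x. complex_of_real (pd j k f x))"
  unfolding pderiv_def by (rule ext, rule vector_derivative_at, rule line_of_real_has_derivative[OF assms])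

lemma pderivs_of_real:
  assumes "smooth_alg J f"
  shows "\<exists>g. smooth_alg J g \<and> pderivs ds (\<lambda>x. complex_of_real (f x)) = (\<lambda>x. complex_of_real (g x))"
proof (induction ds)
  case (Cons d ds)
  then show ?case
    using pderiv_of_real smooth_alg_pd by fastforce
qed (use assms in auto)

lemma line_of_real_differentiable:
  assumes "smooth_alg J f"
  shows "line j k (\<lambda>x. complex_of_real (f x)) x differentiable at 0"
  using line_of_real_has_derivative[OF assms] by (rule differentiableI_vector)

lemma smoothN_of_real:
  assumes "smooth_alg J f"
  shows "smoothN N (\<lambda>x. complex_of_real (f x))"
  unfolding smoothN_def
proof (intro allI impI)
  fix ds :: "(nat \<times> 3) list"
  obtain g where g: "smooth_alg J g" "pderivs ds (\<lambda>x. complex_of_real (f x)) = (\<lambda>x. complex_of_real (g x))"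
    using pderivs_of_real[OF assms] by blast
  then show "continuous_on (confs N) (pderivs ds (\<lambda>x. complex_of_real (f x))) \<and>
      (\<forall>j<N. \<forall>k. \<forall>x\<in>confs N. line j k (pderivs ds (\<lambda>x. complex_of_real (f x))) x differentiable at 0)"
    using line_of_real_differentiable smooth_alg_continuous
    by (auto intro: continuous_on_of_real)
qed

text \<open>A quantitative way of keeping the support away from the origins of the particles in
  \<open>J\<close>. The parameter \<open>J\<close> allows the intermediate stages in which the
  origin has been restored for some particles but not for others.\<close>

definition vanish_near_0 :: "nat set \<Rightarrow> (conf \<Rightarrow> real) \<Rightarrow> bool"
  where "vanish_near_0 J f \<longleftrightarrow> (\<exists>r>0. \<forall>x. \<forall>j\<in>J. (\<forall>k. \<bar>x j $ k\<bar> < r) \<longrightarrow> f x = 0)"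

text \<open>The support lies in the \<open>N\<close>-th power of a cube from which a smaller open
  cube around the origin has been removed. This power is compact and avoids all origins.\<close>

lemma Cc_infty_of_real:
  assumes "smooth_alg {..<N} f" "csupp {..<N} L f" "vanish_near_0 {..<N} f"
  shows "(\<lambda>x. complex_of_real (f x)) \<in> Cc_infty N (- {0})"
proof -
  obtain r where r: "r > 0" "\<And>x j. j < N \<Longrightarrow> (\<And>k. \<bar>x j $ k\<bar> < r) \<Longrightarrow> f x = 0"
    using assms(3) unfolding vanish_near_0_def by (meson lessThan_iff)
  define C where "C = {p::real^3. \<forall>k. \<bar>p $ k\<bar> \<le> L} \<inter> (\<Union>k. {p. r \<le> \<bar>p $ k\<bar>})"
  have "closed {p::real^3. r \<le> \<bar>p $ k\<bar>}" for k
    by (intro closed_Collect_le continuous_on_const continuous_on_rabs continuous_on_component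
        continuous_on_id)
  then have "compact C"
    unfolding C_def by (intro compact_Int_closed compact_cube closed_UN) auto
  then have "compact (PiE {..<N} (\<lambda>_. C))"
    by (intro compact_PiE)
  moreover have "PiE {..<N} (\<lambda>_. C) \<subseteq> PiE {..<N} (\<lambda>_. - {0})"
    using r(1) by (intro PiE_mono) (auto simp: C_def)
  moreover have "f x = 0" if x: "x \<in> confs N - PiE {..<N} (\<lambda>_. C)" for x
  proof -
    obtain j where "j < N" "x j \<notin> C"
      using x by (auto simp: confs_def PiE_iff)
    then consider k where "L < \<bar>x j $ k\<bar>" | "\<And>k. \<bar>x j $ k\<bar> < r"
      by (auto simp: C_def not_le)
    then show ?thesis
      using \<open>j < N\<close> assms(2) r(2) by cases (auto simp: csupp_def)
  qed
  ultimately have "\<exists>K. compact K \<and> K \<subseteq> PiE {..<N} (\<lambda>_. - {0}) \<and>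
      (\<forall>x\<in>confs N - K. complex_of_real (f x) = 0)"
    by (intro exI[of _ "PiE {..<N} (\<lambda>_. C)"] conjI ballI) simp_all
  then show ?thesis
    using smoothN_of_real[OF assms(1)] unfolding Cc_infty_def by blast
qed

subsection \<open>Lebesgue measure on configurations\<close>

interpretation lborel_product: product_sigma_finite "\<lambda>_::nat. lborel :: (real^3) measure" ..

lemma space_lebN: "space (lebN N) = confs N"
  by (simp add: lebN_def confs_def space_PiM)

lemma sigma_finite_lebN: "sigma_finite_measure (lebN N)"
  unfolding lebN_def by (rule lborel_product.sigma_finite) simp

lemma lebN_component_measurable [measurable]:
  "j < N \<Longrightarrow> (\<lambda>x. x j) \<in> borel_measurable (lebN N)"
  unfolding lebN_def using measurable_component_singleton[of j "{..<N}" "\<lambda>_. lborel"] by simp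

text \<open>Connects the product sigma-algebra over \<open>{..<N}\<close> with the Borel sets of the
  product topology on all of \<open>conf\<close>: coordinatewise measurability suffices, and the
  coordinates beyond \<open>N\<close> are constant on \<open>confs N\<close>. This is what makes
  continuous functions measurable.\<close>

lemma lebN_id_measurable [measurable]: "(\<lambda>x. x) \<in> borel_measurable (lebN N)"
proof (rule measurable_coordinatewise_then_product)
  fix i
  show "(\<lambda>x. x i) \<in> borel_measurable (lebN N)"
  proof (cases "i < N")
    case False
    have "(\<lambda>x. undefined :: real^3) \<in> borel_measurable (lebN N)"
      by simp
    then show ?thesis
      by (rule measurable_cong[THEN iffD1, rotated])
        (use False in \<open>auto simp: space_lebN confs_def PiE_iff extensional_def\<close>)
  qed (rule lebN_component_measurable)
qed

lemma continuous_on_confs_measurable: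
  fixes f :: "conf \<Rightarrow> 'a::topological_space"
  assumes "continuous_on (confs N) f"
  shows "f \<in> borel_measurable (lebN N)"
proof -
  have "(\<lambda>x. x) \<in> measurable (lebN N) (restrict_space borel (confs N))"
    by (rule measurable_restrict_space2) (auto simp: space_lebN)
  from measurable_compose[OF this borel_measurable_continuous_on_restrict[OF assms]]
  show ?thesis .
qed

lemma emeasure_lebN_PiE:
  "(\<And>i. i < N \<Longrightarrow> A i \<in> sets borel) \<Longrightarrow>
    emeasure (lebN N) (PiE {..<N} A) = (\<Prod>i<N. emeasure lborel (A i))"
  unfolding lebN_def by (rule lborel_product.emeasure_PiM) auto

lemma lebN_eqI:
  assumes "sets P = sets (lebN N)"
    and "\<And>A. (\<And>i. i < N \<Longrightarrow> A i \<in> sets borel) \<Longrightarrow>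
      emeasure P (PiE {..<N} A) = (\<Prod>i<N. emeasure lborel (A i))"
  shows "P = lebN N"
  unfolding lebN_def
  by (rule lborel_product.PiM_eqI) (use assms in \<open>auto simp: lebN_def\<close>)

section \<open>Translations and permutations preserve Lebesgue measure\<close>

text \<open>The restriction keeps the value \<open>undefined\<close> beyond \<open>N\<close>; a
  plain pointwise sum could leave \<open>confs N\<close>.\<close>

definition shift :: "nat \<Rightarrow> conf \<Rightarrow> conf \<Rightarrow> conf"
  where "shift N z x = (\<lambda>i\<in>{..<N}. x i + z i)"

lemma shift_in_confs [simp]: "shift N z x \<in> confs N"
  by (auto simp: shift_def confs_def)

lemma shift_apply [simp]: "i < N \<Longrightarrow> shift N z x i = x i + z i"
  by (simp add: shift_def)

lemma shift_measurable [measurable]: "shift N z \<in> measurable (lebN N) (lebN N)"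
proof -
  have "(\<lambda>x. \<lambda>i\<in>{..<N}. x i + z i) \<in> measurable (lebN N) (PiM {..<N} (\<lambda>_. borel))"
    by (rule measurable_restrict) measurable
  moreover have "sets (lebN N) = sets (PiM {..<N} (\<lambda>_. borel))"
    unfolding lebN_def by (rule sets_PiM_cong) auto
  ultimately show ?thesis
    unfolding shift_def using measurable_cong_sets by blast
qed

lemma distr_shift: "distr (lebN N) (lebN N) (shift N z) = lebN N"
proof (rule lebN_eqI)
  fix A :: "nat \<Rightarrow> (real^3) set" assume A: "\<And>i. i < N \<Longrightarrow> A i \<in> sets borel"
  have box: "PiE {..<N} A \<in> sets (lebN N)"
    unfolding lebN_def using A by (intro sets_PiM_I_finite) auto
  have vim: "(\<lambda>p. z i + p) -` A i \<in> sets borel" if "i < N" for i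
    using measurable_sets[OF _ A[OF that], of "\<lambda>p. z i + p" borel] by simp
  have "shift N z -` PiE {..<N} A \<inter> space (lebN N) = PiE {..<N} (\<lambda>i. (\<lambda>p. z i + p) -` A i)"
    by (auto simp: shift_def space_lebN confs_def PiE_iff extensional_def add.commute)
  then have "emeasure (distr (lebN N) (lebN N) (shift N z)) (PiE {..<N} A)
      = (\<Prod>i<N. emeasure lborel ((\<lambda>p. z i + p) -` A i))"
    using box vim by (simp add: emeasure_distr emeasure_lebN_PiE)
  also have "\<dots> = (\<Prod>i<N. emeasure lborel (A i))"
  proof (rule prod.cong)
    fix i assume "i \<in> {..<N}"
    then have "emeasure lborel (A i) = emeasure (distr lborel borel (\<lambda>p. z i + p)) (A i)"
      by (simp add: lborel_distr_plus)
    also have "\<dots> = emeasure lborel ((\<lambda>p. z i + p) -` A i)"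
      using A \<open>i \<in> {..<N}\<close> by (subst emeasure_distr) auto
    finally show "emeasure lborel ((\<lambda>p. z i + p) -` A i) = emeasure lborel (A i)" ..
  qed simp
  finally show "emeasure (distr (lebN N) (lebN N) (shift N z)) (PiE {..<N} A)
      = (\<Prod>i<N. emeasure lborel (A i))" .
qed simp

lemma nn_integral_shift:
  "f \<in> borel_measurable (lebN N) \<Longrightarrow> (\<integral>\<^sup>+x. f (shift N z x) \<partial>lebN N) = (\<integral>\<^sup>+x. f x \<partial>lebN N)"
  using nn_integral_distr[OF shift_measurable, of f N z] by (simp add: distr_shift)

lemma integral_shift:
  fixes f :: "conf \<Rightarrow> 'a::{banach, second_countable_topology}"
  shows "f \<in> borel_measurable (lebN N) \<Longrightarrow> (LINT x|lebN N. f (shift N z x)) = (LINT x|lebN N. f x)"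
  using integral_distr[OF shift_measurable, of f N z] by (simp add: distr_shift)

lemma integrable_shift:
  fixes f :: "conf \<Rightarrow> 'a::{banach, second_countable_topology}"
  shows "integrable (lebN N) f \<Longrightarrow> integrable (lebN N) (\<lambda>x. f (shift N z x))"
  using integrable_distr[OF shift_measurable, of N z f] by (simp add: distr_shift)

lemma perm_measurable:
  assumes "\<pi> permutes {..<N}"
  shows "(\<lambda>x. x \<circ> \<pi>) \<in> measurable (lebN N) (lebN N)"
proof -
  have "\<pi> i < N" if "i < N" for i
    using permutes_in_image[OF assms, of i] that by simp
  then have "(\<lambda>x. \<lambda>i\<in>{..<N}. x (\<pi> i)) \<in> measurable (lebN N) (PiM {..<N} (\<lambda>_. borel))"
    by (intro measurable_restrict) measurable
  moreover have "sets (lebN N) = sets (PiM {..<N} (\<lambda>_. borel))"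
    unfolding lebN_def by (rule sets_PiM_cong) auto
  ultimately have "(\<lambda>x. \<lambda>i\<in>{..<N}. x (\<pi> i)) \<in> measurable (lebN N) (lebN N)"
    using measurable_cong_sets by blast
  then show ?thesis
    by (rule measurable_cong[THEN iffD1, rotated])
      (use permutes_not_in[OF assms] in
        \<open>auto simp: space_lebN confs_def PiE_iff extensional_def fun_eq_iff\<close>)
qed

text \<open>On boxes, which determine the measure, a permutation of the particles only reorders the
  factors of a product.\<close>

lemma distr_perm:
  assumes "\<pi> permutes {..<N}"
  shows "distr (lebN N) (lebN N) (\<lambda>x. x \<circ> \<pi>) = lebN N"
proof (rule lebN_eqI)
  fix A :: "nat \<Rightarrow> (real^3) set" assume A: "\<And>i. i < N \<Longrightarrow> A i \<in> sets borel"
  let ?\<sigma> = "inv \<pi>"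
  have \<sigma>: "?\<sigma> permutes {..<N}"
    using assms by (rule permutes_inv)
  then have in_N: "?\<sigma> i < N \<longleftrightarrow> i < N" "\<pi> i < N \<longleftrightarrow> i < N" for i
    using permutes_in_image[OF \<sigma>, of i] permutes_in_image[OF assms, of i] by auto
  have box: "PiE {..<N} A \<in> sets (lebN N)"
    unfolding lebN_def using A by (intro sets_PiM_I_finite) auto
  have "(\<lambda>x. x \<circ> \<pi>) -` PiE {..<N} A \<inter> space (lebN N) = PiE {..<N} (\<lambda>i. A (?\<sigma> i))"
  proof (intro set_eqI)
    fix x :: conf
    have "(\<forall>i<N. x (\<pi> i) \<in> A i) \<longleftrightarrow> (\<forall>i<N. x i \<in> A (?\<sigma> i))"
      using in_N permutes_inverses[OF assms] by metis
    moreover have "\<pi> i = i" if "\<not> i < N" for i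
      using permutes_not_in[OF assms] that by simp
    ultimately show "x \<in> (\<lambda>x. x \<circ> \<pi>) -` PiE {..<N} A \<inter> space (lebN N) \<longleftrightarrow>
        x \<in> PiE {..<N} (\<lambda>i. A (?\<sigma> i))"
      by (auto simp: PiE_iff extensional_def space_lebN confs_def)
  qed
  then have "emeasure (distr (lebN N) (lebN N) (\<lambda>x. x \<circ> \<pi>)) (PiE {..<N} A)
      = (\<Prod>i<N. emeasure lborel (A (?\<sigma> i)))"
    using box A in_N by (simp add: emeasure_distr perm_measurable[OF assms] emeasure_lebN_PiE)
  also have "\<dots> = (\<Prod>i<N. emeasure lborel (A i))"
    using prod.permute[OF \<sigma>, of "\<lambda>i. emeasure lborel (A i)"] by (simp add: o_def)
  finally show "emeasure (distr (lebN N) (lebN N) (\<lambda>x. x \<circ> \<pi>)) (PiE {..<N} A)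
      = (\<Prod>i<N. emeasure lborel (A i))" .
qed simp

lemma integral_perm:
  fixes f :: "conf \<Rightarrow> complex"
  assumes "\<pi> permutes {..<N}" "f \<in> borel_measurable (lebN N)"
  shows "(LINT x|lebN N. f (x \<circ> \<pi>)) = (LINT x|lebN N. f x)"
  using integral_distr[OF perm_measurable[OF assms(1)] assms(2)] by (simp add: distr_perm assms(1))

lemma integrable_perm:
  fixes f :: "conf \<Rightarrow> 'a::{banach, second_countable_topology}"
  assumes "\<pi> permutes {..<N}" "integrable (lebN N) f"
  shows "integrable (lebN N) (\<lambda>x. f (x \<circ> \<pi>))"
  using integrable_distr[OF perm_measurable[OF assms(1)], of f] assms by (simp add: distr_perm)

text \<open>Sup-norm balls in place of Euclidean ones: they are boxes, so the measures needed later
  are finite products.\<close>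

definition cube :: "real^3 \<Rightarrow> real \<Rightarrow> (real^3) set"
  where "cube c r = {p. \<forall>k. \<bar>p $ k - c $ k\<bar> \<le> r}"

lemma cube_eq_cbox: "cube c r = cbox (\<chi> k. c $ k - r) (\<chi> k. c $ k + r)"
  by (force simp: cube_def mem_box_cart abs_le_iff algebra_simps)

lemma cube_sets [measurable]: "cube c r \<in> sets borel"
  by (simp add: cube_eq_cbox)

lemma emeasure_cube: 
  assumes "r \<ge> 0"
  shows "emeasure lborel (cube c r) = ennreal ((2 * r) ^ 3)"
proof -
  have ne: "cbox (\<chi> k. c $ k - r) (\<chi> k. c $ k + r :: real^3) \<noteq> {}"
    using assms by (auto simp: interval_ne_empty_cart)
  have "emeasure lborel (cube c r) = ennreal (measure lborel (cbox (\<chi> k. c $ k - r) (\<chi> k. c $ k + r)))"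
    unfolding cube_eq_cbox by (rule emeasure_eq_ennreal_measure) (simp add: emeasure_lborel_cbox_eq)
  also have "measure lborel (cbox (\<chi> k. c $ k - r) (\<chi> k. c $ k + r)) = (2 * r) ^ 3"
    using content_cbox_cart[OF ne] by simp
  finally show ?thesis .
qed

subsection \<open>Integration by parts\<close>

definition cubeN :: "nat \<Rightarrow> real \<Rightarrow> conf set"
  where "cubeN N L = PiE {..<N} (\<lambda>_. cube 0 L)"

lemma cubeN_sets [measurable]: "cubeN N L \<in> sets (lebN N)"
  unfolding cubeN_def lebN_def by (intro sets_PiM_I_finite) auto

lemma mem_cubeN: "x \<in> cubeN N L \<longleftrightarrow> x \<in> confs N \<and> (\<forall>j<N. \<forall>k. \<bar>x j $ k\<bar> \<le> L)"
  by (auto simp: cubeN_def confs_def cube_def PiE_iff)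

lemma emeasure_cubeN: "L \<ge> 0 \<Longrightarrow> emeasure (lebN N) (cubeN N L) = ennreal (((2 * L) ^ 3) ^ N)"
  unfolding cubeN_def by (simp add: emeasure_lebN_PiE emeasure_cube ennreal_power)

lemma cubeN_mono: "L \<le> L' \<Longrightarrow> cubeN N L \<subseteq> cubeN N L'"
  by (auto simp: mem_cubeN) (meson order_trans)

lemma emeasure_cubeN_finite: "emeasure (lebN N) (cubeN N L) < \<infinity>"
proof -
  have "cubeN N L \<subseteq> cubeN N \<bar>L\<bar>"
    by (intro cubeN_mono) simp
  then have "emeasure (lebN N) (cubeN N L) \<le> emeasure (lebN N) (cubeN N \<bar>L\<bar>)"
    by (rule emeasure_mono) simp
  also have "\<dots> < \<infinity>"
    by (simp add: emeasure_cubeN)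
  finally show ?thesis .
qed

lemma integrable_indicator_cubeN: "integrable (lebN N) (\<lambda>x. M * indicator (cubeN N L) x :: real)"
  using emeasure_cubeN_finite[of N L] by (intro integrable_mult_right) (simp add: integrable_indicator_iff cubeN_sets)

lemma coord_le_sum:
  fixes x :: conf
  assumes "j < N"
  shows "\<bar>x j $ k\<bar> \<le> (\<Sum>j<N. \<Sum>k\<in>UNIV. \<bar>x j $ k\<bar>)"
proof -
  have "\<bar>x j $ k\<bar> \<le> (\<Sum>k\<in>UNIV. \<bar>x j $ k\<bar>)"
    by (rule member_le_sum) auto
  also have "\<dots> \<le> (\<Sum>j<N. \<Sum>k\<in>UNIV. \<bar>x j $ k\<bar>)"
    by (rule member_le_sum[of j "{..<N}" "\<lambda>j. \<Sum>k\<in>UNIV. \<bar>x j $ k\<bar>"])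
      (use assms in \<open>auto intro: sum_nonneg\<close>)
  finally show ?thesis .
qed

lemma compact_subset_cubeN:
  assumes "compact K" "K \<subseteq> confs N"
  shows "\<exists>L. K \<subseteq> cubeN N L"
proof -
  have "continuous_on K (\<lambda>x. \<Sum>j<N. \<Sum>k\<in>UNIV. \<bar>x j $ k\<bar>)"
    by (intro continuous_on_sum continuous_on_rabs continuous_on_component)
      (rule continuous_on_subset[OF continuous_on_product_coordinates], simp)
  from compact_imp_bounded[OF compact_continuous_image[OF this assms(1)]] obtain L
    where "\<forall>v\<in>(\<lambda>x. \<Sum>j<N. \<Sum>k\<in>UNIV. \<bar>x j $ k\<bar>) ` K. \<bar>v\<bar> \<le> L"
    unfolding bounded_real by blast
  then have L: "(\<Sum>j<N. \<Sum>k\<in>UNIV. \<bar>x j $ k\<bar>) \<le> L" if "x \<in> K" for x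
    using that by (meson abs_le_D1 imageI)
  have "\<bar>x j $ k\<bar> \<le> L" if "x \<in> K" "j < N" for x j k
    using coord_le_sum[OF that(2), of x k] L[OF that(1)] by linarith
  then show ?thesis
    using assms(2) by (intro exI[of _ L]) (auto simp: mem_cubeN)
qed

lemma compact_support_bounded:
  fixes f :: "conf \<Rightarrow> complex"
  assumes "continuous_on (confs N) f" "compact K" "K \<subseteq> confs N" "\<And>x. x \<in> confs N - K \<Longrightarrow> f x = 0"
  shows "\<exists>M\<ge>0. \<forall>x\<in>confs N. norm (f x) \<le> M"
proof -
  have "bounded (f ` K)"
    by (intro compact_imp_bounded compact_continuous_image continuous_on_subset[OF assms(1)] assms)
  then obtain M where M: "\<And>x. x \<in> K \<Longrightarrow> norm (f x) \<le> M"
    unfolding bounded_iff by blast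
  have "norm (f x) \<le> max M 0" if "x \<in> confs N" for x
    using M[of x] assms(4)[of x] that by (cases "x \<in> K") auto
  then show ?thesis
    by (intro exI[of _ "max M 0"]) auto
qed

lemma integrable_bounded_support:
  fixes f :: "conf \<Rightarrow> 'a::{banach, second_countable_topology}"
  assumes "f \<in> borel_measurable (lebN N)" "\<And>x. x \<in> confs N \<Longrightarrow> norm (f x) \<le> M"
    and "\<And>x. x \<in> confs N - cubeN N L \<Longrightarrow> f x = 0"
  shows "integrable (lebN N) f"
proof (rule Bochner_Integration.integrable_bound[OF integrable_indicator_cubeN[of N M L] assms(1)])
  show "AE x in lebN N. norm (f x) \<le> norm (M * indicator (cubeN N L) x)"
    using assms(2,3) by (intro AE_I2) (fastforce simp: space_lebN indicator_def)
qed

lemma integrable_compact_support: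
  fixes f :: "conf \<Rightarrow> complex"
  assumes "continuous_on (confs N) f" "compact K" "K \<subseteq> confs N" "\<And>x. x \<in> confs N - K \<Longrightarrow> f x = 0"
  shows "integrable (lebN N) f"
proof -
  obtain M where "\<And>x. x \<in> confs N \<Longrightarrow> norm (f x) \<le> M"
    using compact_support_bounded[OF assms] by blast
  moreover obtain L where "K \<subseteq> cubeN N L"
    using compact_subset_cubeN[OF assms(2,3)] by blast
  ultimately show ?thesis
    using assms(4) by (intro integrable_bounded_support[of f N M L] continuous_on_confs_measurable assms) auto
qed

lemma line_in_confs: "j < N \<Longrightarrow> x \<in> confs N \<Longrightarrow> x(j := x j + p) \<in> confs N"
  by (auto simp: confs_def PiE_iff extensional_def)

lemma shift_single:
  "j < N \<Longrightarrow> x \<in> confs N \<Longrightarrow> shift N (\<lambda>i. if i = j then p else 0) x = x(j := x j + p)"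
  by (auto simp: confs_def PiE_iff extensional_def shift_def)

lemma continuous_on_line: "continuous_on UNIV (\<lambda>t. x(j := x j + t *\<^sub>R p) :: conf)"
proof (rule continuous_on_coordinatewise_then_product)
  fix i
  show "continuous_on UNIV (\<lambda>t. (x(j := x j + t *\<^sub>R p)) i)"
    by (cases "i = j") (auto intro!: continuous_intros)
qed

text \<open>Translation invariance makes the integrals of the difference quotients of \<open>g\<close> vanish.\<close>

lemma integral_partial_derivative_eq_0:
  fixes g g' :: "conf \<Rightarrow> complex"
  assumes j: "j < N"
    and der: "\<And>x. x \<in> confs N \<Longrightarrow> (line j k g x has_vector_derivative g' x) (at 0)"
    and cont: "continuous_on (confs N) g" "continuous_on (confs N) g'"
    and K: "compact K" "K \<subseteq> confs N" "\<And>x. x \<in> confs N - K \<Longrightarrow> g x = 0"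
  shows "integrable (lebN N) g'" "(LINT x|lebN N. g' x) = 0"
proof -
  let ?e = "axis k 1 :: real^3"
  let ?sh = "\<lambda>t. shift N (\<lambda>i. if i = j then t *\<^sub>R ?e else 0)"
  have sh: "?sh t x = x(j := x j + t *\<^sub>R ?e)" if "x \<in> confs N" for t x
    using shift_single[OF j that] .
  \<comment> \<open>The complement of the compact set \<open>K\<close> is open, so \<open>g\<close>
    vanishes along a whole piece of the line through \<open>x\<close>.\<close>
  have g'0: "g' x = 0" if x: "x \<in> confs N - K" for x
  proof -
    let ?S = "(\<lambda>t. x(j := x j + t *\<^sub>R ?e)) -` (- K)"
    have "open ?S"
      by (intro open_vimage continuous_on_line) (simp add: K(1) compact_imp_closed open_Compl)
    moreover have "0 \<in> ?S"
      using x by simp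
    moreover have "line j k g x t = 0" if "t \<in> ?S" for t
      using that x line_in_confs[OF j] K(3) by (simp add: line_def del: fun_upd_apply)
    ultimately have "((\<lambda>t. 0) has_vector_derivative g' x) (at 0)"
      using x by (intro has_vector_derivative_transform_within_open[OF der]) auto
    then show ?thesis
      using vector_derivative_unique_at[OF _ has_vector_derivative_const] by blast
  qed
  obtain M where M: "M \<ge> 0" "\<And>x. x \<in> confs N \<Longrightarrow> norm (g' x) \<le> M"
    using compact_support_bounded[OF cont(2) K(1,2) g'0] by blast
  have der_t: "(line j k g x has_vector_derivative g' (x(j := x j + t *\<^sub>R ?e))) (at t)"
    if "x \<in> confs N" for x t
  proof -
    let ?y = "x(j := x j + t *\<^sub>R ?e)"
    have "(line j k g ?y has_vector_derivative g' ?y) (at (t - t))"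
      using der line_in_confs[OF j that] by simp
    moreover have "((\<lambda>s. s - t) has_vector_derivative 1) (at t)"
      by (auto intro!: derivative_eq_intros)
    ultimately have "(line j k g ?y \<circ> (\<lambda>s. s - t) has_vector_derivative 1 *\<^sub>R g' ?y) (at t)"
      by (intro vector_diff_chain_at)
    moreover have "line j k g ?y \<circ> (\<lambda>s. s - t) = line j k g x"
      by (auto simp: line_def algebra_simps)
    ultimately show ?thesis by simp
  qed
  \<comment> \<open>The mean value inequality bounds all difference quotients by \<open>M\<close>,
    which provides the dominating function for the limit.\<close>
  have lip: "norm (g (?sh t x) - g x) \<le> M * \<bar>t\<bar>" if "x \<in> confs N" for x t
  proof -
    have "norm (line j k g x t - line j k g x 0) \<le> M * norm (t - 0)"
    proof (rule differentiable_bound)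
      show "(line j k g x has_derivative (\<lambda>h. h *\<^sub>R g' (x(j := x j + s *\<^sub>R ?e)))) (at s within UNIV)" for s
        using der_t[OF that, of s] by (simp add: has_vector_derivative_def)
      show "onorm (\<lambda>h. h *\<^sub>R g' (x(j := x j + s *\<^sub>R ?e))) \<le> M" for s
        using M(2)[OF line_in_confs[OF j that]]
        by (intro onorm_le) (simp add: mult.commute[of M] mult_left_mono)
    qed auto
    then show ?thesis
      using sh[OF that] by (simp add: line_def)
  qed
  obtain L where L: "K \<subseteq> cubeN N L"
    using compact_subset_cubeN[OF K(1,2)] by blast
  have int_g: "integrable (lebN N) g"
    using integrable_compact_support[OF cont(1) K] .
  show "integrable (lebN N) g'"
    using integrable_compact_support[OF cont(2) K(1,2) g'0] .
  define q where "q n x = (g (?sh (1 / Suc n) x) - g x) * of_nat (Suc n)" for n x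
  have q_int: "(LINT x|lebN N. q n x) = 0" for n
    unfolding q_def using int_g integrable_shift[OF int_g]
    by (simp add: integral_shift borel_measurable_integrable)
  \<comment> \<open>Steps of length \<open>1 / Suc n\<close> are at most 1, so all quotients vanish
    outside the cube enlarged by 1, whatever \<open>n\<close> is.\<close>
  have bound: "norm (q n x) \<le> M * indicator (cubeN N (L + 1)) x" if x: "x \<in> confs N" for n x
  proof (cases "x \<in> cubeN N (L + 1)")
    case True
    have "norm (q n x) = norm (g (?sh (1 / Suc n) x) - g x) * Suc n"
      by (simp add: q_def norm_mult norm_of_nat del: of_nat_Suc)
    also have "\<dots> \<le> M * \<bar>1 / Suc n\<bar> * Suc n"
      using lip[OF x, of "1 / Suc n"] by (intro mult_right_mono) auto
    finally have "norm (q n x) \<le> M"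
      by simp
    then show ?thesis
      using True by simp
  next
    case False
    have "x \<notin> K"
      using False L cubeN_mono[of L "L + 1" N] by auto
    moreover have "?sh (1 / Suc n) x \<notin> K"
    proof
      assume "?sh (1 / Suc n) x \<in> K"
      then have "?sh (1 / Suc n) x \<in> cubeN N L"
        using L by blast
      then have L': "\<And>i l. i < N \<Longrightarrow> \<bar>?sh (1 / Suc n) x i $ l\<bar> \<le> L"
        unfolding mem_cubeN by blast
      have "\<bar>x i $ l\<bar> \<le> L + 1" if "i < N" for i l
      proof -
        have "\<bar>(if i = j then (1 / Suc n) *\<^sub>R ?e else 0) $ l\<bar> \<le> 1"
          by (auto simp: axis_def)
        then show ?thesis
          using L'[OF that, of l] that by (simp split: if_splits)
      qed
      then show False
        using False x by (auto simp: mem_cubeN)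
    qed
    ultimately show ?thesis
      using K(3) x M(1) by (simp add: q_def)
  qed
  have lim: "(\<lambda>n. q n x) \<longlonglongrightarrow> g' x" if x: "x \<in> confs N" for x
  proof -
    have "((\<lambda>h. (1 / h) *\<^sub>R (line j k g x (0 + h) - line j k g x 0 - h *\<^sub>R g' x)) \<longlongrightarrow> 0) (at 0)"
      using der[OF x] unfolding has_vector_derivative_def has_derivative_at
      by (subst tendsto_norm_zero_iff[symmetric]) simp
    then have "(\<lambda>n. (1 / inverse (real (Suc n))) *\<^sub>R (line j k g x (0 + inverse (real (Suc n)))
        - line j k g x 0 - inverse (real (Suc n)) *\<^sub>R g' x)) \<longlonglongrightarrow> 0"
      by (rule filterlim_compose)
        (auto simp: filterlim_at simp del: of_nat_Suc intro!: LIMSEQ_inverse_real_of_nat)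
    moreover have "(1 / inverse (real (Suc n))) *\<^sub>R (line j k g x (0 + inverse (real (Suc n)))
        - line j k g x 0 - inverse (real (Suc n)) *\<^sub>R g' x) = q n x - g' x" for n
      using sh[OF x] by (simp add: q_def line_def scaleR_conv_of_real inverse_eq_divide right_diff_distrib
          del: of_nat_Suc) (simp add: algebra_simps)
    ultimately show ?thesis
      by (simp add: LIM_zero_iff)
  qed
  have "(\<lambda>n. LINT x|lebN N. q n x) \<longlonglongrightarrow> (LINT x|lebN N. g' x)"
  proof (rule integral_dominated_convergence[where w = "\<lambda>x. M * indicator (cubeN N (L + 1)) x"])
    show "g' \<in> borel_measurable (lebN N)"
      by (rule continuous_on_confs_measurable[OF cont(2)])
    have [measurable]: "g \<in> borel_measurable (lebN N)"
      by (rule continuous_on_confs_measurable[OF cont(1)])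
    show "q n \<in> borel_measurable (lebN N)" for n
      unfolding q_def by measurable
    show "integrable (lebN N) (\<lambda>x. M * indicator (cubeN N (L + 1)) x)"
      by (rule integrable_indicator_cubeN)
  qed (use bound lim in \<open>auto simp: space_lebN\<close>)
  then show "(LINT x|lebN N. g' x) = 0"
    by (simp add: q_int LIMSEQ_const_iff)
qed

lemma smooth_alg_measurable [measurable_dest]:
  "smooth_alg J f \<Longrightarrow> f \<in> borel_measurable (lebN N)"
  by (intro continuous_on_confs_measurable smooth_alg_continuous)

lemma csupp_cubeN: "csupp {..<N} L f \<Longrightarrow> x \<in> confs N - cubeN N L \<Longrightarrow> f x = 0"
  by (force simp: csupp_def mem_cubeN not_le)

text \<open>The product rule is applied to \<open>\<eta> x * f x\<close>, whose compact support
  comes from \<open>\<eta>\<close> alone. It identifies the classical derivatives of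
  \<open>f\<close> as weak ones.\<close>

lemma integration_by_parts:
  assumes \<eta>: "\<eta> \<in> Cc_infty N UNIV" and j: "j < N"
    and f: "smooth_alg {..<N} f"
  shows "(LINT x|lebN N. pderiv j k \<eta> x * of_real (f x)) = - (LINT x|lebN N. \<eta> x * of_real (pd j k f x))"
proof -
  obtain K where K: "compact K" "K \<subseteq> confs N" "\<And>x. x \<in> confs N - K \<Longrightarrow> \<eta> x = 0"
    and sm: "smoothN N \<eta>"
    using \<eta> by (auto simp: Cc_infty_def confs_def)
  have c\<eta>: "continuous_on (confs N) \<eta>"
    and der: "\<And>x. x \<in> confs N \<Longrightarrow> line j k \<eta> x differentiable at 0"
    using sm[unfolded smoothN_def, rule_format, of "[]"] j by auto
  have c\<eta>': "continuous_on (confs N) (pderiv j k \<eta>)"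
    using sm[unfolded smoothN_def, rule_format, of "[(j, k)]"] j by auto
  have cf: "continuous_on (confs N) (\<lambda>x. complex_of_real (f x))"
    "continuous_on (confs N) (\<lambda>x. complex_of_real (pd j k f x))"
    by (intro continuous_on_of_real smooth_alg_continuous[OF f]
        smooth_alg_continuous[OF smooth_alg_pd[OF f]])+
  let ?g' = "\<lambda>x. \<eta> x * of_real (pd j k f x) + pderiv j k \<eta> x * of_real (f x)"
  have d: "(line j k (\<lambda>x. \<eta> x * of_real (f x)) x has_vector_derivative ?g' x) (at 0)"
    if x: "x \<in> confs N" for x
  proof -
    have "(line j k \<eta> x has_vector_derivative pderiv j k \<eta> x) (at 0)"
      unfolding pderiv_def using der[OF x] vector_derivative_works by blast
    moreover have "(line j k (\<lambda>x. of_real (f x)) x has_vector_derivative complex_of_real (pd j k f x)) (at 0)"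
      by (rule line_of_real_has_derivative[OF f])
    ultimately have "((\<lambda>t. line j k \<eta> x t * line j k (\<lambda>x. of_real (f x)) x t) has_vector_derivative
        line j k \<eta> x 0 * of_real (pd j k f x) + pderiv j k \<eta> x * line j k (\<lambda>x. of_real (f x)) x 0) (at 0)"
      by (rule has_vector_derivative_mult)
    then show ?thesis
      by (simp add: line_def[abs_def] del: fun_upd_apply)
  qed
  have c: "continuous_on (confs N) (\<lambda>x. \<eta> x * of_real (f x))" "continuous_on (confs N) ?g'"
    by (intro continuous_intros c\<eta> c\<eta>' cf)+
  have "(LINT x|lebN N. ?g' x) = 0"
    by (rule integral_partial_derivative_eq_0(2)[OF j d c K(1,2)]) (use K(3) in auto)
  moreover have "integrable (lebN N) (\<lambda>x. \<eta> x * of_real (pd j k f x))"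
    by (rule integrable_compact_support[OF continuous_on_mult[OF c\<eta> cf(2)] K(1,2)]) (use K(3) in auto)
  \<comment> \<open>Obtained as a difference of integrable functions, which avoids determining the
    support of \<open>pderiv j k \<eta>\<close>.\<close>
  moreover have "integrable (lebN N) (\<lambda>x. pderiv j k \<eta> x * of_real (f x))"
  proof -
    have "integrable (lebN N) (\<lambda>x. ?g' x - \<eta> x * of_real (pd j k f x))"
      by (intro Bochner_Integration.integrable_diff calculation(2)
          integral_partial_derivative_eq_0(1)[OF j d c K(1,2)]) (use K(3) in auto)
    then show ?thesis by simp
  qed
  ultimately show ?thesis
    by (simp add: add_eq_0_iff)
qed

subsection \<open>Test spinors and symmetrization\<close>

definition square_int :: "nat \<Rightarrow> (conf \<Rightarrow> complex) \<Rightarrow> bool"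
  where "square_int N f \<longleftrightarrow> f \<in> borel_measurable (lebN N) \<and> integrable (lebN N) (\<lambda>x. (cmod (f x))\<^sup>2)"

lemma L2_iff: "\<psi> \<in> L2 N \<longleftrightarrow> (\<forall>s\<in>spins N. square_int N (\<lambda>x. \<psi> x s))"
  by (simp add: L2_def square_int_def)

lemma spins_nonempty: "spins N \<noteq> {}"
  by (simp add: spins_def PiE_eq_empty_iff)

lemma finite_spins: "finite (spins N)"
  by (simp add: spins_def finite_PiE)

text \<open>A scalar function is regarded as a wave function constant in the spin index, so the
  closure properties of \<open>L2\<close> carry over to scalars.\<close>

lemma square_int_iff_L2: "square_int N f \<longleftrightarrow> (\<lambda>x s. f x) \<in> L2 N"
  using spins_nonempty[of N] by (auto simp: L2_iff)

lemma square_int_zero: "square_int N (\<lambda>x. 0)"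
  by (simp add: square_int_def)

lemma square_int_scale: "square_int N f \<Longrightarrow> square_int N (\<lambda>x. a * f x)"
  unfolding square_int_iff_L2 by (rule L2_scale)

lemma square_int_add: "square_int N f \<Longrightarrow> square_int N g \<Longrightarrow> square_int N (\<lambda>x. f x + g x)"
  unfolding square_int_iff_L2 by (rule L2_add)

lemma square_int_sum:
  "finite A \<Longrightarrow> (\<And>i. i \<in> A \<Longrightarrow> square_int N (f i)) \<Longrightarrow> square_int N (\<lambda>x. \<Sum>i\<in>A. f i x)"
  by (induction A rule: finite_induct) (simp_all add: square_int_zero square_int_add)

lemma square_int_cnj: "square_int N f \<Longrightarrow> square_int N (\<lambda>x. cnj (f x))"
  unfolding square_int_def
  by (auto intro: borel_measurable_continuous_on[OF continuous_on_cnj[OF continuous_on_id]])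

lemma two_mult_le_squares: "2 * (a * b) \<le> (a::real)\<^sup>2 + b\<^sup>2"
  using sum_squares_bound[of a b] by (simp add: mult.assoc)

lemma integrable_square_int_mult:
  assumes "square_int N f" "square_int N g"
  shows "integrable (lebN N) (\<lambda>x. f x * g x)"
proof (rule Bochner_Integration.integrable_bound)
  show "integrable (lebN N) (\<lambda>x. (cmod (f x))\<^sup>2 + (cmod (g x))\<^sup>2)"
    using assms by (auto simp: square_int_def)
  show "(\<lambda>x. f x * g x) \<in> borel_measurable (lebN N)"
    using assms by (auto simp: square_int_def)
  have "norm (f x * g x) \<le> (cmod (f x))\<^sup>2 + (cmod (g x))\<^sup>2" for x
    unfolding norm_mult using two_mult_le_squares[of "cmod (f x)" "cmod (g x)"]
      mult_nonneg_nonneg[OF norm_ge_zero norm_ge_zero, of "f x" "g x"] by linarith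
  then show "AE x in lebN N. norm (f x * g x) \<le> norm ((cmod (f x))\<^sup>2 + (cmod (g x))\<^sup>2)"
    by simp
qed

lemma square_int_bounded_support:
  assumes "f \<in> borel_measurable (lebN N)" "\<And>x. x \<in> confs N \<Longrightarrow> cmod (f x) \<le> M"
    and "\<And>x. x \<in> confs N - cubeN N L \<Longrightarrow> f x = 0"
  shows "square_int N f"
  unfolding square_int_def
proof (intro conjI integrable_bounded_support[where M = "M\<^sup>2" and L = L])
  show "norm ((cmod (f x))\<^sup>2) \<le> M\<^sup>2" if "x \<in> confs N" for x
    using assms(2)[OF that] by (simp add: power_mono)
qed (use assms in auto)

lemma square_int_of_real:
  assumes "smooth_alg {..<N} f" "csupp {..<N} L f"
  shows "square_int N (\<lambda>x. complex_of_real (f x))"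
proof -
  obtain M where "\<And>x. \<bar>f x\<bar> \<le> M"
    using smooth_alg_bounded[OF assms] by blast
  then show ?thesis
    using csupp_cubeN[OF assms(2)] smooth_alg_measurable[OF assms(1), of N]
    by (intro square_int_bounded_support[where M = M and L = L]) auto
qed

section \<open>Real test fields and the classical Dirac operator on them\<close>

text \<open>Real components suffice: the test functions to be inserted are real, and exchange signs
  are real as well, so symmetrization stays within this class. Complex numbers enter through the
  Dirac matrices.\<close>

definition field :: "(spin \<Rightarrow> conf \<Rightarrow> real) \<Rightarrow> wavefun"
  where "field F = (\<lambda>x s. of_real (F s x))"

definition test_field :: "nat \<Rightarrow> (spin \<Rightarrow> conf \<Rightarrow> real) \<Rightarrow> bool"
  where "test_field N F \<longleftrightarrow> (\<exists>L. \<forall>s. smooth_alg {..<N} (F s) \<and> csupp {..<N} L (F s))"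

lemma field_L2: "test_field N F \<Longrightarrow> field F \<in> L2 N"
  unfolding L2_iff field_def test_field_def using square_int_of_real by blast

lemma test_field_pd: "test_field N F \<Longrightarrow> test_field N (\<lambda>s. pd j k (F s))"
  unfolding test_field_def using smooth_alg_pd csupp_pd by blast

lemma weak_pderiv_field:
  assumes "test_field N F" "j < N"
  shows "weak_pderiv N j k (field F) (field (\<lambda>s. pd j k (F s)))"
proof -
  have "smooth_alg {..<N} (F s)" for s
    using assms(1) unfolding test_field_def by blast
  then show ?thesis
    unfolding weak_pderiv_def
    using field_L2[OF assms(1)] field_L2[OF test_field_pd[OF assms(1)]] integration_by_parts[OF _ assms(2)]
    by (simp add: field_def)
qed

definition particle_op ::
    "real \<Rightarrow> real \<Rightarrow> real \<Rightarrow> nat \<Rightarrow> (spin \<Rightarrow> conf \<Rightarrow> real) \<Rightarrow> wavefun"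
  where "particle_op c hbar m j F = (\<lambda>x s.
    - \<i> * of_real (c * hbar) * (\<Sum>k\<in>UNIV. spin_op j (dirac_alpha k) (field (\<lambda>s. pd j k (F s))) x s)
    + of_real (m * c\<^sup>2) * spin_op j dirac_beta (field F) x s)"

definition dirac_op ::
    "real \<Rightarrow> real \<Rightarrow> real \<Rightarrow> nat \<Rightarrow> (spin \<Rightarrow> conf \<Rightarrow> real) \<Rightarrow> wavefun"
  where "dirac_op c hbar m N F = (\<lambda>x s. \<Sum>j<N. particle_op c hbar m j F x s)"

lemma spins_upd: "s \<in> spins N \<Longrightarrow> j < N \<Longrightarrow> s(j := b) \<in> spins N"
  by (auto simp: spins_def PiE_iff extensional_def)

lemma spin_op_L2: "\<psi> \<in> L2 N \<Longrightarrow> j < N \<Longrightarrow> spin_op j A \<psi> \<in> L2 N"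
  unfolding L2_iff spin_op_def
  by (intro ballI square_int_sum square_int_scale) (auto intro: spins_upd simp del: fun_upd_apply)

lemma L2_sum: "finite A \<Longrightarrow> (\<And>i. i \<in> A \<Longrightarrow> \<psi> i \<in> L2 N) \<Longrightarrow> (\<lambda>x s. \<Sum>i\<in>A. \<psi> i x s) \<in> L2 N"
  unfolding L2_iff by (auto intro: square_int_sum)

lemma particle_op_L2: "test_field N F \<Longrightarrow> j < N \<Longrightarrow> particle_op c hbar m j F \<in> L2 N"
  unfolding particle_op_def
  by (intro L2_add L2_scale L2_sum spin_op_L2 field_L2 test_field_pd) auto

lemma dirac_op_L2: "test_field N F \<Longrightarrow> dirac_op c hbar m N F \<in> L2 N"
  unfolding dirac_op_def by (intro L2_sum particle_op_L2) auto

lemma dirac_sum_field: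
  assumes "test_field N F"
  shows "dirac_sum c hbar m N (field F) (dirac_op c hbar m N F)"
proof -
  have "dirac_particle c hbar m N j (field F) (particle_op c hbar m j F)" if "j < N" for j
    unfolding dirac_particle_def
    using weak_pderiv_field[OF assms that] particle_op_L2[OF assms that]
    by (intro conjI exI[of _ "\<lambda>k. field (\<lambda>s. pd j k (F s))"]) (auto simp: particle_op_def ae_eq_refl)
  then show ?thesis
    unfolding dirac_sum_def using field_L2[OF assms] dirac_op_L2[OF assms]
    by (intro conjI exI[of _ "\<lambda>j. particle_op c hbar m j F"]) (auto simp: dirac_op_def ae_eq_refl)
qed

text \<open>Constant sequences witness membership in the closure.\<close>

lemma dirac_free_field:
  assumes "test_field N F"
  shows "dirac_free c hbar m N (field F) (dirac_op c hbar m N F)"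
  unfolding dirac_free_def using field_L2[OF assms] dirac_op_L2[OF assms] dirac_sum_field[OF assms]
  by (intro conjI exI[of _ "\<lambda>n. field F"] exI[of _ "\<lambda>n. dirac_op c hbar m N F"])
    (auto simp: l2_norm_def l2_inner_def)

lemma l2_inner_sum_left:
  assumes "finite A" "\<And>i. i \<in> A \<Longrightarrow> \<psi> i \<in> L2 N" "\<phi> \<in> L2 N"
  shows "l2_inner N (\<lambda>x s. \<Sum>i\<in>A. a i * \<psi> i x s) \<phi> = (\<Sum>i\<in>A. cnj (a i) * l2_inner N (\<psi> i) \<phi>)"
proof -
  have int: "integrable (lebN N) (\<lambda>x. cnj (\<psi> i x s) * \<phi> x s)" if "i \<in> A" "s \<in> spins N" for i s
    using assms that by (intro integrable_square_int_mult square_int_cnj) (auto simp: L2_iff)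
  have "(LINT x|lebN N. cnj (\<Sum>i\<in>A. a i * \<psi> i x s) * \<phi> x s)
      = (\<Sum>i\<in>A. cnj (a i) * (LINT x|lebN N. cnj (\<psi> i x s) * \<phi> x s))" if s: "s \<in> spins N" for s
  proof -
    have "(LINT x|lebN N. cnj (\<Sum>i\<in>A. a i * \<psi> i x s) * \<phi> x s)
        = (LINT x|lebN N. (\<Sum>i\<in>A. cnj (a i) * (cnj (\<psi> i x s) * \<phi> x s)))"
      by (simp add: sum_distrib_right mult.assoc)
    also have "\<dots> = (\<Sum>i\<in>A. LINT x|lebN N. cnj (a i) * (cnj (\<psi> i x s) * \<phi> x s))"
      by (intro Bochner_Integration.integral_sum integrable_mult_right int s)
    finally show ?thesis by simp
  qed
  then show ?thesis
    unfolding l2_inner_def by (simp add: sum_distrib_left) (rule sum.swap)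
qed

lemma l2_inner_cnj: "cnj (l2_inner N \<psi> \<phi>) = l2_inner N \<phi> \<psi>"
proof -
  have "cnj (LINT x|lebN N. cnj (\<psi> x s) * \<phi> x s) = (LINT x|lebN N. cnj (\<phi> x s) * \<psi> x s)" for s
    using Bochner_Integration.integral_cnj[of "lebN N" "\<lambda>x. cnj (\<psi> x s) * \<phi> x s"] by (simp add: mult.commute)
  then show ?thesis
    by (simp add: l2_inner_def)
qed

lemma l2_inner_sum_right:
  assumes "finite A" "\<And>i. i \<in> A \<Longrightarrow> \<psi> i \<in> L2 N" "\<phi> \<in> L2 N"
  shows "l2_inner N \<phi> (\<lambda>x s. \<Sum>i\<in>A. a i * \<psi> i x s) = (\<Sum>i\<in>A. a i * l2_inner N \<phi> (\<psi> i))"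
  using arg_cong[where f = cnj, OF l2_inner_sum_left[OF assms, where a = a]] by (simp add: l2_inner_cnj)

section \<open>Permutations of wave functions and symmetrization\<close>

definition permute :: "(nat \<Rightarrow> nat) \<Rightarrow> wavefun \<Rightarrow> wavefun"
  where "permute \<pi> \<psi> = (\<lambda>x s. \<psi> (x \<circ> \<pi>) (s \<circ> \<pi>))"

lemma comp_permutes_spins: "\<pi> permutes {..<N} \<Longrightarrow> s \<in> spins N \<Longrightarrow> s \<circ> \<pi> \<in> spins N"
  by (auto simp: spins_def PiE_iff extensional_def permutes_def)

lemma permute_L2:
  assumes "\<pi> permutes {..<N}" "\<psi> \<in> L2 N"
  shows "permute \<pi> \<psi> \<in> L2 N"
  unfolding L2_iff
proof
  fix s assume "s \<in> spins N"
  then have *: "square_int N (\<lambda>x. \<psi> x (s \<circ> \<pi>))"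
    using assms comp_permutes_spins by (auto simp: L2_iff)
  then show "square_int N (\<lambda>x. permute \<pi> \<psi> x s)"
    unfolding square_int_def permute_def
    using integrable_perm[OF assms(1), of "\<lambda>x. (cmod (\<psi> x (s \<circ> \<pi>)))\<^sup>2"]
      measurable_compose[OF perm_measurable[OF assms(1)], of "\<lambda>x. \<psi> x (s \<circ> \<pi>)" borel]
    by auto
qed

lemma comp_permutes_inv:
  "\<pi> permutes A \<Longrightarrow> (x \<circ> \<pi>) \<circ> inv \<pi> = x" "\<pi> permutes A \<Longrightarrow> (x \<circ> inv \<pi>) \<circ> \<pi> = x"
  by (simp_all add: comp_assoc permutes_inv_o)

lemma bij_betw_spins:
  assumes "\<pi> permutes {..<N}"
  shows "bij_betw (\<lambda>s. s \<circ> \<pi>) (spins N) (spins N)"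
  by (rule bij_betw_byWitness[where f' = "\<lambda>s. s \<circ> inv \<pi>"])
    (auto simp: comp_permutes_inv[OF assms] comp_permutes_spins assms permutes_inv)

text \<open>Permutations act unitarily: the sum over spins is reindexed by a bijection, and the
  integral over positions by a measure-preserving map.\<close>

lemma l2_inner_permute:
  assumes \<pi>: "\<pi> permutes {..<N}" and "\<psi> \<in> L2 N" "\<phi> \<in> L2 N"
  shows "l2_inner N (permute \<pi> \<psi>) \<phi> = l2_inner N \<psi> (permute (inv \<pi>) \<phi>)"
proof -
  have meas: "(\<lambda>x. cnj (\<psi> x s) * permute (inv \<pi>) \<phi> x s) \<in> borel_measurable (lebN N)"
    if "s \<in> spins N" for s
    using that assms(2) permute_L2[OF permutes_inv[OF \<pi>] assms(3)]
    by (intro borel_measurable_integrable integrable_square_int_mult square_int_cnj) (auto simp: L2_iff)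
  have "l2_inner N \<psi> (permute (inv \<pi>) \<phi>)
      = (\<Sum>s\<in>spins N. LINT x|lebN N. cnj (\<psi> x (s \<circ> \<pi>)) * permute (inv \<pi>) \<phi> x (s \<circ> \<pi>))"
    unfolding l2_inner_def by (rule sum.reindex_bij_betw[OF bij_betw_spins[OF \<pi>], symmetric])
  also have "\<dots> = (\<Sum>s\<in>spins N. LINT x|lebN N. cnj (\<psi> (x \<circ> \<pi>) (s \<circ> \<pi>)) * permute (inv \<pi>) \<phi> (x \<circ> \<pi>) (s \<circ> \<pi>))"
    by (intro sum.cong refl integral_perm[OF \<pi>, symmetric] meas comp_permutes_spins[OF \<pi>])
  also have "\<dots> = l2_inner N (permute \<pi> \<psi>) \<phi>"
    unfolding l2_inner_def permute_def by (simp add: comp_permutes_inv[OF \<pi>])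
  finally show ?thesis ..
qed

text \<open>A real-valued copy of \<open>exchange_sign\<close>, so that real fields can be
  symmetrized without leaving the reals.\<close>

definition exchange_sgn :: "statistics \<Rightarrow> (nat \<Rightarrow> nat) \<Rightarrow> real"
  where "exchange_sgn st \<pi> = (case st of Bose \<Rightarrow> 1 | Fermi \<Rightarrow> of_int (sign \<pi>))"

lemma exchange_sign_of_real: "exchange_sign st \<pi> = of_real (exchange_sgn st \<pi>)"
  by (cases st) (simp_all add: exchange_sgn_def)

lemma exchange_sgn_inv:
  assumes "\<pi> permutes {..<N::nat}"
  shows "exchange_sgn st (inv \<pi>) = exchange_sgn st \<pi>"
  using permutes_imp_permutation[OF _ assms] by (cases st) (simp_all add: exchange_sgn_def sign_inverse)

lemma exchange_sgn_comp:
  assumes "\<pi> permutes {..<N::nat}" "\<sigma> permutes {..<N}"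
  shows "exchange_sgn st (\<pi> \<circ> \<sigma>) = exchange_sgn st \<pi> * exchange_sgn st \<sigma>"
  using permutes_imp_permutation[OF _ assms(1)] permutes_imp_permutation[OF _ assms(2)]
  by (cases st) (simp_all add: exchange_sgn_def sign_compose)

lemma symmetrize_eq:
  "symmetrize st N \<psi> = (\<lambda>x s. \<Sum>\<pi> | \<pi> permutes {..<N}.
    of_real (exchange_sgn st \<pi> / fact N) * permute \<pi> \<psi> x s)"
  by (simp add: symmetrize_def exchange_sign_of_real permute_def sum_divide_distrib fun_eq_iff)

lemma finite_perms: "finite {\<pi>. \<pi> permutes {..<N::nat}}"
  by (simp add: finite_permutations)

lemma symmetrize_L2: "\<psi> \<in> L2 N \<Longrightarrow> symmetrize st N \<psi> \<in> L2 N"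
  unfolding symmetrize_eq by (intro L2_sum L2_scale permute_L2 finite_perms) auto

text \<open>The adjoint of a permutation is its inverse, and inversion permutes the group while
  preserving the sign.\<close>

lemma l2_inner_symmetrize:
  assumes "\<psi> \<in> L2 N" "\<phi> \<in> L2 N"
  shows "l2_inner N (symmetrize st N \<psi>) \<phi> = l2_inner N \<psi> (symmetrize st N \<phi>)"
proof -
  let ?P = "{\<pi>. \<pi> permutes {..<N}}"
  let ?a = "\<lambda>\<pi>. complex_of_real (exchange_sgn st \<pi> / fact N)"
  have "l2_inner N (symmetrize st N \<psi>) \<phi> = (\<Sum>\<pi>\<in>?P. ?a \<pi> * l2_inner N (permute \<pi> \<psi>) \<phi>)"
    unfolding symmetrize_eq using assms
    by (subst l2_inner_sum_left) (auto simp: permute_L2 finite_perms)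
  also have "\<dots> = (\<Sum>\<pi>\<in>?P. ?a (inv \<pi>) * l2_inner N \<psi> (permute (inv \<pi>) \<phi>))"
    using assms by (intro sum.cong) (auto simp: l2_inner_permute exchange_sgn_inv)
  also have "\<dots> = (\<Sum>\<pi>\<in>?P. ?a \<pi> * l2_inner N \<psi> (permute \<pi> \<phi>))"
    by (rule sum_permutations_inverse[symmetric])
  also have "\<dots> = l2_inner N \<psi> (symmetrize st N \<phi>)"
    unfolding symmetrize_eq using assms
    by (subst l2_inner_sum_right) (auto simp: permute_L2 finite_perms)
  finally show ?thesis .
qed

text \<open>Composition with a fixed permutation only reindexes the sum, and the two signs multiply;
  so each of the N! outer summands contributes the same value.\<close>

lemma symmetrize_idem: "symmetrize st N (symmetrize st N \<psi>) = symmetrize st N \<psi>"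
proof (intro ext)
  fix x s
  let ?P = "{\<pi>. \<pi> permutes {..<N}}"
  let ?t = "\<lambda>\<pi>. complex_of_real (exchange_sgn st \<pi> / fact N) * permute \<pi> \<psi> x s"
  have "complex_of_real (exchange_sgn st \<pi> / fact N) * permute \<pi> (symmetrize st N \<psi>) x s
      = symmetrize st N \<psi> x s / fact N" if \<pi>: "\<pi> \<in> ?P" for \<pi>
  proof -
    have "complex_of_real (exchange_sgn st \<pi>) * permute \<pi> (symmetrize st N \<psi>) x s = (\<Sum>\<sigma>\<in>?P. ?t (\<pi> \<circ> \<sigma>))"
      using \<pi> by (simp add: symmetrize_eq permute_def sum_distrib_left exchange_sgn_comp comp_assoc mult.assoc)
    also have "\<dots> = (\<Sum>\<sigma>\<in>?P. ?t \<sigma>)"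
      using \<pi> by (intro setum_permutations_compose_left[symmetric]) simp
    finally show ?thesis
      by (simp add: symmetrize_eq)
  qed
  then have "symmetrize st N (symmetrize st N \<psi>) x s = (\<Sum>\<pi>\<in>?P. symmetrize st N \<psi> x s / fact N)"
    unfolding symmetrize_eq[of st N "symmetrize st N \<psi>"] by (intro sum.cong) auto
  then show "symmetrize st N (symmetrize st N \<psi>) x s = symmetrize st N \<psi> x s"
    by (simp add: card_permutations)
qed

definition symmetrize_field :: "statistics \<Rightarrow> nat \<Rightarrow> (spin \<Rightarrow> conf \<Rightarrow> real) \<Rightarrow> spin \<Rightarrow> conf \<Rightarrow> real"
  where "symmetrize_field st N F s x = (\<Sum>\<pi> | \<pi> permutes {..<N}.
    exchange_sgn st \<pi> / fact N * F (s \<circ> \<pi>) (x \<circ> \<pi>))"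

lemma symmetrize_of_field: "symmetrize st N (field F) = field (symmetrize_field st N F)"
  by (simp add: symmetrize_eq field_def symmetrize_field_def permute_def)

lemma smooth_alg_permute:
  assumes \<pi>: "\<pi> permutes {..<N}" and "smooth_alg {..<N} f"
  shows "smooth_alg {..<N} (\<lambda>x. f (x \<circ> \<pi>))"
  using assms(2)
proof induction
  case (coord j k)
  then have "\<pi> j \<in> {..<N}"
    using permutes_in_image[OF \<pi>] by simp
  then show ?case
    using smooth_alg.coord[of "\<pi> j" "{..<N}" k] by simp
qed (auto intro: smooth_alg.intros)

text \<open>Explains every \<open>inv \<pi> j\<close> below: after composition with
  \<open>\<pi>\<close>, the position of particle \<open>j\<close> sits in slot
  \<open>inv \<pi> j\<close>.\<close>

lemma permute_upd:
  assumes "\<pi> permutes A"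
  shows "(x(j := p)) \<circ> \<pi> = (x \<circ> \<pi>)(inv \<pi> j := p)"
proof
  fix i
  have "\<pi> i = j \<longleftrightarrow> i = inv \<pi> j"
    using permutes_inverses[OF assms] by metis
  then show "((x(j := p)) \<circ> \<pi>) i = ((x \<circ> \<pi>)(inv \<pi> j := p)) i"
    by simp
qed

lemma pd_permute:
  assumes \<pi>: "\<pi> permutes {..<N}" and "smooth_alg {..<N} f"
  shows "pd j k (\<lambda>x. f (x \<circ> \<pi>)) = (\<lambda>x. pd (inv \<pi> j) k f (x \<circ> \<pi>))"
proof (rule pd_eqI)
  fix x :: conf
  have "x j = (x \<circ> \<pi>) (inv \<pi> j)"
    using permutes_inverses[OF \<pi>] by simp
  then show "((\<lambda>t. f ((x(j := x j + t *\<^sub>R axis k 1)) \<circ> \<pi>)) has_real_derivative pd (inv \<pi> j) k f (x \<circ> \<pi>)) (at 0)"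
    unfolding permute_upd[OF \<pi>] using smooth_alg_has_pd[OF assms(2), of "x \<circ> \<pi>" "inv \<pi> j" k] by simp
qed

lemma smooth_alg_sum:
  "finite A \<Longrightarrow> (\<And>i. i \<in> A \<Longrightarrow> smooth_alg J (f i)) \<Longrightarrow> smooth_alg J (\<lambda>x. \<Sum>i\<in>A. f i x)"
  by (induction A rule: finite_induct) (auto intro: smooth_alg.intros)

lemma pd_sum:
  assumes "\<And>i. i \<in> A \<Longrightarrow> smooth_alg J (f i)"
  shows "pd j k (\<lambda>x. \<Sum>i\<in>A. a i * f i x) = (\<lambda>x. \<Sum>i\<in>A. a i * pd j k (f i) x)"
  by (rule pd_eqI) (intro DERIV_sum DERIV_cmult smooth_alg_has_pd[of J] assms)

lemma pd_symmetrize_field: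
  assumes "\<And>s. smooth_alg {..<N} (F s)"
  shows "pd j k (symmetrize_field st N F s) = (\<lambda>x. \<Sum>\<pi> | \<pi> permutes {..<N}.
    exchange_sgn st \<pi> / fact N * pd (inv \<pi> j) k (F (s \<circ> \<pi>)) (x \<circ> \<pi>))"
proof -
  have "pd j k (symmetrize_field st N F s) = (\<lambda>x. \<Sum>\<pi> | \<pi> permutes {..<N}.
      exchange_sgn st \<pi> / fact N * pd j k (\<lambda>x. F (s \<circ> \<pi>) (x \<circ> \<pi>)) x)"
    unfolding symmetrize_field_def[abs_def]
    by (rule pd_sum[of _ "{..<N}"]) (auto intro: smooth_alg_permute assms)
  then show ?thesis
    by (simp add: pd_permute assms)
qed

lemma test_field_symmetrize:
  assumes "test_field N F"
  shows "test_field N (symmetrize_field st N F)"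
proof -
  obtain L where L: "\<And>s. smooth_alg {..<N} (F s)" "\<And>s. csupp {..<N} L (F s)"
    using assms unfolding test_field_def by blast
  have "smooth_alg {..<N} (symmetrize_field st N F s)" for s
    unfolding symmetrize_field_def[abs_def]
    by (intro smooth_alg_sum finite_perms smooth_alg.mult smooth_alg.const smooth_alg_permute L) simp
  moreover have "csupp {..<N} L (symmetrize_field st N F s)" for s
    unfolding csupp_def
  proof (intro allI ballI impI)
    fix x :: conf and j and k :: 3 assume *: "j \<in> {..<N}" "L < \<bar>x j $ k\<bar>"
    have "F (s \<circ> \<pi>) (x \<circ> \<pi>) = 0" if "\<pi> permutes {..<N}" for \<pi>
    proof -
      have "inv \<pi> j \<in> {..<N}" "(x \<circ> \<pi>) (inv \<pi> j) = x j"
        using permutes_in_image[OF permutes_inv[OF that]] permutes_inverses[OF that] * by auto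
      then show ?thesis
        using L(2)[of "s \<circ> \<pi>"] * unfolding csupp_def by metis
    qed
    then show "symmetrize_field st N F s x = 0"
      by (simp add: symmetrize_field_def)
  qed
  ultimately show ?thesis
    unfolding test_field_def by blast
qed

lemma particle_op_eq:
  "particle_op c hbar m j F x s =
    (\<Sum>k\<in>UNIV. \<Sum>b\<in>UNIV. - \<i> * of_real (c * hbar) * dirac_alpha k $ s j $ b * of_real (pd j k (F (s(j := b))) x))
    + (\<Sum>b\<in>UNIV. of_real (m * c\<^sup>2) * dirac_beta $ s j $ b * of_real (F (s(j := b)) x))"
  by (simp add: particle_op_def spin_op_def field_def sum_distrib_left mult.assoc)

lemma particle_op_symmetrize:
  assumes "\<And>s. smooth_alg {..<N} (F s)"
  shows "particle_op c hbar m j (symmetrize_field st N F) x s =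
    (\<Sum>\<pi> | \<pi> permutes {..<N}. of_real (exchange_sgn st \<pi> / fact N) *
      particle_op c hbar m (inv \<pi> j) F (x \<circ> \<pi>) (s \<circ> \<pi>))"
proof -
  let ?P = "{\<pi>. \<pi> permutes {..<N}}"
  let ?a = "\<lambda>\<pi>. complex_of_real (exchange_sgn st \<pi> / fact N)"
  have upd: "s(j := b) \<circ> \<pi> = (s \<circ> \<pi>)(inv \<pi> j := b)" "s j = (s \<circ> \<pi>) (inv \<pi> j)" if "\<pi> \<in> ?P" for b \<pi>
    using that permute_upd permutes_inverses by fastforce+
  have 1: "of_real (pd j k (symmetrize_field st N F (s(j := b))) x) = (\<Sum>\<pi>\<in>?P. ?a \<pi> *
      of_real (pd (inv \<pi> j) k (F ((s \<circ> \<pi>)(inv \<pi> j := b))) (x \<circ> \<pi>)))" for k b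
    unfolding pd_symmetrize_field[OF assms] of_real_sum of_real_mult
    by (intro sum.cong refl) (simp only: upd(1))
  have 2: "of_real (symmetrize_field st N F (s(j := b)) x) = (\<Sum>\<pi>\<in>?P. ?a \<pi> *
      of_real (F ((s \<circ> \<pi>)(inv \<pi> j := b)) (x \<circ> \<pi>)))" for b
    unfolding symmetrize_field_def of_real_sum of_real_mult
    by (intro sum.cong refl) (simp only: upd(1))
  have "particle_op c hbar m j (symmetrize_field st N F) x s =
     (\<Sum>k\<in>UNIV. \<Sum>b\<in>UNIV. \<Sum>\<pi>\<in>?P. ?a \<pi> * (- \<i> * of_real (c * hbar) * dirac_alpha k $ s j $ b *
        of_real (pd (inv \<pi> j) k (F ((s \<circ> \<pi>)(inv \<pi> j := b))) (x \<circ> \<pi>))))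
     + (\<Sum>b\<in>UNIV. \<Sum>\<pi>\<in>?P. ?a \<pi> * (of_real (m * c\<^sup>2) * dirac_beta $ s j $ b *
        of_real (F ((s \<circ> \<pi>)(inv \<pi> j := b)) (x \<circ> \<pi>))))"
    unfolding particle_op_eq 1 2 sum_distrib_left by (simp only: mult_ac)
  also have "\<dots> = (\<Sum>\<pi>\<in>?P. \<Sum>k\<in>UNIV. \<Sum>b\<in>UNIV. ?a \<pi> * (- \<i> * of_real (c * hbar) * dirac_alpha k $ s j $ b *
        of_real (pd (inv \<pi> j) k (F ((s \<circ> \<pi>)(inv \<pi> j := b))) (x \<circ> \<pi>))))
     + (\<Sum>\<pi>\<in>?P. \<Sum>b\<in>UNIV. ?a \<pi> * (of_real (m * c\<^sup>2) * dirac_beta $ s j $ b *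
        of_real (F ((s \<circ> \<pi>)(inv \<pi> j := b)) (x \<circ> \<pi>))))"
    by (simp only: sum.swap[of _ ?P])
  also have "\<dots> = (\<Sum>\<pi>\<in>?P. ?a \<pi> * particle_op c hbar m (inv \<pi> j) F (x \<circ> \<pi>) (s \<circ> \<pi>))"
    unfolding sum.distrib[symmetric] particle_op_eq
    by (intro sum.cong refl) (simp only: distrib_left sum_distrib_left upd(2)[symmetric])
  finally show ?thesis .
qed

text \<open>A single particle operator does not commute with permutations but has its label moved
  from \<open>j\<close> to \<open>inv \<pi> j\<close>; the sum over all particles absorbs the
  relabelling.\<close>

lemma dirac_op_symmetrize:
  assumes "test_field N F"
  shows "dirac_op c hbar m N (symmetrize_field st N F) = symmetrize st N (dirac_op c hbar m N F)"
proof (intro ext)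
  fix x s
  let ?P = "{\<pi>. \<pi> permutes {..<N}}"
  let ?a = "\<lambda>\<pi>. complex_of_real (exchange_sgn st \<pi> / fact N)"
  have sm: "\<And>s. smooth_alg {..<N} (F s)"
    using assms unfolding test_field_def by blast
  have "dirac_op c hbar m N (symmetrize_field st N F) x s =
      (\<Sum>\<pi>\<in>?P. \<Sum>j<N. ?a \<pi> * particle_op c hbar m (inv \<pi> j) F (x \<circ> \<pi>) (s \<circ> \<pi>))"
    unfolding dirac_op_def particle_op_symmetrize[OF sm] by (rule sum.swap)
  also have "\<dots> = (\<Sum>\<pi>\<in>?P. ?a \<pi> * (\<Sum>j<N. particle_op c hbar m j F (x \<circ> \<pi>) (s \<circ> \<pi>)))"
  proof (intro sum.cong refl)
    fix \<pi> assume "\<pi> \<in> ?P"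
    then have "inv \<pi> permutes {..<N}"
      by (simp add: permutes_inv)
    from sum.permute[OF this, of "\<lambda>j. particle_op c hbar m j F (x \<circ> \<pi>) (s \<circ> \<pi>)"]
    show "(\<Sum>j<N. ?a \<pi> * particle_op c hbar m (inv \<pi> j) F (x \<circ> \<pi>) (s \<circ> \<pi>))
        = ?a \<pi> * (\<Sum>j<N. particle_op c hbar m j F (x \<circ> \<pi>) (s \<circ> \<pi>))"
      by (simp add: o_def sum_distrib_left)
  qed
  finally show "dirac_op c hbar m N (symmetrize_field st N F) x s = symmetrize st N (dirac_op c hbar m N F) x s"
    unfolding symmetrize_eq dirac_op_def permute_def .
qed

subsection \<open>Continuity of translations\<close>

definition small :: "nat \<Rightarrow> real \<Rightarrow> conf \<Rightarrow> bool"
  where "small N r z \<longleftrightarrow> (\<forall>j<N. \<forall>k. \<bar>z j $ k\<bar> \<le> r)"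

lemma small_mono: "small N r z \<Longrightarrow> r \<le> r' \<Longrightarrow> small N r' z"
  unfolding small_def by (meson order_trans)

text \<open>The symmetric difference of \<open>A\<close> and a translate of it. Its measure is the
  L1 distance between the indicator of \<open>A\<close> and the translated indicator.\<close>

definition moved :: "nat \<Rightarrow> conf \<Rightarrow> conf set \<Rightarrow> conf set"
  where "moved N z A = {x \<in> confs N. (shift N z x \<in> A) \<noteq> (x \<in> A)}"

lemma moved_sets [measurable]:
  assumes "A \<in> sets (lebN N)"
  shows "moved N z A \<in> sets (lebN N)"
proof -
  have "shift N z -` A \<inter> space (lebN N) \<in> sets (lebN N)"
    using measurable_sets[OF shift_measurable assms] .
  moreover have "moved N z A = (shift N z -` A \<inter> space (lebN N) - A) \<union> (A - (shift N z -` A \<inter> space (lebN N)))"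
    using sets.sets_into_space[OF assms] by (auto simp: moved_def space_lebN)
  ultimately show ?thesis
    using assms by auto
qed

lemma emeasure_shift_vimage:
  assumes "A \<in> sets (lebN N)"
  shows "emeasure (lebN N) (shift N z -` A \<inter> confs N) = emeasure (lebN N) A"
  using emeasure_distr[OF shift_measurable assms, of z] by (simp add: distr_shift space_lebN)

lemma shift_cubeN:
  assumes "x \<in> cubeN N L" "small N r z"
  shows "shift N z x \<in> cubeN N (L + r)"
proof -
  have "\<bar>x j $ k + z j $ k\<bar> \<le> L + r" if "j < N" for j k
  proof -
    have "\<bar>x j $ k\<bar> \<le> L" "\<bar>z j $ k\<bar> \<le> r"
      using assms that by (auto simp: mem_cubeN small_def)
    then show ?thesis by linarith
  qed
  then show ?thesis
    by (auto simp: mem_cubeN)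
qed

text \<open>Translation continuity of a set, demanded only inside bounded cubes. The generators of
  the sigma-algebra, such as half-spaces, have infinite measure; the local form holds for them and
  is preserved by complements and countable unions, as an induction over the sigma-algebra
  requires.\<close>

definition locally_stable :: "nat \<Rightarrow> conf set \<Rightarrow> bool"
  where "locally_stable N A \<longleftrightarrow> (\<forall>L. \<forall>\<delta>>0. \<exists>r>0. \<forall>z. small N r z \<longrightarrow>
    emeasure (lebN N) (cubeN N L \<inter> moved N z A) \<le> ennreal \<delta>)"

lemma locally_stable_Un:
  assumes "A \<in> sets (lebN N)" "B \<in> sets (lebN N)" "locally_stable N A" "locally_stable N B"
  shows "locally_stable N (A \<union> B)"
  unfolding locally_stable_def
proof (intro allI impI)
  fix L \<delta> :: real assume "\<delta> > 0"
  then obtain r1 r2 where r: "r1 > 0" "r2 > 0"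
    and r1: "\<And>z. small N r1 z \<Longrightarrow> emeasure (lebN N) (cubeN N L \<inter> moved N z A) \<le> ennreal (\<delta> / 2)"
    and r2: "\<And>z. small N r2 z \<Longrightarrow> emeasure (lebN N) (cubeN N L \<inter> moved N z B) \<le> ennreal (\<delta> / 2)"
    using assms(3,4)[unfolded locally_stable_def, rule_format, of "\<delta> / 2" L] by auto
  have "emeasure (lebN N) (cubeN N L \<inter> moved N z (A \<union> B)) \<le> ennreal \<delta>" if "small N (min r1 r2) z" for z
  proof -
    have "emeasure (lebN N) (cubeN N L \<inter> moved N z (A \<union> B))
        \<le> emeasure (lebN N) ((cubeN N L \<inter> moved N z A) \<union> (cubeN N L \<inter> moved N z B))"
    proof (rule emeasure_mono)
      show "cubeN N L \<inter> moved N z (A \<union> B) \<subseteq> (cubeN N L \<inter> moved N z A) \<union> (cubeN N L \<inter> moved N z B)"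
        by (auto simp: moved_def)
    qed (use assms in auto)
    also have "\<dots> \<le> emeasure (lebN N) (cubeN N L \<inter> moved N z A) + emeasure (lebN N) (cubeN N L \<inter> moved N z B)"
      using assms by (intro emeasure_subadditive) auto
    also have "\<dots> \<le> ennreal (\<delta> / 2) + ennreal (\<delta> / 2)"
      using that by (intro add_mono r1 r2) (auto elim: small_mono)
    also have "\<dots> = ennreal \<delta>"
      using \<open>\<delta> > 0\<close> by (simp flip: ennreal_plus)
    finally show ?thesis .
  qed
  then show "\<exists>r>0. \<forall>z. small N r z \<longrightarrow> emeasure (lebN N) (cubeN N L \<inter> moved N z (A \<union> B)) \<le> ennreal \<delta>"
    using r by (intro exI[of _ "min r1 r2"]) auto
qed

lemma locally_stable_empty: "locally_stable N {}"
  unfolding locally_stable_def by (auto simp: moved_def intro!: exI[of _ 1])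

lemma locally_stable_Diff: "locally_stable N A \<Longrightarrow> locally_stable N (confs N - A)"
proof -
  have "moved N z (confs N - A) = moved N z A" for z
    by (auto simp: moved_def)
  then show "locally_stable N A \<Longrightarrow> locally_stable N (confs N - A)"
    by (simp add: locally_stable_def)
qed

lemma emeasure_decseq_small:
  assumes "range A \<subseteq> sets M" "decseq A" "emeasure M (A 0) < \<infinity>" "emeasure M (\<Inter>i. A i) = 0" "\<delta> > (0::real)"
  obtains n :: nat where "emeasure M (A n) \<le> ennreal \<delta>"
proof -
  have "emeasure M (A i) \<noteq> \<infinity>" for i
    using emeasure_mono[of "A i" "A 0" M] assms(1-3) by (auto simp: decseq_def top_unique image_subset_iff)
  then have "(\<lambda>i. emeasure M (A i)) \<longlonglongrightarrow> 0"
    using Lim_emeasure_decseq[OF assms(1,2)] assms(4) by simp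
  then have "eventually (\<lambda>i. emeasure M (A i) < ennreal \<delta>) sequentially"
    using assms(5) by (intro order_tendstoD) auto
  then show ?thesis
    using that by (auto simp: eventually_sequentially intro: less_imp_le)
qed

text \<open>A point moved by the whole union but not by the finite one lies in the tail
  \<open>T n\<close>, before or after the translation. The tail is small inside the cube enlarged by
  1, and its preimage under the translation has the same measure. The three cases account for three
  portions \<open>\<delta> / 3\<close>.\<close>

lemma locally_stable_UN:
  fixes A :: "nat \<Rightarrow> conf set"
  assumes A: "\<And>i. A i \<in> sets (lebN N)" and st: "\<And>i. locally_stable N (A i)"
  shows "locally_stable N (\<Union>i. A i)"
  unfolding locally_stable_def
proof (intro allI impI)
  fix L \<delta> :: real assume \<delta>: "\<delta> > 0"
  define T where "T n = (\<Union>i. A i) - (\<Union>i<n. A i)" for n :: nat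
  have T_sets: "T n \<in> sets (lebN N)" for n
    unfolding T_def using A by auto
  obtain n where n: "emeasure (lebN N) (cubeN N (L + 1) \<inter> T n) \<le> ennreal (\<delta> / 3)"
  proof (rule emeasure_decseq_small)
    show "range (\<lambda>n. cubeN N (L + 1) \<inter> T n) \<subseteq> sets (lebN N)"
      using T_sets by auto
    show "decseq (\<lambda>n. cubeN N (L + 1) \<inter> T n)"
      unfolding decseq_def T_def by fastforce
    have "emeasure (lebN N) (cubeN N (L + 1) \<inter> T 0) \<le> emeasure (lebN N) (cubeN N (L + 1))"
      by (intro emeasure_mono) auto
    then show "emeasure (lebN N) (cubeN N (L + 1) \<inter> T 0) < \<infinity>"
      using emeasure_cubeN_finite[of N "L + 1"] by (rule le_less_trans)
    have "(\<Inter>n. cubeN N (L + 1) \<inter> T n) = {}"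
      unfolding T_def by blast
    then show "emeasure (lebN N) (\<Inter>n. cubeN N (L + 1) \<inter> T n) = 0"
      by simp
    show "\<delta> / 3 > 0"
      using \<delta> by simp
  qed
  have "locally_stable N (\<Union>i<n. A i)"
  proof (induction n)
    case (Suc n)
    then show ?case
      using A st by (simp add: lessThan_Suc locally_stable_Un)
  qed (simp add: locally_stable_empty)
  then obtain r where r: "r > 0"
    "\<And>z. small N r z \<Longrightarrow> emeasure (lebN N) (cubeN N L \<inter> moved N z (\<Union>i<n. A i)) \<le> ennreal (\<delta> / 3)"
    unfolding locally_stable_def using \<delta> by (metis divide_pos_pos zero_less_numeral)
  have "emeasure (lebN N) (cubeN N L \<inter> moved N z (\<Union>i. A i)) \<le> ennreal \<delta>" if z: "small N (min r 1) z" for z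
  proof -
    let ?U = "cubeN N L \<inter> moved N z (\<Union>i<n. A i)" and ?C = "cubeN N (L + 1) \<inter> T n"
    let ?V = "shift N z -` ?C \<inter> confs N"
    have sets: "?U \<in> sets (lebN N)" "?C \<in> sets (lebN N)" "?V \<in> sets (lebN N)"
      using A T_sets measurable_sets[OF shift_measurable, of ?C N z] by (auto simp: space_lebN)
    have "cubeN N L \<inter> moved N z (\<Union>i. A i) \<subseteq> ?U \<union> ?C \<union> ?V"
    proof
      fix x assume x: "x \<in> cubeN N L \<inter> moved N z (\<Union>i. A i)"
      then have "x \<in> cubeN N (L + 1)" "shift N z x \<in> cubeN N (L + 1)"
        using cubeN_mono[of L "L + 1" N] shift_cubeN[of x N L 1 z] small_mono[OF z, of 1] by auto
      then show "x \<in> ?U \<union> ?C \<union> ?V"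
        using x by (auto simp: moved_def T_def)
    qed
    then have "emeasure (lebN N) (cubeN N L \<inter> moved N z (\<Union>i. A i)) \<le> emeasure (lebN N) (?U \<union> ?C \<union> ?V)"
      using sets by (intro emeasure_mono) auto
    also have "\<dots> \<le> emeasure (lebN N) (?U \<union> ?C) + emeasure (lebN N) ?V"
      using sets by (intro emeasure_subadditive) auto
    also have "\<dots> \<le> emeasure (lebN N) ?U + emeasure (lebN N) ?C + emeasure (lebN N) ?V"
      using sets by (intro add_right_mono emeasure_subadditive) auto
    also have "\<dots> \<le> ennreal (\<delta> / 3) + ennreal (\<delta> / 3) + ennreal (\<delta> / 3)"
      unfolding emeasure_shift_vimage[OF sets(2)] using z n by (intro add_mono r) (auto elim: small_mono)
    also have "\<dots> = ennreal \<delta>"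
      using \<delta> by (simp flip: ennreal_plus)
    finally show ?thesis .
  qed
  then show "\<exists>r>0. \<forall>z. small N r z \<longrightarrow> emeasure (lebN N) (cubeN N L \<inter> moved N z (\<Union>i. A i)) \<le> ennreal \<delta>"
    using r(1) by (intro exI[of _ "min r 1"]) auto
qed

lemma emeasure_lborel_hyperplane: "emeasure lborel {p::real^3. p $ k = a} = 0"
proof -
  have "closed {p::real^3. p $ k = a}"
    by (intro closed_Collect_eq continuous_on_component continuous_on_id continuous_on_const)
  then have "{p::real^3. p $ k = a} \<in> sets lborel"
    by simp
  moreover have "{p::real^3. p $ k = a} \<in> null_sets lebesgue"
    using negligible_standard_hyperplane[of "axis k 1 :: real^3" a]
    by (simp add: negligible_iff_null_sets inner_axis axis_in_Basis_iff)
  ultimately show ?thesis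
    by (simp add: null_sets_def)
qed

lemma halfspace_measurable:
  assumes "j < N"
  shows "{x \<in> confs N. a < x j $ k} \<in> sets (lebN N)"
    and "{x \<in> confs N. \<bar>x j $ k - a\<bar> \<le> e} \<in> sets (lebN N)"
proof -
  have "(\<lambda>x. x j $ k) \<in> borel_measurable (lebN N)"
    using smooth_alg_measurable[OF smooth_alg.coord[of j "{..<N}" k], of N] assms by simp
  then show "{x \<in> confs N. a < x j $ k} \<in> sets (lebN N)"
    "{x \<in> confs N. \<bar>x j $ k - a\<bar> \<le> e} \<in> sets (lebN N)"
    unfolding space_lebN[symmetric] by measurable
qed

text \<open>A point that crosses the boundary under a translation of size \<open>1 / Suc n\<close>
  is within that distance of the hyperplane. Inside a fixed cube, these slabs decrease to a null
  set.\<close>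

lemma locally_stable_halfspace:
  assumes j: "j < N"
  shows "locally_stable N {x \<in> confs N. a < x j $ k}"
  unfolding locally_stable_def
proof (intro allI impI)
  fix L \<delta> :: real assume \<delta>: "\<delta> > 0"
  define E where "E n = cubeN N L \<inter> {x \<in> confs N. \<bar>x j $ k - a\<bar> \<le> 1 / Suc n}" for n :: nat
  have E_sets: "E n \<in> sets (lebN N)" for n
    unfolding E_def using halfspace_measurable(2)[OF j] by auto
  obtain n where n: "emeasure (lebN N) (E n) \<le> ennreal \<delta>"
  proof (rule emeasure_decseq_small[OF _ _ _ _ \<delta>])
    show "range E \<subseteq> sets (lebN N)"
      using E_sets by auto
    have "1 / real (Suc n) \<le> 1 / real (Suc m)" if "m \<le> n" for m n
      using that by (simp add: frac_le)
    then show "decseq E"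
      unfolding decseq_def E_def by (auto intro: order_trans simp del: of_nat_Suc)
    have "emeasure (lebN N) (E 0) \<le> emeasure (lebN N) (cubeN N L)"
      by (intro emeasure_mono) (auto simp: E_def)
    then show "emeasure (lebN N) (E 0) < \<infinity>"
      using emeasure_cubeN_finite[of N L] by (rule le_less_trans)
    let ?H = "PiE {..<N} (\<lambda>i. if i = j then {p. p $ k = a} else UNIV)"
    have closed: "closed {p::real^3. p $ k = a}"
      by (intro closed_Collect_eq continuous_on_component continuous_on_id continuous_on_const)
    have "emeasure (lebN N) ?H = (\<Prod>i<N. emeasure lborel (if i = j then {p::real^3. p $ k = a} else UNIV))"
      by (rule emeasure_lebN_PiE) (use closed in auto)
    also have "\<dots> = 0"
      using j emeasure_lborel_hyperplane[of k a] by (intro prod_zero) (auto intro!: bexI[of _ j])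
    finally have "emeasure (lebN N) ?H = 0" .
    moreover have "?H \<in> sets (lebN N)"
      unfolding lebN_def using closed by (intro sets_PiM_I_finite) auto
    moreover have "(\<Inter>n. E n) \<subseteq> ?H"
    proof
      fix x assume x: "x \<in> (\<Inter>n. E n)"
      have "\<bar>x j $ k - a\<bar> \<le> 1 / Suc n" for n
        using x unfolding E_def by blast
      then have "\<bar>x j $ k - a\<bar> \<le> 0"
        using LIMSEQ_le_const[OF lim_inverse_n'[THEN LIMSEQ_Suc]] by blast
      then show "x \<in> ?H"
        using x by (auto simp: E_def mem_cubeN confs_def PiE_iff)
    qed
    ultimately show "emeasure (lebN N) (\<Inter>n. E n) = 0"
      using emeasure_mono[of "\<Inter>n. E n" ?H "lebN N"] by simp
  qed
  have "cubeN N L \<inter> moved N z {x \<in> confs N. a < x j $ k} \<subseteq> E n" if z: "small N (1 / Suc n) z" for z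
  proof
    fix x assume x: "x \<in> cubeN N L \<inter> moved N z {x \<in> confs N. a < x j $ k}"
    have "\<bar>z j $ k\<bar> \<le> 1 / Suc n"
      using z j by (simp add: small_def)
    then have "\<bar>x j $ k - a\<bar> \<le> 1 / Suc n"
      using x j by (auto simp: moved_def simp del: of_nat_Suc)
    then show "x \<in> E n"
      using x by (auto simp: E_def mem_cubeN)
  qed
  then have "emeasure (lebN N) (cubeN N L \<inter> moved N z {x \<in> confs N. a < x j $ k}) \<le> ennreal \<delta>"
    if "small N (1 / Suc n) z" for z
    using emeasure_mono[OF _ E_sets] n that by (meson order_trans)
  then show "\<exists>r>0. \<forall>z. small N r z \<longrightarrow>
      emeasure (lebN N) (cubeN N L \<inter> moved N z {x \<in> confs N. a < x j $ k}) \<le> ennreal \<delta>"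
    by (intro exI[of _ "1 / Suc n"]) auto
qed

lemma lebN_vimage_component:
  "j < N \<Longrightarrow> B \<in> sets borel \<Longrightarrow> {x \<in> confs N. x j \<in> B} \<in> sets (lebN N)"
  using measurable_sets[OF lebN_component_measurable, of j N B]
  by (simp add: vimage_def Int_def conj_commute space_lebN)

lemma locally_stable_cylinder:
  assumes j: "j < N" and "B \<in> sets borel"
  shows "locally_stable N {x \<in> confs N. x j \<in> B}"
proof -
  let ?G = "(\<lambda>(a, i). {x::real^3. a < x \<bullet> i}) ` (UNIV \<times> Basis)"
  have borel: "sets (borel :: (real^3) measure) = sigma_sets UNIV ?G"
    by (subst borel_eq_halfspace_greater) (simp add: sets_measure_of)
  have "B \<in> sigma_sets UNIV ?G"
    using assms(2) borel by simp
  then show ?thesis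
  proof induction
    case (Basic B)
    then obtain a k where "B = {x. a < x $ k}"
      by (auto simp: Basis_vec_def inner_axis)
    then show ?case
      using locally_stable_halfspace[OF j] by simp
  next
    case Empty
    then show ?case by (simp add: locally_stable_empty)
  next
    case (Compl B)
    have "{x \<in> confs N. x j \<in> UNIV - B} = confs N - {x \<in> confs N. x j \<in> B}"
      by auto
    then show ?case
      using locally_stable_Diff[OF Compl.IH] by simp
  next
    case (Union B)
    have "{x \<in> confs N. x j \<in> (\<Union>i. B i)} = (\<Union>i. {x \<in> confs N. x j \<in> B i})"
      by auto
    then show ?case
      using Union borel j by (simp add: locally_stable_UN lebN_vimage_component)
  qed
qed

text \<open>The second of two inductions: half-spaces generate the Borel sets of a single particle,
  and the resulting cylinders generate the product sigma-algebra.\<close>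

lemma locally_stable_sets:
  assumes "A \<in> sets (lebN N)"
  shows "locally_stable N A"
proof -
  let ?G = "{{x \<in> \<Pi>\<^sub>E i\<in>{..<N}. space lborel. x i \<in> B} |i B. i \<in> {..<N} \<and> B \<in> sets (lborel :: (real^3) measure)}"
  have leb: "sets (lebN N) = sigma_sets (\<Pi>\<^sub>E i\<in>{..<N}. space lborel) ?G"
    unfolding lebN_def by (rule sets_PiM_single)
  have "A \<in> sigma_sets (\<Pi>\<^sub>E i\<in>{..<N}. space lborel) ?G"
    using assms leb by simp
  then show ?thesis
  proof induction
    case (Basic A)
    then show ?case
      using locally_stable_cylinder by (auto simp: confs_def)
  next
    case (Compl A)
    then show ?case
      using locally_stable_Diff by (simp add: confs_def)
  next
    case (Union A)
    then show ?case
      using leb by (intro locally_stable_UN) auto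
  qed (rule locally_stable_empty)
qed

text \<open>Finite measure turns the local statement into a global one, since both \<open>A\<close>
  and its translate have little mass outside a large cube. The margin 1 in the size of the cube
  accounts for the translation.\<close>

lemma emeasure_moved_small:
  assumes A: "A \<in> sets (lebN N)" "emeasure (lebN N) A < \<infinity>" and \<delta>: "\<delta> > 0"
  shows "\<exists>r>0. \<forall>z. small N r z \<longrightarrow> emeasure (lebN N) (moved N z A) \<le> ennreal \<delta>"
proof -
  obtain n where n: "emeasure (lebN N) (A - cubeN N (real n)) \<le> ennreal (\<delta> / 3)"
  proof (rule emeasure_decseq_small[where A = "\<lambda>n. A - cubeN N (real n)"])
    show "range (\<lambda>n. A - cubeN N (real n)) \<subseteq> sets (lebN N)"
      using A by auto
    show "decseq (\<lambda>n. A - cubeN N (real n))"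
      unfolding decseq_def using cubeN_mono by (meson Diff_mono of_nat_mono order_refl)
    show "emeasure (lebN N) (A - cubeN N (real 0)) < \<infinity>"
      using emeasure_mono[of "A - cubeN N (real 0)" A "lebN N"] A by (auto intro: le_less_trans)
    have "x \<in> (\<Union>n. cubeN N (real n))" if x: "x \<in> confs N" for x
    proof -
      obtain n where n: "(\<Sum>j<N. \<Sum>k\<in>UNIV. \<bar>x j $ k\<bar>) \<le> real n"
        using real_arch_simple by blast
      have "\<bar>x j $ k\<bar> \<le> real n" if "j < N" for j k
        using coord_le_sum[OF that, of x k] n by linarith
      then show ?thesis
        using x by (auto simp: mem_cubeN)
    qed
    then have empty: "(\<Inter>n. A - cubeN N (real n)) = {}"
      using sets.sets_into_space[OF A(1)] by (auto simp: space_lebN)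
    show "emeasure (lebN N) (\<Inter>n. A - cubeN N (real n)) = 0"
      unfolding empty by simp
    show "\<delta> / 3 > 0"
      using \<delta> by simp
  qed
  obtain r where r: "r > 0"
    "\<And>z. small N r z \<Longrightarrow> emeasure (lebN N) (cubeN N (real n + 1) \<inter> moved N z A) \<le> ennreal (\<delta> / 3)"
    using locally_stable_sets[OF A(1), unfolded locally_stable_def, rule_format, of "\<delta> / 3"] \<delta>
    by (metis divide_pos_pos zero_less_numeral)
  have "emeasure (lebN N) (moved N z A) \<le> ennreal \<delta>" if z: "small N (min r 1) z" for z
  proof -
    let ?U = "cubeN N (real n + 1) \<inter> moved N z A" and ?C = "A - cubeN N (real n)"
    let ?V = "shift N z -` ?C \<inter> confs N"
    have sets: "?U \<in> sets (lebN N)" "?C \<in> sets (lebN N)" "?V \<in> sets (lebN N)"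
      using A measurable_sets[OF shift_measurable, of ?C N z] by (auto simp: space_lebN)
    have "moved N z A \<subseteq> ?U \<union> ?C \<union> ?V"
    proof
      fix x assume x: "x \<in> moved N z A"
      have "x \<in> cubeN N (real n + 1)" if "shift N z x \<in> cubeN N (real n)"
      proof -
        have "\<bar>x j $ k\<bar> \<le> real n + 1" if "j < N" for j k
        proof -
          have "\<bar>x j $ k + z j $ k\<bar> \<le> real n" "\<bar>z j $ k\<bar> \<le> 1"
            using \<open>shift N z x \<in> cubeN N (real n)\<close> small_mono[OF z, of 1] that
            by (auto simp: mem_cubeN small_def)
          then show ?thesis by linarith
        qed
        then show ?thesis
          using x by (auto simp: mem_cubeN moved_def)
      qed
      moreover have "x \<in> cubeN N (real n + 1)" if "x \<in> cubeN N (real n)"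
        using that cubeN_mono[of "real n" "real n + 1" N] by auto
      ultimately show "x \<in> ?U \<union> ?C \<union> ?V"
        using x by (auto simp: moved_def)
    qed
    then have "emeasure (lebN N) (moved N z A) \<le> emeasure (lebN N) (?U \<union> ?C \<union> ?V)"
      using sets by (intro emeasure_mono) auto
    also have "\<dots> \<le> emeasure (lebN N) (?U \<union> ?C) + emeasure (lebN N) ?V"
      using sets by (intro emeasure_subadditive) auto
    also have "\<dots> \<le> emeasure (lebN N) ?U + emeasure (lebN N) ?C + emeasure (lebN N) ?V"
      using sets by (intro add_right_mono emeasure_subadditive) auto
    also have "\<dots> \<le> ennreal (\<delta> / 3) + ennreal (\<delta> / 3) + ennreal (\<delta> / 3)"
      unfolding emeasure_shift_vimage[OF sets(2)] using z n by (intro add_mono r) (auto elim: small_mono)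
    also have "\<dots> = ennreal \<delta>"
      using \<delta> by (simp flip: ennreal_plus)
    finally show ?thesis .
  qed
  then show ?thesis
    using r(1) by (intro exI[of _ "min r 1"]) auto
qed

text \<open>For indicators the integral is a multiple of the measure of \<open>moved\<close>. In the
  limit case the error at the shifted point has the same integral as the error at the original
  point, by translation invariance.\<close>

lemma L1_translation_continuous:
  fixes f :: "conf \<Rightarrow> complex"
  assumes "integrable (lebN N) f"
  shows "\<forall>\<delta>>0. \<exists>r>0. \<forall>z. small N r z \<longrightarrow>
    (\<integral>\<^sup>+x. ennreal (norm (f (shift N z x) - f x)) \<partial>lebN N) \<le> ennreal \<delta>"
  using assms
proof (induction rule: integrable_induct)
  case (base A c)
  show ?case
  proof (intro allI impI)
    fix \<delta> :: real assume "\<delta> > 0"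
    \<comment> \<open>The \<open>+ 1\<close> in the denominator takes care of
      \<open>c = 0\<close>.\<close>
    then obtain r where r: "r > 0"
      "\<And>z. small N r z \<Longrightarrow> emeasure (lebN N) (moved N z A) \<le> ennreal (\<delta> / (norm c + 1))"
      using emeasure_moved_small[OF base, of "\<delta> / (norm c + 1)"]
      by (metis add_nonneg_pos divide_pos_pos norm_ge_zero zero_less_one)
    have "(\<integral>\<^sup>+x. ennreal (norm (indicator A (shift N z x) *\<^sub>R c - indicator A x *\<^sub>R c)) \<partial>lebN N) \<le> ennreal \<delta>"
      if "small N r z" for z
    proof -
      have "(\<integral>\<^sup>+x. ennreal (norm (indicator A (shift N z x) *\<^sub>R c - indicator A x *\<^sub>R c)) \<partial>lebN N)
          = (\<integral>\<^sup>+x. ennreal (norm c) * indicator (moved N z A) x \<partial>lebN N)"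
        by (intro nn_integral_cong) (auto simp: moved_def space_lebN indicator_def)
      also have "\<dots> = ennreal (norm c) * emeasure (lebN N) (moved N z A)"
        using base by (subst nn_integral_cmult_indicator) auto
      also have "\<dots> \<le> ennreal (norm c + 1) * ennreal (\<delta> / (norm c + 1))"
        by (intro mult_mono r that) auto
      also have "\<dots> = ennreal ((norm c + 1) * (\<delta> / (norm c + 1)))"
        using \<open>\<delta> > 0\<close> by (intro ennreal_mult[symmetric]) auto
      also have "(norm c + 1) * (\<delta> / (norm c + 1)) = \<delta>"
        by (simp add: add_nonneg_eq_0_iff)
      finally show ?thesis .
    qed
    then show "\<exists>r>0. \<forall>z. small N r z \<longrightarrow>
        (\<integral>\<^sup>+x. ennreal (norm (indicator A (shift N z x) *\<^sub>R c - indicator A x *\<^sub>R c)) \<partial>lebN N) \<le> ennreal \<delta>"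
      using r(1) by blast
  qed
next
  case (add f g)
  have [measurable]: "f \<in> borel_measurable (lebN N)" "g \<in> borel_measurable (lebN N)"
    using add.hyps by auto
  show ?case
  proof (intro allI impI)
    fix \<delta> :: real assume "\<delta> > 0"
    then have "\<delta> / 2 > 0" by simp
    obtain r1 where r1: "r1 > 0" "\<And>z. small N r1 z \<Longrightarrow>
        (\<integral>\<^sup>+x. ennreal (norm (f (shift N z x) - f x)) \<partial>lebN N) \<le> ennreal (\<delta> / 2)"
      using add.IH(1) \<open>\<delta> / 2 > 0\<close> by blast
    obtain r2 where r2: "r2 > 0" "\<And>z. small N r2 z \<Longrightarrow>
        (\<integral>\<^sup>+x. ennreal (norm (g (shift N z x) - g x)) \<partial>lebN N) \<le> ennreal (\<delta> / 2)"
      using add.IH(2) \<open>\<delta> / 2 > 0\<close> by blast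
    have "(\<integral>\<^sup>+x. ennreal (norm (f (shift N z x) + g (shift N z x) - (f x + g x))) \<partial>lebN N) \<le> ennreal \<delta>"
      if z: "small N (min r1 r2) z" for z
    proof -
      have "(\<integral>\<^sup>+x. ennreal (norm (f (shift N z x) + g (shift N z x) - (f x + g x))) \<partial>lebN N)
          \<le> (\<integral>\<^sup>+x. ennreal (norm (f (shift N z x) - f x)) + ennreal (norm (g (shift N z x) - g x)) \<partial>lebN N)"
        by (intro nn_integral_mono)
          (simp add: norm_diff_triangle_ineq flip: ennreal_plus)
      also have "\<dots> = (\<integral>\<^sup>+x. ennreal (norm (f (shift N z x) - f x)) \<partial>lebN N) +
          (\<integral>\<^sup>+x. ennreal (norm (g (shift N z x) - g x)) \<partial>lebN N)"
        by (rule nn_integral_add) measurable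
      also have "\<dots> \<le> ennreal (\<delta> / 2) + ennreal (\<delta> / 2)"
        using z by (intro add_mono r1 r2) (auto elim: small_mono)
      also have "\<dots> = ennreal \<delta>"
        using \<open>\<delta> > 0\<close> by (simp flip: ennreal_plus)
      finally show ?thesis .
    qed
    then show "\<exists>r>0. \<forall>z. small N r z \<longrightarrow>
        (\<integral>\<^sup>+x. ennreal (norm (f (shift N z x) + g (shift N z x) - (f x + g x))) \<partial>lebN N) \<le> ennreal \<delta>"
      using r1(1) r2(1) by (intro exI[of _ "min r1 r2"]) auto
  qed
next
  case (lim f s)
  have [measurable]: "f \<in> borel_measurable (lebN N)" "\<And>i. s i \<in> borel_measurable (lebN N)"
    using lim.hyps by auto
  show ?case
  proof (intro allI impI)
    fix \<delta> :: real assume "\<delta> > 0"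
    have "(\<lambda>i. \<integral>\<^sup>+x. ennreal (norm (f x - s i x)) \<partial>lebN N) \<longlonglongrightarrow> 0"
    proof (rule nn_integral_dominated_convergence_norm[where w = "\<lambda>x. 2 * norm (f x)"])
      show "(\<integral>\<^sup>+x. ennreal (2 * norm (f x)) \<partial>lebN N) < \<infinity>"
        using lim.hyps(4) by (simp add: integrable_iff_bounded ennreal_mult nn_integral_cmult ennreal_mult_less_top)
    qed (use lim.hyps in \<open>auto intro!: AE_I2\<close>)
    then have "eventually (\<lambda>i. (\<integral>\<^sup>+x. ennreal (norm (f x - s i x)) \<partial>lebN N) < ennreal (\<delta> / 3)) sequentially"
      using \<open>\<delta> > 0\<close> by (intro order_tendstoD) auto
    then obtain i where i: "(\<integral>\<^sup>+x. ennreal (norm (f x - s i x)) \<partial>lebN N) \<le> ennreal (\<delta> / 3)"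
      by (auto simp: eventually_sequentially intro: less_imp_le)
    have "\<delta> / 3 > 0"
      using \<open>\<delta> > 0\<close> by simp
    then obtain r where r: "r > 0" "\<And>z. small N r z \<Longrightarrow>
        (\<integral>\<^sup>+x. ennreal (norm (s i (shift N z x) - s i x)) \<partial>lebN N) \<le> ennreal (\<delta> / 3)"
      using lim.IH[of i] by blast
    have "(\<integral>\<^sup>+x. ennreal (norm (f (shift N z x) - f x)) \<partial>lebN N) \<le> ennreal \<delta>" if z: "small N r z" for z
    proof -
      have tri: "norm (f y - f x) \<le> norm (f y - s i y) + norm (s i y - s i x) + norm (f x - s i x)" for x y
        using norm_triangle_ineq[of "f y - s i y" "s i y - s i x"]
          norm_triangle_ineq4[of "f y - s i x" "f x - s i x"] by simp
      have "(\<integral>\<^sup>+x. ennreal (norm (f (shift N z x) - f x)) \<partial>lebN N)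
          \<le> (\<integral>\<^sup>+x. ennreal (norm (f (shift N z x) - s i (shift N z x)))
            + ennreal (norm (s i (shift N z x) - s i x)) + ennreal (norm (f x - s i x)) \<partial>lebN N)"
        using tri by (intro nn_integral_mono) (simp flip: ennreal_plus)
      also have "\<dots> = (\<integral>\<^sup>+x. ennreal (norm (f (shift N z x) - s i (shift N z x))) \<partial>lebN N)
          + (\<integral>\<^sup>+x. ennreal (norm (s i (shift N z x) - s i x)) \<partial>lebN N)
          + (\<integral>\<^sup>+x. ennreal (norm (f x - s i x)) \<partial>lebN N)"
        by (simp add: nn_integral_add)
      also have "(\<integral>\<^sup>+x. ennreal (norm (f (shift N z x) - s i (shift N z x))) \<partial>lebN N)
          = (\<integral>\<^sup>+x. ennreal (norm (f x - s i x)) \<partial>lebN N)"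
        by (rule nn_integral_shift) measurable
      also have "(\<integral>\<^sup>+x. ennreal (norm (f x - s i x)) \<partial>lebN N)
          + (\<integral>\<^sup>+x. ennreal (norm (s i (shift N z x) - s i x)) \<partial>lebN N)
          + (\<integral>\<^sup>+x. ennreal (norm (f x - s i x)) \<partial>lebN N) \<le> ennreal (\<delta> / 3) + ennreal (\<delta> / 3) + ennreal (\<delta> / 3)"
        by (intro add_mono i r z)
      also have "\<dots> = ennreal \<delta>"
        using \<open>\<delta> > 0\<close> by (simp flip: ennreal_plus)
      finally show ?thesis .
    qed
    then show "\<exists>r>0. \<forall>z. small N r z \<longrightarrow>
        (\<integral>\<^sup>+x. ennreal (norm (f (shift N z x) - f x)) \<partial>lebN N) \<le> ennreal \<delta>"
      using r(1) by blast
  qed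
qed

text \<open>This makes \<open>p \<mapsto> \<bar>p\<bar> p\<close> a device for reducing \<open>L\<^sup>2\<close> statements to \<open>L\<^sup>1\<close> statements.\<close>

lemma norm_diff_square_le:
  fixes p q :: "'a::real_inner"
  shows "(norm (p - q))\<^sup>2 \<le> 2 * norm (norm p *\<^sub>R p - norm q *\<^sub>R q)"
proof (cases "p = q")
  case False
  let ?a = "norm p" and ?b = "norm q" and ?d = "norm (p - q)"
  have pq: "2 * inner p q = ?a\<^sup>2 + ?b\<^sup>2 - ?d\<^sup>2"
    by (simp add: power2_norm_eq_inner inner_diff inner_commute algebra_simps)
  \<comment> \<open>With a, b, d the norms of \<open>p\<close>, \<open>q\<close>,
    \<open>p - q\<close>, this pairing equals (a + b)((a - b)^2 + d^2), which is at least d^3 since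
    d \<le> a + b. Cauchy-Schwarz bounds it from above by d times the right-hand side of the claim,
    and one factor d cancels.\<close>
  have "2 * inner (p - q) (?a *\<^sub>R p - ?b *\<^sub>R q) = 2 * ?a ^ 3 + 2 * ?b ^ 3 - (?a + ?b) * (2 * inner p q)"
    by (simp add: inner_diff inner_commute power2_norm_eq_inner[symmetric] power3_eq_cube power2_eq_square algebra_simps)
  also have "\<dots> = (?a + ?b) * ((?a - ?b)\<^sup>2 + ?d\<^sup>2)"
    unfolding pq by (simp add: power2_eq_square power3_eq_cube algebra_simps)
  also have "\<dots> \<ge> ?d * ?d\<^sup>2"
    using norm_triangle_ineq4[of p q] by (intro mult_mono) auto
  finally have "?d * ?d\<^sup>2 \<le> 2 * inner (p - q) (?a *\<^sub>R p - ?b *\<^sub>R q)" .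
  also have "\<dots> \<le> ?d * (2 * norm (?a *\<^sub>R p - ?b *\<^sub>R q))"
    using norm_cauchy_schwarz[of "p - q" "?a *\<^sub>R p - ?b *\<^sub>R q"] by simp
  finally show ?thesis
    using False by (simp add: mult_le_cancel_left)
qed simp

lemma L2_translation_continuous:
  assumes "square_int N f" "\<delta> > 0"
  shows "\<exists>r>0. \<forall>z. small N r z \<longrightarrow>
    (\<integral>\<^sup>+x. ennreal ((cmod (f (shift N z x) - f x))\<^sup>2) \<partial>lebN N) \<le> ennreal \<delta>"
proof -
  let ?g = "\<lambda>x. cmod (f x) *\<^sub>R f x"
  have f [measurable]: "f \<in> borel_measurable (lebN N)"
    using assms by (simp add: square_int_def)
  have "integrable (lebN N) ?g"
  proof (rule Bochner_Integration.integrable_bound)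
    show "integrable (lebN N) (\<lambda>x. (cmod (f x))\<^sup>2)"
      using assms by (simp add: square_int_def)
  qed (auto simp: power2_eq_square)
  moreover have "\<delta> / 2 > 0"
    using assms by simp
  ultimately obtain r where r: "r > 0" "\<And>z. small N r z \<Longrightarrow>
      (\<integral>\<^sup>+x. ennreal (norm (?g (shift N z x) - ?g x)) \<partial>lebN N) \<le> ennreal (\<delta> / 2)"
    using L1_translation_continuous by blast
  have "(\<integral>\<^sup>+x. ennreal ((cmod (f (shift N z x) - f x))\<^sup>2) \<partial>lebN N) \<le> ennreal \<delta>" if "small N r z" for z
  proof -
    have "(\<integral>\<^sup>+x. ennreal ((cmod (f (shift N z x) - f x))\<^sup>2) \<partial>lebN N)
        \<le> (\<integral>\<^sup>+x. ennreal 2 * ennreal (norm (?g (shift N z x) - ?g x)) \<partial>lebN N)"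
      by (intro nn_integral_mono)
        (simp add: norm_diff_square_le flip: ennreal_mult del: ennreal_numeral)
    also have "\<dots> = ennreal 2 * (\<integral>\<^sup>+x. ennreal (norm (?g (shift N z x) - ?g x)) \<partial>lebN N)"
      by (rule nn_integral_cmult) measurable
    also have "\<dots> \<le> ennreal 2 * ennreal (\<delta> / 2)"
      by (intro mult_left_mono r that) simp
    also have "\<dots> = ennreal \<delta>"
      using assms by (simp flip: ennreal_mult del: ennreal_numeral)
    finally show ?thesis .
  qed
  then show ?thesis
    using r(1) by blast
qed

subsection \<open>Removing the origin\<close>

definition bump1 :: "real \<Rightarrow> real"
  where "bump1 t = flat 1 (1 - t) * flat 1 (1 + t)"

text \<open>One profile for three purposes: with \<open>J = {m}\<close> it makes the cutoff near the
  origin; with all particles, stretched it makes the cutoff at infinity and shrunk it makes the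
  mollifier. Normalizations are divided out where they matter.\<close>

definition bump :: "nat set \<Rightarrow> conf \<Rightarrow> real"
  where "bump J x = (\<Prod>j\<in>J. \<Prod>k\<in>UNIV. bump1 (x j $ k))"

lemma bump1_nonneg: "bump1 t \<ge> 0"
  by (simp add: bump1_def flat_1_nonneg)

lemma bump1_eq_0: "1 < \<bar>t\<bar> \<Longrightarrow> bump1 t = 0"
  by (auto simp: bump1_def flat_1_eq_0_iff)

lemma bump1_pos: "\<bar>t\<bar> < 1 \<Longrightarrow> bump1 t > 0"
  using bump1_nonneg[of t] flat_1_eq_0_iff[of "1 - t"] flat_1_eq_0_iff[of "1 + t"]
  by (auto simp: bump1_def less_le)

lemma bump1_minus: "bump1 (- t) = bump1 t"
  by (simp add: bump1_def mult.commute)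

lemma bump_smooth_alg:
  assumes "finite J"
  shows "smooth_alg J (bump J)"
proof -
  have "smooth_alg J (\<lambda>x. flat 1 (1 + a * x j $ k))" if "j \<in> J" for j k a
    by (intro smooth_alg.comp[OF _ smooth1_flat] smooth_alg.add smooth_alg.mult smooth_alg.const
        smooth_alg.coord that)
  from this[of _ "- 1"] this[of _ 1]
  have "smooth_alg J (\<lambda>x. bump1 (x j $ k))" if "j \<in> J" for j k
    unfolding bump1_def using that by (intro smooth_alg.mult) auto
  then show ?thesis
    unfolding bump_def[abs_def] by (intro smooth_alg_prod assms) auto
qed

lemma bump_csupp:
  assumes "finite J"
  shows "csupp J 1 (bump J)"
  unfolding csupp_def bump_def
proof (intro allI ballI impI)
  fix x :: conf and j and k :: 3 assume "j \<in> J" "1 < \<bar>x j $ k\<bar>"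
  then have "(\<Prod>k\<in>UNIV. bump1 (x j $ k)) = 0"
    by (intro prod_zero) (auto intro!: bexI[of _ k] bump1_eq_0)
  then show "(\<Prod>j\<in>J. \<Prod>k\<in>UNIV. bump1 (x j $ k)) = 0"
    using \<open>j \<in> J\<close> assms by (intro prod_zero) auto
qed

lemma bump_nonneg: "bump J x \<ge> 0"
  unfolding bump_def by (intro prod_nonneg ballI bump1_nonneg)

lemma bump_pos:
  assumes "finite J" "\<And>j k. j \<in> J \<Longrightarrow> \<bar>x j $ k\<bar> < 1"
  shows "bump J x > 0"
  unfolding bump_def by (intro prod_pos ballI bump1_pos) (use assms in auto)

lemma bump1_continuous: "isCont bump1 t"
proof -
  have c: "isCont (flat 1) s" for s
    by (rule DERIV_isCont[OF flat_has_derivative])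
  have "isCont (\<lambda>t. flat 1 (1 - t)) t" "isCont (\<lambda>t. flat 1 (1 + t)) t"
    by (rule isCont_o2[OF _ c], simp)+
  then show ?thesis
    unfolding bump1_def[abs_def] by (rule isCont_mult)
qed

text \<open>The numerator vanishes where the bump is large, that is when particle \<open>m\<close> is near the origin; the
  quotient is 1 where the bump vanishes.\<close>

definition cutoff :: "nat \<Rightarrow> conf \<Rightarrow> real"
  where "cutoff m x = flat 1 (bump {m} (\<lambda>_. 0) / 2 - bump {m} x) / flat 1 (bump {m} (\<lambda>_. 0) / 2)"

lemma cutoff_smooth_alg: "smooth_alg {m} (cutoff m)"
proof -
  define a where "a = bump {m} (\<lambda>_. 0) / 2"
  define d where "d = inverse (flat 1 a)"
  have "smooth_alg {m} (\<lambda>x. d * flat 1 (a + (- 1) * bump {m} x))"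
    by (intro smooth_alg.mult smooth_alg.const smooth_alg.comp[OF _ smooth1_flat] smooth_alg.add bump_smooth_alg) simp
  moreover have "cutoff m x = d * flat 1 (a + (- 1) * bump {m} x)" for x
    unfolding cutoff_def a_def[symmetric] d_def by (simp add: divide_inverse mult.commute)
  ultimately show ?thesis
    by presburger
qed

lemma cutoff_csupp: "csupp {m} 1 (\<lambda>x. 1 - cutoff m x)"
proof -
  have "bump {m} (\<lambda>_. 0) > 0"
    by (intro bump_pos) auto
  then have "flat 1 (bump {m} (\<lambda>_. 0) / 2) \<noteq> 0"
    by (simp add: flat_1_eq_0_iff)
  then show ?thesis
    using bump_csupp[of "{m}"] by (auto simp: csupp_def cutoff_def)
qed

lemma cutoff_vanish: "vanish_near_0 {m} (cutoff m)"
proof -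
  let ?b = "bump1 0"
  have b: "?b > 0"
    by (intro bump1_pos) simp
  \<comment> \<open>The product of three such factors must be at least half the maximal value
    \<open>?b ^ 3\<close>; the cube of 9/10 is 0.729, so this factor is large enough.\<close>
  have "eventually (\<lambda>t. 9 / 10 * ?b < bump1 t) (at 0)"
    using bump1_continuous[of 0] b unfolding isCont_def by (intro order_tendstoD(1)) auto
  then obtain r where r: "r > 0" and near: "\<And>t. t \<noteq> 0 \<Longrightarrow> \<bar>t\<bar> < r \<Longrightarrow> 9 / 10 * ?b < bump1 t"
    by (auto simp: eventually_at)
  have lower: "9 / 10 * ?b < bump1 t" if "\<bar>t\<bar> < r" for t
    using near[of t] that b by (cases "t = 0") auto
  have "cutoff m x = 0" if "\<And>k. \<bar>x m $ k\<bar> < r" for x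
  proof -
    have "(9 / 10 * ?b) ^ 3 = (\<Prod>k\<in>(UNIV :: 3 set). 9 / 10 * ?b)"
      by simp
    also have "\<dots> \<le> (\<Prod>k\<in>UNIV. bump1 (x m $ k))"
      using lower[OF that] b by (intro prod_mono) (auto intro: less_imp_le)
    finally have "(9 / 10 * ?b) ^ 3 \<le> bump {m} x"
      by (simp add: bump_def)
    moreover have "bump {m} (\<lambda>_. 0) / 2 \<le> (9 / 10 * ?b) ^ 3"
      using b by (simp add: bump_def power_mult_distrib power_divide)
    ultimately show ?thesis
      by (simp add: cutoff_def flat_1_eq_0_iff)
  qed
  then show ?thesis
    unfolding vanish_near_0_def using r by auto
qed

lemma slab_measure:
  assumes m: "m < N" and L: "L \<ge> 0" and e: "e \<ge> 0"
  shows "{x \<in> cubeN N L. \<forall>k. \<bar>x m $ k\<bar> \<le> e} \<in> sets (lebN N)"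
    and "emeasure (lebN N) {x \<in> cubeN N L. \<forall>k. \<bar>x m $ k\<bar> \<le> e} \<le> ennreal ((2 * L) ^ (3 * (N - 1)) * (2 * e) ^ 3)"
proof -
  let ?A = "\<lambda>i. cube 0 L \<inter> (if i = m then cube 0 e else UNIV)"
  have eq: "{x \<in> cubeN N L. \<forall>k. \<bar>x m $ k\<bar> \<le> e} = PiE {..<N} ?A"
    using m by (auto simp: cubeN_def PiE_iff extensional_def cube_def split: if_splits)
  show "{x \<in> cubeN N L. \<forall>k. \<bar>x m $ k\<bar> \<le> e} \<in> sets (lebN N)"
    unfolding eq lebN_def by (intro sets_PiM_I_finite) auto
  have "emeasure (lebN N) (PiE {..<N} ?A) = (\<Prod>i<N. emeasure lborel (?A i))"
    by (rule emeasure_lebN_PiE) auto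
  also have "\<dots> = emeasure lborel (?A m) * (\<Prod>i\<in>{..<N} - {m}. emeasure lborel (?A i))"
    using m by (subst prod.remove[of _ m]) auto
  also have "(\<Prod>i\<in>{..<N} - {m}. emeasure lborel (?A i)) = (\<Prod>i\<in>{..<N} - {m}. ennreal ((2 * L) ^ 3))"
    using L by (intro prod.cong) (auto simp: emeasure_cube)
  also have "emeasure lborel (?A m) \<le> ennreal ((2 * e) ^ 3)"
    using emeasure_mono[of "?A m" "cube 0 e" lborel] e by (simp add: emeasure_cube)
  finally have "emeasure (lebN N) (PiE {..<N} ?A)
      \<le> ennreal ((2 * e) ^ 3) * (\<Prod>i\<in>{..<N} - {m}. ennreal ((2 * L) ^ 3))"
    by (simp add: mult_right_mono)
  also have "\<dots> = ennreal ((2 * L) ^ (3 * (N - 1)) * (2 * e) ^ 3)"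
    using m L e by (simp add: ennreal_power power_mult mult.commute flip: ennreal_mult)
  finally show "emeasure (lebN N) {x \<in> cubeN N L. \<forall>k. \<bar>x m $ k\<bar> \<le> e} \<le> ennreal ((2 * L) ^ (3 * (N - 1)) * (2 * e) ^ 3)"
    unfolding eq .
qed

text \<open>A slab of width \<open>1 / n\<close> around \<open>x m = 0\<close> has measure of order \<open>n\<^sup>-\<^sup>3\<close>: codimension 3 is what
  beats the factor \<open>n\<close> produced by differentiating the cutoff.\<close>

lemma slab_integral_tendsto_0:
  assumes w: "square_int N w" and m: "m < N"
    and g: "g \<in> borel_measurable (lebN N)" "\<And>x. \<bar>g x\<bar> \<le> M" "csupp {..<N} L g"
    and h: "\<And>n. h n \<in> borel_measurable (lebN N)" "\<And>n x. \<bar>h n x\<bar> \<le> M'"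
      "\<And>n x k. 1 / real (Suc n) < \<bar>x m $ k\<bar> \<Longrightarrow> h n x = 0"
  shows "(\<lambda>n. real (Suc n) * norm (LINT x|lebN N. w x * of_real (g x * h n x))) \<longlonglongrightarrow> 0"
proof -
  define L' where "L' = max L 0"
  \<comment> \<open>The slab of half-width \<open>1 / Suc n\<close> has measure at most
    \<open>V / (Suc n) ^ 3\<close>; the 8 is the cube of the 2 in the side length.\<close>
  define V where "V = (2 * L') ^ (3 * (N - 1)) * 8"
  define W where "W = (LINT x|lebN N. (cmod (w x))\<^sup>2)"
  have V: "V \<ge> 0" and M: "M \<ge> 0" "M' \<ge> 0"
    using g(2)[of undefined] h(2)[of undefined undefined] by (auto simp: V_def L'_def)
  have [measurable]: "w \<in> borel_measurable (lebN N)" "g \<in> borel_measurable (lebN N)"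
    "\<And>n. h n \<in> borel_measurable (lebN N)"
    using w g h by (auto simp: square_int_def)
  have bound: "real (Suc n) * norm (LINT x|lebN N. w x * of_real (g x * h n x)) \<le> M * M' * (W + V) / sqrt (Suc n)" for n
  proof -
    let ?n = "real (Suc n)"
    define S where "S = {x \<in> cubeN N L'. \<forall>k. \<bar>x m $ k\<bar> \<le> 1 / ?n}"
    have S: "S \<in> sets (lebN N)"
      unfolding S_def by (rule slab_measure) (use m in \<open>auto simp: L'_def\<close>)
    have "emeasure (lebN N) S \<le> ennreal ((2 * L') ^ (3 * (N - 1)) * (2 * (1 / ?n)) ^ 3)"
      unfolding S_def by (rule slab_measure) (use m in \<open>auto simp: L'_def\<close>)
    also have "(2 * L') ^ (3 * (N - 1)) * (2 * (1 / ?n)) ^ 3 = V / ?n ^ 3"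
      by (simp add: V_def power_divide del: of_nat_Suc)
    finally have eS: "emeasure (lebN N) S \<le> ennreal (V / ?n ^ 3)" .
    then have "emeasure (lebN N) S < \<infinity>"
      by (rule le_less_trans) simp
    then have int_S: "integrable (lebN N) (indicator S :: conf \<Rightarrow> real)"
      using S by (simp add: integrable_indicator_iff)
    have mS: "measure (lebN N) S \<le> V / ?n ^ 3"
      using eS V by (simp add: measure_def enn2real_leI del: of_nat_Suc)
    have int_w: "integrable (lebN N) (\<lambda>x. (cmod (w x))\<^sup>2)"
      using w by (simp add: square_int_def)
    \<comment> \<open>Young's inequality replaces Cauchy-Schwarz, with weight n sqrt n: its square
      n^3 is compensated by the measure of the slab, and the prefactor of order n^(-3/2) leaves
      n^(-1/2) after multiplication by n.\<close>
    have pointwise: "norm (w x * of_real (g x * h n x))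
        \<le> M * M' / (2 * ?n * sqrt ?n) * ((cmod (w x))\<^sup>2 + ?n ^ 3 * indicator S x)" if x: "x \<in> confs N" for x
    proof (cases "x \<in> S")
      case True
      have "2 * (cmod (w x) * (?n * sqrt ?n)) \<le> (cmod (w x))\<^sup>2 + (?n * sqrt ?n)\<^sup>2"
        by (rule two_mult_le_squares)
      also have "(?n * sqrt ?n)\<^sup>2 = ?n ^ 3"
        by (simp add: power_mult_distrib power2_eq_square power3_eq_cube del: of_nat_Suc)
      finally have "cmod (w x) \<le> ((cmod (w x))\<^sup>2 + ?n ^ 3) / (2 * ?n * sqrt ?n)"
        by (simp add: pos_le_divide_eq mult_ac del: of_nat_Suc)
      then have "cmod (w x) * (\<bar>g x\<bar> * \<bar>h n x\<bar>) \<le> ((cmod (w x))\<^sup>2 + ?n ^ 3) / (2 * ?n * sqrt ?n) * (M * M')"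
        using g(2) h(2) M by (intro mult_mono) auto
      then show ?thesis
        using True by (simp add: norm_mult abs_mult mult_ac del: of_nat_Suc)
    next
      case False
      have gh: "g x * h n x = 0"
      proof (cases "x \<in> cubeN N L'")
        case True
        then show ?thesis
          using False h(3)[of n x] by (auto simp: S_def not_le)
      next
        case F: False
        then show ?thesis
          using csupp_cubeN[OF g(3), of x] x cubeN_mono[of L L' N] by (auto simp: L'_def)
      qed
      show ?thesis
        unfolding gh using M by simp
    qed
    have nonneg: "0 \<le> M * M' / (2 * ?n * sqrt ?n) * ((cmod (w x))\<^sup>2 + ?n ^ 3 * indicator S x)" for x
      using M by simp
    have "norm (LINT x|lebN N. w x * of_real (g x * h n x)) \<le> (LINT x|lebN N. norm (w x * of_real (g x * h n x)))"
      by (rule integral_norm_bound)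
    also have "\<dots> \<le> (LINT x|lebN N. M * M' / (2 * ?n * sqrt ?n) * ((cmod (w x))\<^sup>2 + ?n ^ 3 * indicator S x))"
    proof (rule Bochner_Integration.integral_mono_AE')
      show "integrable (lebN N) (\<lambda>x. M * M' / (2 * ?n * sqrt ?n) * ((cmod (w x))\<^sup>2 + ?n ^ 3 * indicator S x))"
        by (intro integrable_mult_right Bochner_Integration.integrable_add int_w int_S)
      show "AE x in lebN N. norm (w x * of_real (g x * h n x))
          \<le> M * M' / (2 * ?n * sqrt ?n) * ((cmod (w x))\<^sup>2 + ?n ^ 3 * indicator S x)"
        using pointwise by (intro AE_I2) (simp only: space_lebN)
    qed (rule AE_I2, rule nonneg)
    also have "\<dots> = M * M' / (2 * ?n * sqrt ?n) * (W + ?n ^ 3 * measure (lebN N) S)"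
      using int_w int_S S sets.sets_into_space[OF S] by (simp add: W_def Int_absorb2 del: of_nat_Suc)
    also have "\<dots> \<le> M * M' / (2 * ?n * sqrt ?n) * (W + ?n ^ 3 * (V / ?n ^ 3))"
      using M mS by (intro mult_left_mono add_left_mono) (auto simp del: of_nat_Suc)
    also have "\<dots> = M * M' / (2 * ?n * sqrt ?n) * (W + V)"
      by (simp del: of_nat_Suc)
    finally have "?n * norm (LINT x|lebN N. w x * of_real (g x * h n x))
        \<le> ?n * (M * M' / (2 * ?n * sqrt ?n) * (W + V))"
      by (intro mult_left_mono) auto
    also have "\<dots> = M * M' * (W + V) / sqrt ?n / 2"
      by (simp del: of_nat_Suc)
    also have "\<dots> \<le> M * M' * (W + V) / sqrt ?n"
    proof -
      have "W \<ge> 0"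
        unfolding W_def by (intro integral_nonneg_AE) auto
      then have "0 \<le> M * M' * (W + V) / sqrt ?n"
        using V M by auto
      moreover have "y / 2 \<le> y" if "0 \<le> y" for y :: real
        using that by simp
      ultimately show ?thesis
        by blast
    qed
    finally show ?thesis .
  qed
  have "(\<lambda>n. M * M' * (W + V) * inverse (sqrt (real (Suc n)))) \<longlonglongrightarrow> M * M' * (W + V) * 0"
    by (intro tendsto_mult tendsto_const tendsto_inverse_0_at_top
        filterlim_compose[OF sqrt_at_top filterlim_compose[OF filterlim_real_sequentially filterlim_Suc]])
  then have lim: "(\<lambda>n. M * M' * (W + V) / sqrt (Suc n)) \<longlonglongrightarrow> 0"
    by (simp add: divide_inverse)
  show ?thesis
    by (rule tendsto_sandwich[OF _ _ tendsto_const lim]) (use bound in auto)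
qed

section \<open>Symmetric first-order operators with constant coefficients in weak form\<close>

text \<open>Matrix form of an operator \<Sum> A \<partial> + B that is formally symmetric: partial
  derivatives are antisymmetric, so their coefficient matrices have to be antihermitian. Row
  \<open>s\<close> and column \<open>t\<close> mean that component \<open>t\<close> contributes to
  component \<open>s\<close>. This structure is all that the removal of the origin and the doubling
  argument need to know about the Dirac operator.\<close>

locale first_order_symbol =
  fixes N :: nat and A :: "nat \<Rightarrow> 3 \<Rightarrow> spin \<Rightarrow> spin \<Rightarrow> complex" and B :: "spin \<Rightarrow> spin \<Rightarrow> complex"
  assumes A_antihermitian: "cnj (A j k s t) = - A j k t s"
    and B_hermitian: "cnj (B s t) = B t s"
begin

text \<open>The pairing of \<open>u\<close> with the operator applied to the test function with single component
  \<open>f\<close> at spin index \<open>t\<close> equals the pairing of \<open>v\<close> with that test function.\<close>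

definition weak_at :: "wavefun \<Rightarrow> wavefun \<Rightarrow> (conf \<Rightarrow> real) \<Rightarrow> bool"
  where "weak_at u v f \<longleftrightarrow> (\<forall>t\<in>spins N.
    (\<Sum>j<N. \<Sum>k\<in>UNIV. \<Sum>s\<in>spins N. A j k s t * (LINT x|lebN N. cnj (u x s) * of_real (pd j k f x)))
    + (\<Sum>s\<in>spins N. B s t * (LINT x|lebN N. cnj (u x s) * of_real (f x)))
    = (LINT x|lebN N. cnj (v x t) * of_real (f x)))"

lemma weak_at_limit:
  assumes "\<And>n. weak_at u v (f n)"
    and 1: "\<And>s. s \<in> spins N \<Longrightarrow> (\<lambda>n. LINT x|lebN N. cnj (u x s) * of_real (f n x)) \<longlonglongrightarrow>
      (LINT x|lebN N. cnj (u x s) * of_real (g x))"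
    and 2: "\<And>s. s \<in> spins N \<Longrightarrow> (\<lambda>n. LINT x|lebN N. cnj (v x s) * of_real (f n x)) \<longlonglongrightarrow>
      (LINT x|lebN N. cnj (v x s) * of_real (g x))"
    and 3: "\<And>s j k. s \<in> spins N \<Longrightarrow> j < N \<Longrightarrow> (\<lambda>n. LINT x|lebN N. cnj (u x s) * of_real (pd j k (f n) x)) \<longlonglongrightarrow>
      (LINT x|lebN N. cnj (u x s) * of_real (pd j k g x))"
  shows "weak_at u v g"
  unfolding weak_at_def
proof
  fix t assume t: "t \<in> spins N"
  have "(\<lambda>n. (\<Sum>j<N. \<Sum>k\<in>UNIV. \<Sum>s\<in>spins N. A j k s t * (LINT x|lebN N. cnj (u x s) * of_real (pd j k (f n) x)))
    + (\<Sum>s\<in>spins N. B s t * (LINT x|lebN N. cnj (u x s) * of_real (f n x)))) \<longlonglongrightarrow>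
    (\<Sum>j<N. \<Sum>k\<in>UNIV. \<Sum>s\<in>spins N. A j k s t * (LINT x|lebN N. cnj (u x s) * of_real (pd j k g x)))
    + (\<Sum>s\<in>spins N. B s t * (LINT x|lebN N. cnj (u x s) * of_real (g x)))"
    by (intro tendsto_add tendsto_sum tendsto_mult tendsto_const 1 3) auto
  then show "(\<Sum>j<N. \<Sum>k\<in>UNIV. \<Sum>s\<in>spins N. A j k s t * (LINT x|lebN N. cnj (u x s) * of_real (pd j k g x)))
    + (\<Sum>s\<in>spins N. B s t * (LINT x|lebN N. cnj (u x s) * of_real (g x)))
    = (LINT x|lebN N. cnj (v x t) * of_real (g x))"
    using LIMSEQ_unique 2[OF t] assms(1) t unfolding weak_at_def by auto
qed

end

lemma integrable_square_int_real:
  assumes "square_int N w" "smooth_alg {..<N} f" "csupp {..<N} L f"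
  shows "integrable (lebN N) (\<lambda>x. w x * complex_of_real (f x))"
  using integrable_square_int_mult[OF assms(1) square_int_of_real[OF assms(2,3)]] .

text \<open>Both limits come from the slab estimate, applied to \<open>1 - cutoff m\<close> and to a
  derivative of \<open>cutoff m\<close>. Both are supported near the origin of particle
  \<open>m\<close>, and dilation by \<open>Suc n\<close> puts them into the slab of width
  \<open>1 / Suc n\<close>.\<close>

lemma integral_cutoff_tendsto:
  assumes w: "square_int N w" and m: "m < N" and g: "smooth_alg {..<N} g" "csupp {..<N} L g"
  shows "(\<lambda>n. LINT x|lebN N. w x * of_real (g x * cutoff m (\<lambda>i. real (Suc n) *\<^sub>R x i))) \<longlonglongrightarrow>
      (LINT x|lebN N. w x * of_real (g x))" (is ?thesis1)
    and "(\<lambda>n. LINT x|lebN N. w x * of_real (g x * (real (Suc n) * pd j k (cutoff m) (\<lambda>i. real (Suc n) *\<^sub>R x i)))) \<longlonglongrightarrow> 0"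
      (is ?thesis2)
proof -
  obtain M where M: "\<And>x. \<bar>g x\<bar> \<le> M"
    using smooth_alg_bounded[OF g] by blast
  have sm: "smooth_alg {m} (\<lambda>x. 1 - cutoff m x)"
    using smooth_alg.add[OF smooth_alg.const[of _ 1] smooth_alg.mult[OF smooth_alg.const[of _ "- 1"] cutoff_smooth_alg[of m]]]
    by simp
  have smN: "smooth_alg {..<N} f" if "smooth_alg {m} f" for f
    using smooth_alg_mono[OF that, of "{..<N}"] m by simp
  have scale: "smooth_alg {..<N} (\<lambda>x. f (\<lambda>i. a *\<^sub>R x i))" if "smooth_alg {m} f" for f a
    using smooth_alg_affine[OF smN[OF that], of a "\<lambda>_. 0"] by simp
  have main: "(\<lambda>n. real (Suc n) * norm (LINT x|lebN N. w x * of_real (g x * h (\<lambda>i. real (Suc n) *\<^sub>R x i)))) \<longlonglongrightarrow> 0"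
    if h: "smooth_alg {m} h" "csupp {m} 1 h" for h
  proof -
    obtain M' where M': "\<And>x. \<bar>h x\<bar> \<le> M'"
      using smooth_alg_bounded[OF h] by blast
    show ?thesis
    proof (rule slab_integral_tendsto_0[OF w m smooth_alg_measurable[OF g(1)] M g(2)])
      show "(\<lambda>x. h (\<lambda>i. real (Suc n) *\<^sub>R x i)) \<in> borel_measurable (lebN N)" for n
        by (rule smooth_alg_measurable[OF scale[OF h(1)]])
      show "h (\<lambda>i. real (Suc n) *\<^sub>R x i) = 0" if "1 / real (Suc n) < \<bar>x m $ k\<bar>" for n x k
      proof -
        have "1 < \<bar>(real (Suc n) *\<^sub>R x m) $ k\<bar>"
          using that by (simp add: abs_mult field_simps del: of_nat_Suc)
        then show ?thesis
          using h(2)[unfolded csupp_def, THEN spec, of "\<lambda>i. real (Suc n) *\<^sub>R x i", THEN bspec, of m, THEN spec, of k]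
          by (simp del: of_nat_Suc)
      qed
    qed (rule M')
  qed
  \<comment> \<open>The slab estimate controls even \<open>Suc n\<close> times this integral; the
    factor is needed for derivatives and is given away here.\<close>
  have "norm (LINT x|lebN N. w x * of_real (g x * (1 - cutoff m (\<lambda>i. real (Suc n) *\<^sub>R x i))))
      \<le> real (Suc n) * norm (LINT x|lebN N. w x * of_real (g x * (1 - cutoff m (\<lambda>i. real (Suc n) *\<^sub>R x i))))" for n
    using mult_right_mono[of 1 "real (Suc n)" "norm (LINT x|lebN N. w x * of_real (g x * (1 - cutoff m (\<lambda>i. real (Suc n) *\<^sub>R x i))))"]
    by simp
  then have "(\<lambda>n. LINT x|lebN N. w x * of_real (g x * (1 - cutoff m (\<lambda>i. real (Suc n) *\<^sub>R x i)))) \<longlonglongrightarrow> 0"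
    using main[OF sm cutoff_csupp] by (intro Lim_null_comparison[OF _ main[OF sm cutoff_csupp]]) auto
  then have "(\<lambda>n. (LINT x|lebN N. w x * of_real (g x))
      - (LINT x|lebN N. w x * of_real (g x * (1 - cutoff m (\<lambda>i. real (Suc n) *\<^sub>R x i))))) \<longlonglongrightarrow>
      (LINT x|lebN N. w x * of_real (g x)) - 0"
    by (intro tendsto_diff tendsto_const)
  moreover have "(LINT x|lebN N. w x * of_real (g x))
      - (LINT x|lebN N. w x * of_real (g x * (1 - cutoff m (\<lambda>i. real (Suc n) *\<^sub>R x i))))
      = (LINT x|lebN N. w x * of_real (g x * cutoff m (\<lambda>i. real (Suc n) *\<^sub>R x i)))" for n
  proof -
    have "smooth_alg {..<N} (\<lambda>x. g x * (1 - cutoff m (\<lambda>i. real (Suc n) *\<^sub>R x i)))"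
      by (intro smooth_alg.mult g scale[OF sm])
    then have "integrable (lebN N) (\<lambda>x. w x * of_real (g x * (1 - cutoff m (\<lambda>i. real (Suc n) *\<^sub>R x i))))"
      by (rule integrable_square_int_real[OF w]) (rule csupp_mult[OF g(2)])
    from Bochner_Integration.integral_diff[OF integrable_square_int_real[OF w g] this]
    show ?thesis
      by (simp add: algebra_simps)
  qed
  ultimately show ?thesis1
    by simp
  have "pd j k (\<lambda>x. 1 - cutoff m x) = (\<lambda>x. - pd j k (cutoff m) x)"
    by (rule pd_eqI, rule DERIV_cong[OF DERIV_diff[OF DERIV_const smooth_alg_has_pd[OF cutoff_smooth_alg]]]) simp
  then have csp: "csupp {m} 1 (pd j k (cutoff m))"
    using csupp_pd[OF sm cutoff_csupp, of j k] by (simp add: csupp_def)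
  have "(\<lambda>n. norm (LINT x|lebN N. w x * of_real (g x * (real (Suc n) * pd j k (cutoff m) (\<lambda>i. real (Suc n) *\<^sub>R x i))))) \<longlonglongrightarrow> 0"
  proof -
    have "(LINT x|lebN N. w x * of_real (g x * (real (Suc n) * pd j k (cutoff m) (\<lambda>i. real (Suc n) *\<^sub>R x i))))
        = of_real (real (Suc n)) * (LINT x|lebN N. w x * of_real (g x * pd j k (cutoff m) (\<lambda>i. real (Suc n) *\<^sub>R x i)))" for n
      by (subst integral_mult_right_zero[symmetric]) (simp add: mult_ac del: of_nat_Suc)
    then show ?thesis
      using main[OF smooth_alg_pd[OF cutoff_smooth_alg] csp] by (simp add: norm_mult del: of_nat_Suc)
  qed
  then show ?thesis2
    by (rule tendsto_norm_zero_cancel)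
qed

context first_order_symbol
begin

text \<open>The origins are restored one particle at a time. At stage \<open>m\<close> the test
  function has to vanish only near the origins of particles \<open>m\<close> and above: stage 0 is
  the hypothesis, and stage \<open>N\<close> imposes no condition. The step multiplies by a dilated
  cutoff in particle \<open>m\<close> and passes to the limit.\<close>

lemma weak_at_remove_origin:
  assumes u: "u \<in> L2 N" and v: "v \<in> L2 N"
    and weak: "\<And>f L. smooth_alg {..<N} f \<Longrightarrow> csupp {..<N} L f \<Longrightarrow> vanish_near_0 {..<N} f \<Longrightarrow> weak_at u v f"
    and "smooth_alg {..<N} f" "csupp {..<N} L f"
  shows "weak_at u v f"
proof -
  have "weak_at u v f" if "m \<le> N" "smooth_alg {..<N} f" "csupp {..<N} L f" "vanish_near_0 {m..<N} f" for m f
    using that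
  proof (induction m arbitrary: f)
    case 0
    then show ?case
      using weak[of f L] by (simp add: atLeast0LessThan)
  next
    case (Suc m)
    have m: "m < N" using Suc.prems by simp
    define g where "g n x = f x * cutoff m (\<lambda>i. real (Suc n) *\<^sub>R x i)" for n x
    have cut: "smooth_alg {..<N} (\<lambda>x. cutoff m (\<lambda>i. real (Suc n) *\<^sub>R x i))"
      "pd j k (\<lambda>x. cutoff m (\<lambda>i. real (Suc n) *\<^sub>R x i)) = (\<lambda>x. real (Suc n) * pd j k (cutoff m) (\<lambda>i. real (Suc n) *\<^sub>R x i))" for n j k
    proof -
      have c: "smooth_alg {..<N} (cutoff m)"
        by (rule smooth_alg_mono[OF cutoff_smooth_alg]) (use m in simp)
      show "smooth_alg {..<N} (\<lambda>x. cutoff m (\<lambda>i. real (Suc n) *\<^sub>R x i))"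
        using smooth_alg_affine[OF c, of "real (Suc n)" "\<lambda>_. 0"] by simp
      show "pd j k (\<lambda>x. cutoff m (\<lambda>i. real (Suc n) *\<^sub>R x i)) = (\<lambda>x. real (Suc n) * pd j k (cutoff m) (\<lambda>i. real (Suc n) *\<^sub>R x i))"
        using pd_affine[OF c, of j k "real (Suc n)" "\<lambda>_. 0"] by simp
    qed
    have "vanish_near_0 {m..<N} (g n)" for n
    proof -
      obtain r where r: "r > 0" "\<And>x j. j \<in> {Suc m..<N} \<Longrightarrow> \<forall>k. \<bar>x j $ k\<bar> < r \<Longrightarrow> f x = 0"
        using Suc.prems(4) unfolding vanish_near_0_def by meson
      obtain r' where r': "r' > 0" "\<And>x. \<forall>k. \<bar>x m $ k\<bar> < r' \<Longrightarrow> cutoff m x = 0"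
        using cutoff_vanish[of m] unfolding vanish_near_0_def by auto
      let ?r = "min r (r' / real (Suc n))"
      have "g n x = 0" if j: "j \<in> {m..<N}" and x: "\<forall>k. \<bar>x j $ k\<bar> < ?r" for x j
      proof (cases "j = m")
        case True
        have "\<forall>k. \<bar>(real (Suc n) *\<^sub>R x m) $ k\<bar> < r'"
          using x True by (simp add: abs_mult pos_less_divide_eq mult.commute del: of_nat_Suc)
        then show ?thesis
          using r'(2)[of "\<lambda>i. real (Suc n) *\<^sub>R x i"] by (simp add: g_def)
      next
        case False
        then show ?thesis
          using r(2)[of j x] j x by (simp add: g_def)
      qed
      moreover have "?r > 0"
        using r(1) r'(1) by simp
      ultimately show ?thesis
        unfolding vanish_near_0_def by blast
    qed
    then have "weak_at u v (g n)" for n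
      using Suc.IH[of "g n"] m Suc.prems(2,3) cut(1)[of n] unfolding g_def
      by (simp add: smooth_alg.mult csupp_mult)
    then show ?case
    proof (rule weak_at_limit)
      have su: "square_int N (\<lambda>x. cnj (u x s))" "square_int N (\<lambda>x. cnj (v x s))" if "s \<in> spins N" for s
        using u v that by (auto simp: L2_iff intro: square_int_cnj)
      show "(\<lambda>n. LINT x|lebN N. cnj (u x s) * of_real (g n x)) \<longlonglongrightarrow> (LINT x|lebN N. cnj (u x s) * of_real (f x))"
        "(\<lambda>n. LINT x|lebN N. cnj (v x s) * of_real (g n x)) \<longlonglongrightarrow> (LINT x|lebN N. cnj (v x s) * of_real (f x))"
        if "s \<in> spins N" for s
        unfolding g_def
        by (rule integral_cutoff_tendsto(1)[OF su(1)[OF that] m Suc.prems(2,3)],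
            rule integral_cutoff_tendsto(1)[OF su(2)[OF that] m Suc.prems(2,3)])
      fix s j k assume s: "s \<in> spins N" and "j < N"
      have pf: "smooth_alg {..<N} (pd j k f)" "csupp {..<N} L (pd j k f)"
        using Suc.prems by (auto intro: smooth_alg_pd csupp_pd)
      have pg: "pd j k (g n) = (\<lambda>x. pd j k f x * cutoff m (\<lambda>i. real (Suc n) *\<^sub>R x i)
          + f x * (real (Suc n) * pd j k (cutoff m) (\<lambda>i. real (Suc n) *\<^sub>R x i)))" for n
        unfolding g_def by (subst pd_mult[OF Suc.prems(2) cut(1)]) (simp only: cut(2))
      have int1: "integrable (lebN N) (\<lambda>x. cnj (u x s) * of_real (pd j k f x * cutoff m (\<lambda>i. real (Suc n) *\<^sub>R x i)))" for n
        by (rule integrable_square_int_real[OF su(1)[OF s] smooth_alg.mult[OF pf(1) cut(1)] csupp_mult[OF pf(2)]])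
      have "smooth_alg {..<N} (\<lambda>x. real (Suc n) * pd j k (cutoff m) (\<lambda>i. real (Suc n) *\<^sub>R x i))" for n
        using smooth_alg_pd[OF cut(1), of j k n] by (simp only: cut(2))
      then have int2: "integrable (lebN N) (\<lambda>x. cnj (u x s) * of_real (f x * (real (Suc n) * pd j k (cutoff m) (\<lambda>i. real (Suc n) *\<^sub>R x i))))" for n
        by (rule integrable_square_int_real[OF su(1)[OF s] smooth_alg.mult[OF Suc.prems(2)] csupp_mult[OF Suc.prems(3)]])
      have "(\<lambda>n. (LINT x|lebN N. cnj (u x s) * of_real (pd j k f x * cutoff m (\<lambda>i. real (Suc n) *\<^sub>R x i)))
          + (LINT x|lebN N. cnj (u x s) * of_real (f x * (real (Suc n) * pd j k (cutoff m) (\<lambda>i. real (Suc n) *\<^sub>R x i))))) \<longlonglongrightarrow>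
          (LINT x|lebN N. cnj (u x s) * of_real (pd j k f x)) + 0"
        by (rule tendsto_add[OF integral_cutoff_tendsto(1)[OF su(1)[OF s] m pf]
              integral_cutoff_tendsto(2)[OF su(1)[OF s] m Suc.prems(2,3)]])
      moreover have "(LINT x|lebN N. cnj (u x s) * of_real (pd j k f x * cutoff m (\<lambda>i. real (Suc n) *\<^sub>R x i)))
          + (LINT x|lebN N. cnj (u x s) * of_real (f x * (real (Suc n) * pd j k (cutoff m) (\<lambda>i. real (Suc n) *\<^sub>R x i))))
          = (LINT x|lebN N. cnj (u x s) * of_real (pd j k (g n) x))" for n
        unfolding pg of_real_add distrib_left
        by (rule Bochner_Integration.integral_add[OF int1 int2, symmetric])
      ultimately show "(\<lambda>n. LINT x|lebN N. cnj (u x s) * of_real (pd j k (g n) x)) \<longlonglongrightarrow>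
          (LINT x|lebN N. cnj (u x s) * of_real (pd j k f x))"
        by simp
    qed
  qed
  from this[of N f] show ?thesis
    using assms(4,5) by (auto simp: vanish_near_0_def gt_ex)
qed

end

subsection \<open>Doubling of variables\<close>

abbreviation lebN2 :: "nat \<Rightarrow> (conf \<times> conf) measure"
  where "lebN2 N \<equiv> lebN N \<Otimes>\<^sub>M lebN N"

lemma pair_sigma_finite_lebN: "pair_sigma_finite (lebN N) (lebN N)"
  by (simp add: pair_sigma_finite_def sigma_finite_lebN)

lemma lebN_coord_measurable [measurable]: "(\<lambda>x. x i) \<in> borel_measurable (lebN N)"
proof -
  have "(\<lambda>x::conf. x i) \<in> borel_measurable borel"
    by (intro borel_measurable_continuous_onI continuous_on_product_coordinates)
  from measurable_compose[OF lebN_id_measurable this] show ?thesis .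
qed

lemma coord_difference_measurable [measurable]:
  "(\<lambda>p i. fst p i - snd p i) \<in> borel_measurable (lebN2 N)"
proof (rule measurable_coordinatewise_then_product)
  fix i
  have "(\<lambda>p. fst p i) \<in> borel_measurable (lebN2 N)" "(\<lambda>p. snd p i) \<in> borel_measurable (lebN2 N)"
    by (rule measurable_compose[OF measurable_fst lebN_coord_measurable],
        rule measurable_compose[OF measurable_snd lebN_coord_measurable])
  then show "(\<lambda>p. fst p i - snd p i) \<in> borel_measurable (lebN2 N)"
    by (rule borel_measurable_diff)
qed

definition close :: "nat \<Rightarrow> real \<Rightarrow> (conf \<times> conf) set"
  where "close N r = {p \<in> confs N \<times> confs N. small N r (\<lambda>i. fst p i - snd p i)}"

lemma space_lebN2: "space (lebN2 N) = confs N \<times> confs N"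
  by (simp add: space_pair_measure space_lebN)

lemma small_coord_measurable: "{x. small N r x} \<in> sets borel"
proof -
  have "closed {x::conf. \<bar>x j $ k\<bar> \<le> r}" for j k
    by (intro closed_Collect_le continuous_on_rabs continuous_on_component continuous_on_const
        continuous_on_product_coordinates)
  moreover have "{x. small N r x} = (\<Inter>j\<in>{..<N}. \<Inter>k. {x. \<bar>x j $ k\<bar> \<le> r})"
    by (auto simp: small_def)
  ultimately have "closed {x. small N r x}"
    by (auto intro!: closed_INT)
  then show ?thesis by simp
qed

lemma close_sets [measurable]: "close N r \<in> sets (lebN2 N)"
proof -
  have "close N r = (\<lambda>p i. fst p i - snd p i) -` {x. small N r x} \<inter> space (lebN2 N)"
    by (auto simp: close_def space_lebN2)
  then show ?thesis
    using measurable_sets[OF coord_difference_measurable small_coord_measurable] by simp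
qed

lemma emeasure_close_section:
  assumes "r \<ge> 0" "x \<in> confs N"
  shows "emeasure (lebN N) {y \<in> confs N. small N r (\<lambda>i. x i - y i)} = ennreal (((2 * r) ^ 3) ^ N)"
    and "emeasure (lebN N) {y \<in> confs N. small N r (\<lambda>i. y i - x i)} = ennreal (((2 * r) ^ 3) ^ N)"
proof -
  have "{y \<in> confs N. small N r (\<lambda>i. y i - x i)} = PiE {..<N} (\<lambda>i. cube (x i) r)"
    by (auto simp: small_def confs_def cube_def PiE_iff extensional_def)
  moreover have "{y \<in> confs N. small N r (\<lambda>i. x i - y i)} = {y \<in> confs N. small N r (\<lambda>i. y i - x i)}"
    by (auto simp: small_def abs_minus_commute)
  ultimately show "emeasure (lebN N) {y \<in> confs N. small N r (\<lambda>i. x i - y i)} = ennreal (((2 * r) ^ 3) ^ N)"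
    "emeasure (lebN N) {y \<in> confs N. small N r (\<lambda>i. y i - x i)} = ennreal (((2 * r) ^ 3) ^ N)"
    using assms by (simp_all add: emeasure_lebN_PiE emeasure_cube ennreal_power)
qed

text \<open>Every section of the strip, in either variable, is a cube of measure
  \<open>((2 * r) ^ 3) ^ N\<close>, so Tonelli's theorem pulls out this constant.\<close>

lemma nn_integral_close:
  assumes r: "r \<ge> 0" and g: "g \<in> borel_measurable (lebN N)"
  shows "(\<integral>\<^sup>+p. g (fst p) * indicator (close N r) p \<partial>lebN2 N) = ennreal (((2 * r) ^ 3) ^ N) * (\<integral>\<^sup>+x. g x \<partial>lebN N)"
    and "(\<integral>\<^sup>+p. g (snd p) * indicator (close N r) p \<partial>lebN2 N) = ennreal (((2 * r) ^ 3) ^ N) * (\<integral>\<^sup>+x. g x \<partial>lebN N)"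
proof -
  interpret pair_sigma_finite "lebN N" "lebN N"
    by (rule pair_sigma_finite_lebN)
  have [measurable]: "g \<in> borel_measurable (lebN N)" by fact
  have sec: "{y \<in> confs N. small N r (\<lambda>i. x i - y i)} \<in> sets (lebN N)"
    "{y \<in> confs N. small N r (\<lambda>i. y i - x i)} \<in> sets (lebN N)" if "x \<in> confs N" for x
    using that sets_Pair1[OF close_sets[of N r], of x] sets_Pair2[OF close_sets[of N r], of x]
    by (auto simp: close_def vimage_def conj_commute)
  have "(\<integral>\<^sup>+p. g (fst p) * indicator (close N r) p \<partial>lebN2 N)
      = (\<integral>\<^sup>+x. \<integral>\<^sup>+y. g x * indicator (close N r) (x, y) \<partial>lebN N \<partial>lebN N)"
    by (subst sigma_finite_measure.nn_integral_fst[OF sigma_finite_lebN, symmetric]) auto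
  also have "\<dots> = (\<integral>\<^sup>+x. g x * ennreal (((2 * r) ^ 3) ^ N) \<partial>lebN N)"
  proof (rule nn_integral_cong)
    fix x assume "x \<in> space (lebN N)"
    then have x: "x \<in> confs N" by (simp add: space_lebN)
    have "(\<integral>\<^sup>+y. g x * indicator (close N r) (x, y) \<partial>lebN N)
        = (\<integral>\<^sup>+y. g x * indicator {y \<in> confs N. small N r (\<lambda>i. x i - y i)} y \<partial>lebN N)"
      using x by (intro nn_integral_cong) (auto simp: close_def indicator_def space_lebN)
    then show "(\<integral>\<^sup>+y. g x * indicator (close N r) (x, y) \<partial>lebN N) = g x * ennreal (((2 * r) ^ 3) ^ N)"
      using sec(1)[OF x] emeasure_close_section(1)[OF r x] by (simp add: nn_integral_cmult_indicator)
  qed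
  finally show "(\<integral>\<^sup>+p. g (fst p) * indicator (close N r) p \<partial>lebN2 N) = ennreal (((2 * r) ^ 3) ^ N) * (\<integral>\<^sup>+x. g x \<partial>lebN N)"
    by (simp add: nn_integral_multc mult.commute)
  have "(\<integral>\<^sup>+p. g (snd p) * indicator (close N r) p \<partial>lebN2 N)
      = (\<integral>\<^sup>+y. \<integral>\<^sup>+x. g y * indicator (close N r) (x, y) \<partial>lebN N \<partial>lebN N)"
    by (subst nn_integral_snd[symmetric]) auto
  also have "\<dots> = (\<integral>\<^sup>+y. g y * ennreal (((2 * r) ^ 3) ^ N) \<partial>lebN N)"
  proof (rule nn_integral_cong)
    fix y assume "y \<in> space (lebN N)"
    then have y: "y \<in> confs N" by (simp add: space_lebN)
    have "(\<integral>\<^sup>+x. g y * indicator (close N r) (x, y) \<partial>lebN N)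
        = (\<integral>\<^sup>+x. g y * indicator {x \<in> confs N. small N r (\<lambda>i. x i - y i)} x \<partial>lebN N)"
      using y by (intro nn_integral_cong) (auto simp: close_def indicator_def space_lebN)
    then show "(\<integral>\<^sup>+x. g y * indicator (close N r) (x, y) \<partial>lebN N) = g y * ennreal (((2 * r) ^ 3) ^ N)"
      using sec(2)[OF y] emeasure_close_section(2)[OF r y] by (simp add: nn_integral_cmult_indicator)
  qed
  finally show "(\<integral>\<^sup>+p. g (snd p) * indicator (close N r) p \<partial>lebN2 N) = ennreal (((2 * r) ^ 3) ^ N) * (\<integral>\<^sup>+x. g x \<partial>lebN N)"
    by (simp add: nn_integral_multc mult.commute)
qed

section \<open>Bilinear forms given by bounded kernels near the diagonal\<close>

definition kernel :: "nat \<Rightarrow> real \<Rightarrow> real \<Rightarrow> (conf \<times> conf \<Rightarrow> real) \<Rightarrow> bool"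
  where "kernel N r M K \<longleftrightarrow> K \<in> borel_measurable (lebN2 N) \<and> (\<forall>p. \<bar>K p\<bar> \<le> M) \<and>
    (\<forall>p \<in> confs N \<times> confs N - close N r. K p = 0)"

text \<open>Bilinear, with conjugations put into the arguments, so that exchanging the two variables
  treats both arguments alike.\<close>

definition kernel_form :: "nat \<Rightarrow> (conf \<Rightarrow> complex) \<Rightarrow> (conf \<Rightarrow> complex) \<Rightarrow> (conf \<times> conf \<Rightarrow> real) \<Rightarrow> complex"
  where "kernel_form N a b K = (LINT p|lebN2 N. a (fst p) * b (snd p) * of_real (K p))"

definition l2sq :: "nat \<Rightarrow> (conf \<Rightarrow> complex) \<Rightarrow> real"
  where "l2sq N a = (LINT x|lebN N. (cmod (a x))\<^sup>2)"

lemma l2sq_nonneg: "l2sq N a \<ge> 0"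
  unfolding l2sq_def by (intro integral_nonneg_AE) auto

lemma nn_integral_square:
  "square_int N a \<Longrightarrow> (\<integral>\<^sup>+x. ennreal ((cmod (a x))\<^sup>2) \<partial>lebN N) = ennreal (l2sq N a)"
  unfolding l2sq_def square_int_def by (intro nn_integral_eq_integral) auto

text \<open>A Schur-type bound: on the strip, the product of the two functions is dominated by the
  sum of their squares, and each square is integrated over sections of constant measure. Decay along
  the diagonal comes from the functions, not from the kernel.\<close>

lemma kernel_form_bound:
  assumes a: "square_int N a" and b: "square_int N b" and K: "kernel N r M K" and r: "r \<ge> 0"
  shows "integrable (lebN2 N) (\<lambda>p. a (fst p) * b (snd p) * of_real (K p))"
    and "norm (kernel_form N a b K) \<le> M * (((2 * r) ^ 3) ^ N * (l2sq N a + l2sq N b))"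
proof -
  have [measurable]: "a \<in> borel_measurable (lebN N)" "b \<in> borel_measurable (lebN N)"
    "K \<in> borel_measurable (lebN2 N)"
    using a b K by (auto simp: square_int_def kernel_def)
  have M: "M \<ge> 0" "\<And>p. \<bar>K p\<bar> \<le> M"
    using K unfolding kernel_def by (auto intro: order_trans[OF abs_ge_zero])
  let ?C = "M * (((2 * r) ^ 3) ^ N * (l2sq N a + l2sq N b))"
  have pw: "norm (a (fst p) * b (snd p) * complex_of_real (K p))
      \<le> M * ((cmod (a (fst p)))\<^sup>2 * indicator (close N r) p + (cmod (b (snd p)))\<^sup>2 * indicator (close N r) p)"
    if "p \<in> space (lebN2 N)" for p
  proof (cases "p \<in> close N r")
    case True
    have "cmod (a (fst p)) * cmod (b (snd p)) \<le> (cmod (a (fst p)))\<^sup>2 + (cmod (b (snd p)))\<^sup>2"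
      using two_mult_le_squares[of "cmod (a (fst p))" "cmod (b (snd p))"]
        mult_nonneg_nonneg[OF norm_ge_zero norm_ge_zero, of "a (fst p)" "b (snd p)"] by linarith
    then have "(cmod (a (fst p)) * cmod (b (snd p))) * \<bar>K p\<bar> \<le> ((cmod (a (fst p)))\<^sup>2 + (cmod (b (snd p)))\<^sup>2) * M"
      using M by (intro mult_mono) auto
    then show ?thesis
      using True by (simp add: norm_mult mult.commute)
  next
    case False
    then have "K p = 0"
      using K that by (auto simp: kernel_def space_lebN2)
    then show ?thesis
      using False by simp
  qed
  have "(\<integral>\<^sup>+p. ennreal (norm (a (fst p) * b (snd p) * complex_of_real (K p))) \<partial>lebN2 N)
      \<le> (\<integral>\<^sup>+p. ennreal M * (ennreal ((cmod (a (fst p)))\<^sup>2) * indicator (close N r) p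
          + ennreal ((cmod (b (snd p)))\<^sup>2) * indicator (close N r) p) \<partial>lebN2 N)"
  proof (rule nn_integral_mono)
    fix p assume p: "p \<in> space (lebN2 N)"
    have "ennreal M * (ennreal ((cmod (a (fst p)))\<^sup>2) * indicator (close N r) p
          + ennreal ((cmod (b (snd p)))\<^sup>2) * indicator (close N r) p)
        = ennreal (M * ((cmod (a (fst p)))\<^sup>2 * indicator (close N r) p + (cmod (b (snd p)))\<^sup>2 * indicator (close N r) p))"
      using M by (auto simp: indicator_def ennreal_mult ennreal_plus)
    then show "ennreal (norm (a (fst p) * b (snd p) * complex_of_real (K p)))
        \<le> ennreal M * (ennreal ((cmod (a (fst p)))\<^sup>2) * indicator (close N r) p
          + ennreal ((cmod (b (snd p)))\<^sup>2) * indicator (close N r) p)"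
      using pw[OF p] by (simp add: ennreal_leI)
  qed
  also have "\<dots> = ennreal M * ((\<integral>\<^sup>+p. ennreal ((cmod (a (fst p)))\<^sup>2) * indicator (close N r) p \<partial>lebN2 N)
      + (\<integral>\<^sup>+p. ennreal ((cmod (b (snd p)))\<^sup>2) * indicator (close N r) p \<partial>lebN2 N))"
    by (subst nn_integral_cmult, measurable, subst nn_integral_add, measurable)
  also have "\<dots> = ennreal M * (ennreal (((2 * r) ^ 3) ^ N) * ennreal (l2sq N a) + ennreal (((2 * r) ^ 3) ^ N) * ennreal (l2sq N b))"
    by (simp add: nn_integral_close[OF r, of "\<lambda>x. ennreal ((cmod (a x))\<^sup>2)"]
        nn_integral_close[OF r, of "\<lambda>x. ennreal ((cmod (b x))\<^sup>2)"] nn_integral_square a b)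
  also have "\<dots> = ennreal ?C"
    using M r l2sq_nonneg[of N a] l2sq_nonneg[of N b]
    by (simp add: distrib_left flip: ennreal_mult ennreal_plus)
  finally have le: "(\<integral>\<^sup>+p. ennreal (norm (a (fst p) * b (snd p) * complex_of_real (K p))) \<partial>lebN2 N) \<le> ennreal ?C" .
  show int: "integrable (lebN2 N) (\<lambda>p. a (fst p) * b (snd p) * complex_of_real (K p))"
    by (rule integrableI_bounded) (use le in \<open>auto intro: le_less_trans\<close>)
  have "ennreal (norm (kernel_form N a b K)) \<le> ennreal ?C"
    unfolding kernel_form_def using integral_norm_bound_ennreal[OF int] le by (rule order_trans)
  then show "norm (kernel_form N a b K) \<le> ?C"
    using M r l2sq_nonneg[of N a] l2sq_nonneg[of N b] by (subst (asm) ennreal_le_iff) auto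
qed

text \<open>With the inner integral over \<open>x\<close>, the kernel acts as a test function for
  fixed \<open>y\<close>; with the inner integral over \<open>y\<close>, the form is a mollification
  of \<open>b\<close> paired with \<open>a\<close>. The proof uses both readings.\<close>

lemma kernel_form_fubini:
  assumes a: "square_int N a" and b: "square_int N b" and K: "kernel N r M K" and r: "r \<ge> 0"
  shows "integrable (lebN N) (\<lambda>y. (LINT x|lebN N. a x * of_real (K (x, y))) * b y)"
    and "(LINT y|lebN N. (LINT x|lebN N. a x * of_real (K (x, y))) * b y) = kernel_form N a b K"
    and "integrable (lebN N) (\<lambda>x. a x * (LINT y|lebN N. b y * of_real (K (x, y))))"
    and "(LINT x|lebN N. a x * (LINT y|lebN N. b y * of_real (K (x, y)))) = kernel_form N a b K"
proof -
  interpret pair_sigma_finite "lebN N" "lebN N"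
    by (rule pair_sigma_finite_lebN)
  let ?f = "\<lambda>x y. a x * b y * complex_of_real (K (x, y))"
  have int: "integrable (lebN2 N) (case_prod ?f)"
    using kernel_form_bound(1)[OF assms] by (simp add: case_prod_unfold)
  have 1: "(LINT x|lebN N. ?f x y) = (LINT x|lebN N. a x * of_real (K (x, y))) * b y" for y
    by (subst integral_mult_left_zero[symmetric]) (simp add: mult_ac)
  have 2: "(LINT y|lebN N. ?f x y) = a x * (LINT y|lebN N. b y * of_real (K (x, y)))" for x
    by (subst integral_mult_right_zero[symmetric]) (simp add: mult_ac)
  have kf: "kernel_form N a b K = (LINT p|lebN2 N. case_prod ?f p)"
    by (simp add: kernel_form_def case_prod_unfold)
  show "integrable (lebN N) (\<lambda>y. (LINT x|lebN N. a x * of_real (K (x, y))) * b y)"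
    using integrable_snd[OF int] by (simp add: 1)
  show "(LINT y|lebN N. (LINT x|lebN N. a x * of_real (K (x, y))) * b y) = kernel_form N a b K"
    using integral_snd[OF int] by (simp add: 1 kf)
  show "integrable (lebN N) (\<lambda>x. a x * (LINT y|lebN N. b y * of_real (K (x, y))))"
    using integrable_fst[OF int] by (simp add: 2)
  show "(LINT x|lebN N. a x * (LINT y|lebN N. b y * of_real (K (x, y)))) = kernel_form N a b K"
    using integral_fst[OF int] by (simp add: 2 kf)
qed

lemma kernel_form_swap:
  assumes "square_int N a" "square_int N b" "K \<in> borel_measurable (lebN2 N)"
  shows "kernel_form N a b K = kernel_form N b a (\<lambda>p. K (snd p, fst p))"
proof -
  interpret pair_sigma_finite "lebN N" "lebN N"
    by (rule pair_sigma_finite_lebN)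
  have [measurable]: "a \<in> borel_measurable (lebN N)" "b \<in> borel_measurable (lebN N)"
    "K \<in> borel_measurable (lebN2 N)"
    using assms by (auto simp: square_int_def)
  have "(\<lambda>p. a (fst p) * b (snd p) * complex_of_real (K p)) \<in> borel_measurable (lebN2 N)"
    by measurable
  from integral_product_swap[OF this] show ?thesis
    unfolding kernel_form_def by (simp add: case_prod_unfold mult.commute mult.left_commute)
qed

lemma kernel_form_cnj: "cnj (kernel_form N a b K) = kernel_form N (\<lambda>x. cnj (a x)) (\<lambda>x. cnj (b x)) K"
  unfolding kernel_form_def by (simp flip: Bochner_Integration.integral_cnj)

definition product_kernel :: "(conf \<Rightarrow> real) \<Rightarrow> (conf \<Rightarrow> real) \<Rightarrow> (conf \<Rightarrow> real) \<Rightarrow> conf \<times> conf \<Rightarrow> real"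
  where "product_kernel \<rho> g h p = \<rho> (\<lambda>i. fst p i - snd p i) * g (fst p) * h (snd p)"

lemma product_kernel_measurable:
  assumes \<rho>: "smooth_alg {..<N} \<rho>" and g: "smooth_alg {..<N} g" and h: "smooth_alg {..<N} h"
  shows "product_kernel \<rho> g h \<in> borel_measurable (lebN2 N)"
proof -
  have "\<rho> \<in> borel_measurable borel"
    by (intro borel_measurable_continuous_onI smooth_alg_continuous[OF \<rho>])
  then have [measurable]: "(\<lambda>p. \<rho> (\<lambda>i. fst p i - snd p i)) \<in> borel_measurable (lebN2 N)"
    by (rule measurable_compose[OF coord_difference_measurable])
  have [measurable]: "g \<in> borel_measurable (lebN N)" "h \<in> borel_measurable (lebN N)"
    using g h by (auto intro: smooth_alg_measurable)
  show "product_kernel \<rho> g h \<in> borel_measurable (lebN2 N)"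
    unfolding product_kernel_def by measurable
qed

lemma product_kernel_kernel:
  assumes \<rho>: "smooth_alg {..<N} \<rho>" "csupp {..<N} r \<rho>" "\<And>x. \<bar>\<rho> x\<bar> \<le> M1"
    and g: "smooth_alg {..<N} g" "\<And>x. \<bar>g x\<bar> \<le> M2" and h: "smooth_alg {..<N} h" "\<And>x. \<bar>h x\<bar> \<le> M3"
  shows "kernel N r (M1 * M2 * M3) (product_kernel \<rho> g h)"
  unfolding kernel_def
proof (intro conjI allI ballI)
  show "product_kernel \<rho> g h \<in> borel_measurable (lebN2 N)"
    using \<rho>(1) g(1) h(1) by (rule product_kernel_measurable)
  have nn: "0 \<le> M1" "0 \<le> M2"
    using \<rho>(3)[of undefined] g(2)[of undefined] by auto
  show "\<bar>product_kernel \<rho> g h p\<bar> \<le> M1 * M2 * M3" for p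
    unfolding product_kernel_def abs_mult using nn \<rho>(3) g(2) h(2) by (intro mult_mono) auto
  show "product_kernel \<rho> g h p = 0" if "p \<in> confs N \<times> confs N - close N r" for p
  proof -
    have "\<not> small N r (\<lambda>i. fst p i - snd p i)"
      using that by (auto simp: close_def)
    then obtain j k where "j < N" "r < \<bar>(fst p j - snd p j) $ k\<bar>"
      by (auto simp: small_def not_le)
    then have "\<rho> (\<lambda>i. fst p i - snd p i) = 0"
      using \<rho>(2)[unfolded csupp_def, THEN spec, of "\<lambda>i. fst p i - snd p i", THEN bspec, of j, THEN spec, of k]
      by simp
    then show ?thesis
      by (simp add: product_kernel_def)
  qed
qed

lemma sum4_swap:
  fixes S :: "'s set" and T :: "'t set"
  shows "(\<Sum>s\<in>S. \<Sum>j\<in>J. \<Sum>k\<in>K. \<Sum>t\<in>T. f s j k t) = (\<Sum>t\<in>T. \<Sum>j\<in>J. \<Sum>k\<in>K. \<Sum>s\<in>S. f s j k t)"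
proof -
  have "(\<Sum>s\<in>S. \<Sum>j\<in>J. \<Sum>k\<in>K. \<Sum>t\<in>T. f s j k t) = (\<Sum>j\<in>J. \<Sum>k\<in>K. \<Sum>s\<in>S. \<Sum>t\<in>T. f s j k t)"
    by (subst sum.swap) (intro sum.cong refl sum.swap)
  also have "\<dots> = (\<Sum>j\<in>J. \<Sum>k\<in>K. \<Sum>t\<in>T. \<Sum>s\<in>S. f s j k t)"
    by (intro sum.cong refl sum.swap)
  also have "\<dots> = (\<Sum>j\<in>J. \<Sum>t\<in>T. \<Sum>k\<in>K. \<Sum>s\<in>S. f s j k t)"
    by (intro sum.cong refl sum.swap)
  also have "\<dots> = (\<Sum>t\<in>T. \<Sum>j\<in>J. \<Sum>k\<in>K. \<Sum>s\<in>S. f s j k t)"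
    by (rule sum.swap)
  finally show ?thesis .
qed

context first_order_symbol
begin

text \<open>For each fixed \<open>y\<close> the weak equation is tested with
  \<open>\<rho> (x - y) * \<eta> x\<close> as a function of \<open>x\<close>; the result is
  multiplied by \<open>\<eta> y * b y\<close> and integrated over \<open>y\<close>. The product rule
  splits each derivative into the two kernels on the left-hand side.\<close>

lemma weak_at_kernel:
  assumes u: "u \<in> L2 N" and v: "v \<in> L2 N" and b: "square_int N b" and t: "t \<in> spins N"
    and weak: "\<And>f L. smooth_alg {..<N} f \<Longrightarrow> csupp {..<N} L f \<Longrightarrow> weak_at u v f"
    and \<rho>: "smooth_alg {..<N} \<rho>" "csupp {..<N} r \<rho>" "r \<ge> 0"
    and \<eta>: "smooth_alg {..<N} \<eta>" "csupp {..<N} L \<eta>"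
  shows "(\<Sum>j<N. \<Sum>k\<in>UNIV. \<Sum>s\<in>spins N. A j k s t *
      (kernel_form N (\<lambda>x. cnj (u x s)) b (product_kernel (pd j k \<rho>) \<eta> \<eta>)
       + kernel_form N (\<lambda>x. cnj (u x s)) b (product_kernel \<rho> (pd j k \<eta>) \<eta>)))
    + (\<Sum>s\<in>spins N. B s t * kernel_form N (\<lambda>x. cnj (u x s)) b (product_kernel \<rho> \<eta> \<eta>))
    = kernel_form N (\<lambda>x. cnj (v x t)) b (product_kernel \<rho> \<eta> \<eta>)"
proof -
  have su: "square_int N (\<lambda>x. cnj (u x s))" "square_int N (\<lambda>x. cnj (v x s))" if "s \<in> spins N" for s
    using u v that by (auto simp: L2_iff intro: square_int_cnj)
  obtain M where M: "\<And>x. \<bar>\<rho> x\<bar> \<le> M"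
    using smooth_alg_bounded[OF \<rho>(1,2)] by blast
  obtain M' where M': "\<And>x. \<bar>\<eta> x\<bar> \<le> M'"
    using smooth_alg_bounded[OF \<eta>] by blast
  have K0: "kernel N r (M * M' * M') (product_kernel \<rho> \<eta> \<eta>)"
    by (intro product_kernel_kernel \<rho> \<eta> M M')
  have K1: "\<exists>C. kernel N r C (product_kernel (pd j k \<rho>) \<eta> \<eta>)" for j k
  proof -
    obtain C where "\<And>x. \<bar>pd j k \<rho> x\<bar> \<le> C"
      using smooth_alg_bounded[OF smooth_alg_pd[OF \<rho>(1)] csupp_pd[OF \<rho>(1,2)]] by blast
    then have "kernel N r (C * M' * M') (product_kernel (pd j k \<rho>) \<eta> \<eta>)"
      by (intro product_kernel_kernel smooth_alg_pd csupp_pd[OF \<rho>(1)] \<rho> \<eta> M')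
    then show ?thesis ..
  qed
  have K2: "\<exists>C. kernel N r C (product_kernel \<rho> (pd j k \<eta>) \<eta>)" for j k
  proof -
    obtain C where "\<And>x. \<bar>pd j k \<eta> x\<bar> \<le> C"
      using smooth_alg_bounded[OF smooth_alg_pd[OF \<eta>(1)] csupp_pd[OF \<eta>(1,2)]] by blast
    then have "kernel N r (M * C * M') (product_kernel \<rho> (pd j k \<eta>) \<eta>)"
      by (intro product_kernel_kernel smooth_alg_pd \<rho> \<eta> M M')
    then show ?thesis ..
  qed
  define \<phi> where "\<phi> y x = \<rho> (\<lambda>i. x i - y i) * \<eta> x" for y x
  have tr: "smooth_alg {..<N} (\<lambda>x. \<rho> (\<lambda>i. x i - y i))"
    "pd j k (\<lambda>x. \<rho> (\<lambda>i. x i - y i)) = (\<lambda>x. pd j k \<rho> (\<lambda>i. x i - y i))" for y :: conf and j k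
    using smooth_alg_affine[OF \<rho>(1), of 1 "\<lambda>i. - y i"] pd_affine[OF \<rho>(1), of j k 1 "\<lambda>i. - y i"] by simp_all
  have \<phi>: "smooth_alg {..<N} (\<phi> y)" "csupp {..<N} L (\<phi> y)" for y
    using smooth_alg.mult[OF tr(1) \<eta>(1)] \<eta>(2) by (auto simp: \<phi>_def[abs_def] csupp_def)
  have pd\<phi>: "pd j k (\<phi> y) = (\<lambda>x. pd j k \<rho> (\<lambda>i. x i - y i) * \<eta> x + \<rho> (\<lambda>i. x i - y i) * pd j k \<eta> x)" for j k y
    unfolding \<phi>_def[abs_def] by (subst pd_mult[OF tr(1) \<eta>(1)]) (simp only: tr(2))
  define X where "X j k s y = (LINT x|lebN N. cnj (u x s) * of_real (pd j k (\<phi> y) x)) * (of_real (\<eta> y) * b y)" for j k s y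
  define Y where "Y s y = (LINT x|lebN N. cnj (u x s) * of_real (\<phi> y x)) * (of_real (\<eta> y) * b y)" for s y
  define Z where "Z y = (LINT x|lebN N. cnj (v x t) * of_real (\<phi> y x)) * (of_real (\<eta> y) * b y)" for y
  have XYZ: "(\<Sum>j<N. \<Sum>k\<in>UNIV. \<Sum>s\<in>spins N. A j k s t * X j k s y) + (\<Sum>s\<in>spins N. B s t * Y s y) = Z y" for y
  proof -
    have "((\<Sum>j<N. \<Sum>k\<in>UNIV. \<Sum>s\<in>spins N. A j k s t * (LINT x|lebN N. cnj (u x s) * of_real (pd j k (\<phi> y) x)))
        + (\<Sum>s\<in>spins N. B s t * (LINT x|lebN N. cnj (u x s) * of_real (\<phi> y x)))) * (of_real (\<eta> y) * b y) = Z y"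
      using weak[OF \<phi>] t unfolding weak_at_def Z_def by simp
    then show ?thesis
      unfolding X_def Y_def by (simp only: distrib_right sum_distrib_right mult.assoc)
  qed
  have pull: "(LINT x|lebN N. a x * of_real (f x)) * (of_real c * b y) = (LINT x|lebN N. a x * of_real (f x * c)) * b y"
    for a :: "conf \<Rightarrow> complex" and f c y
  proof -
    have "(LINT x|lebN N. a x * of_real (f x)) * of_real c = (LINT x|lebN N. a x * of_real (f x * c))"
      by (subst integral_mult_left_zero[symmetric]) (simp add: mult.assoc)
    then show ?thesis
      by (simp only: mult.assoc[symmetric])
  qed
  have Y_eq: "integrable (lebN N) (Y s)" "(LINT y|lebN N. Y s y) = kernel_form N (\<lambda>x. cnj (u x s)) b (product_kernel \<rho> \<eta> \<eta>)"
    if "s \<in> spins N" for s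
    using kernel_form_fubini(1,2)[OF su(1)[OF that] b K0 \<rho>(3)]
    by (simp_all only: Y_def[abs_def] pull \<phi>_def product_kernel_def fst_conv snd_conv)
  have Z_eq: "integrable (lebN N) Z" "(LINT y|lebN N. Z y) = kernel_form N (\<lambda>x. cnj (v x t)) b (product_kernel \<rho> \<eta> \<eta>)"
    using kernel_form_fubini(1,2)[OF su(2)[OF t] b K0 \<rho>(3)]
    by (simp_all only: Z_def[abs_def] pull \<phi>_def product_kernel_def fst_conv snd_conv)
  have X_eq: "integrable (lebN N) (X j k s)" "(LINT y|lebN N. X j k s y) =
      kernel_form N (\<lambda>x. cnj (u x s)) b (product_kernel (pd j k \<rho>) \<eta> \<eta>)
      + kernel_form N (\<lambda>x. cnj (u x s)) b (product_kernel \<rho> (pd j k \<eta>) \<eta>)"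
    if s: "s \<in> spins N" for j k s
  proof -
    obtain C1 where C1: "kernel N r C1 (product_kernel (pd j k \<rho>) \<eta> \<eta>)"
      using K1 by blast
    obtain C2 where C2: "kernel N r C2 (product_kernel \<rho> (pd j k \<eta>) \<eta>)"
      using K2 by blast
    note f1 = kernel_form_fubini(1,2)[OF su(1)[OF s] b C1 \<rho>(3)]
    note f2 = kernel_form_fubini(1,2)[OF su(1)[OF s] b C2 \<rho>(3)]
    have split: "X j k s y = (LINT x|lebN N. cnj (u x s) * of_real (product_kernel (pd j k \<rho>) \<eta> \<eta> (x, y))) * b y
        + (LINT x|lebN N. cnj (u x s) * of_real (product_kernel \<rho> (pd j k \<eta>) \<eta> (x, y))) * b y" for y
    proof -
      have 1: "integrable (lebN N) (\<lambda>x. cnj (u x s) * of_real (pd j k \<rho> (\<lambda>i. x i - y i) * \<eta> x))"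
        by (rule integrable_square_int_real[OF su(1)[OF s], where L = L])
          (use smooth_alg.mult[OF smooth_alg_pd[OF tr(1), of j k y] \<eta>(1)] \<eta>(2) in \<open>auto simp: tr(2) csupp_def\<close>)
      have 2: "integrable (lebN N) (\<lambda>x. cnj (u x s) * of_real (\<rho> (\<lambda>i. x i - y i) * pd j k \<eta> x))"
        by (rule integrable_square_int_real[OF su(1)[OF s], where L = L])
          (use smooth_alg.mult[OF tr(1) smooth_alg_pd[OF \<eta>(1)], of y j k] csupp_pd[OF \<eta>, of j k] in \<open>auto simp: csupp_def\<close>)
      have "(LINT x|lebN N. cnj (u x s) * of_real (pd j k (\<phi> y) x))
          = (LINT x|lebN N. cnj (u x s) * of_real (pd j k \<rho> (\<lambda>i. x i - y i) * \<eta> x))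
          + (LINT x|lebN N. cnj (u x s) * of_real (\<rho> (\<lambda>i. x i - y i) * pd j k \<eta> x))"
        unfolding pd\<phi> of_real_add distrib_left by (rule Bochner_Integration.integral_add[OF 1 2])
      then have "X j k s y = (LINT x|lebN N. cnj (u x s) * of_real (pd j k \<rho> (\<lambda>i. x i - y i) * \<eta> x)) * (of_real (\<eta> y) * b y)
          + (LINT x|lebN N. cnj (u x s) * of_real (\<rho> (\<lambda>i. x i - y i) * pd j k \<eta> x)) * (of_real (\<eta> y) * b y)"
        unfolding X_def by (simp only: distrib_right)
      then show ?thesis
        unfolding pull by (simp only: product_kernel_def fst_conv snd_conv)
    qed
    show "integrable (lebN N) (X j k s)"
      unfolding split[abs_def] by (rule Bochner_Integration.integrable_add[OF f1(1) f2(1)])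
    show "(LINT y|lebN N. X j k s y) =
      kernel_form N (\<lambda>x. cnj (u x s)) b (product_kernel (pd j k \<rho>) \<eta> \<eta>)
      + kernel_form N (\<lambda>x. cnj (u x s)) b (product_kernel \<rho> (pd j k \<eta>) \<eta>)"
      unfolding split Bochner_Integration.integral_add[OF f1(1) f2(1)] f1(2) f2(2) ..
  qed
  have "(LINT y|lebN N. Z y) = (LINT y|lebN N. (\<Sum>j<N. \<Sum>k\<in>UNIV. \<Sum>s\<in>spins N. A j k s t * X j k s y) + (\<Sum>s\<in>spins N. B s t * Y s y))"
    by (simp only: XYZ)
  also have "\<dots> = (LINT y|lebN N. (\<Sum>j<N. \<Sum>k\<in>UNIV. \<Sum>s\<in>spins N. A j k s t * X j k s y)) + (LINT y|lebN N. (\<Sum>s\<in>spins N. B s t * Y s y))"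
    by (intro Bochner_Integration.integral_add Bochner_Integration.integrable_sum integrable_mult_right X_eq Y_eq)
  also have "(LINT y|lebN N. (\<Sum>s\<in>spins N. B s t * Y s y)) = (\<Sum>s\<in>spins N. B s t * (LINT y|lebN N. Y s y))"
    by (subst Bochner_Integration.integral_sum) (auto intro: Y_eq)
  also have "(LINT y|lebN N. (\<Sum>j<N. \<Sum>k\<in>UNIV. \<Sum>s\<in>spins N. A j k s t * X j k s y)) =
      (\<Sum>j<N. LINT y|lebN N. (\<Sum>k\<in>UNIV. \<Sum>s\<in>spins N. A j k s t * X j k s y))"
    by (intro Bochner_Integration.integral_sum Bochner_Integration.integrable_sum integrable_mult_right X_eq)
  also have "\<dots> = (\<Sum>j<N. \<Sum>k\<in>UNIV. LINT y|lebN N. (\<Sum>s\<in>spins N. A j k s t * X j k s y))"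
    by (intro sum.cong refl Bochner_Integration.integral_sum Bochner_Integration.integrable_sum integrable_mult_right X_eq)
  also have "\<dots> = (\<Sum>j<N. \<Sum>k\<in>UNIV. \<Sum>s\<in>spins N. LINT y|lebN N. A j k s t * X j k s y)"
    by (intro sum.cong refl Bochner_Integration.integral_sum integrable_mult_right X_eq)
  also have "\<dots> = (\<Sum>j<N. \<Sum>k\<in>UNIV. \<Sum>s\<in>spins N. A j k s t * (LINT y|lebN N. X j k s y))"
    by simp
  finally show ?thesis
    unfolding Z_eq(2) using X_eq(2) Y_eq(2) by (simp cong: sum.cong)
qed

text \<open>Doubling of variables: testing with \<open>\<rho> (x - y) \<eta> x \<eta> y\<close> in both variables, the derivatives of \<open>\<rho>\<close>
  cancel, and only derivatives of the cutoff \<open>\<eta>\<close> survive.\<close>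

lemma doubling_identity:
  assumes L2: "u \<in> L2 N" "v \<in> L2 N" "u' \<in> L2 N" "v' \<in> L2 N"
    and weak: "\<And>f L. smooth_alg {..<N} f \<Longrightarrow> csupp {..<N} L f \<Longrightarrow> weak_at u v f"
    and weak': "\<And>f L. smooth_alg {..<N} f \<Longrightarrow> csupp {..<N} L f \<Longrightarrow> weak_at u' v' f"
    and \<rho>: "smooth_alg {..<N} \<rho>" "csupp {..<N} r \<rho>" "r \<ge> 0"
    and \<eta>: "smooth_alg {..<N} \<eta>" "csupp {..<N} L \<eta>"
  shows "(\<Sum>t\<in>spins N. kernel_form N (\<lambda>x. cnj (v x t)) (\<lambda>y. u' y t) (product_kernel \<rho> \<eta> \<eta>))
    - (\<Sum>s\<in>spins N. kernel_form N (\<lambda>x. cnj (u x s)) (\<lambda>y. v' y s) (product_kernel \<rho> \<eta> \<eta>))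
    = (\<Sum>t\<in>spins N. \<Sum>j<N. \<Sum>k\<in>UNIV. \<Sum>s\<in>spins N. A j k s t *
      (kernel_form N (\<lambda>x. cnj (u x s)) (\<lambda>y. u' y t) (product_kernel \<rho> (pd j k \<eta>) \<eta>)
       + kernel_form N (\<lambda>x. cnj (u x s)) (\<lambda>y. u' y t) (product_kernel \<rho> \<eta> (pd j k \<eta>))))"
proof -
  let ?S = "spins N"
  define D0 where "D0 s t = kernel_form N (\<lambda>x. cnj (u x s)) (\<lambda>y. u' y t) (product_kernel \<rho> \<eta> \<eta>)" for s t
  define D1 where "D1 j k s t = kernel_form N (\<lambda>x. cnj (u x s)) (\<lambda>y. u' y t) (product_kernel (pd j k \<rho>) \<eta> \<eta>)" for j k s t
  define D2 where "D2 j k s t = kernel_form N (\<lambda>x. cnj (u x s)) (\<lambda>y. u' y t) (product_kernel \<rho> (pd j k \<eta>) \<eta>)" for j k s t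
  define D3 where "D3 j k s t = kernel_form N (\<lambda>x. cnj (u x s)) (\<lambda>y. u' y t) (product_kernel \<rho> \<eta> (pd j k \<eta>))" for j k s t
  have su: "square_int N (\<lambda>x. u x s)" "square_int N (\<lambda>x. u' x s)" "square_int N (\<lambda>x. v' x s)"
    if "s \<in> ?S" for s
    using L2 that by (auto simp: L2_iff)
  \<comment> \<open>In the equation for \<open>u'\<close> the variables trade places, so the
    reflected mollifier is needed to reproduce the same kernel \<open>\<rho> (x - y)\<close>. The
    reflection changes the sign of its derivatives.\<close>
  define \<sigma> where "\<sigma> x = \<rho> (\<lambda>i. - x i)" for x
  have \<sigma>: "smooth_alg {..<N} \<sigma>" "csupp {..<N} r \<sigma>" "pd j k \<sigma> = (\<lambda>x. - pd j k \<rho> (\<lambda>i. - x i))" for j k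
    using smooth_alg_affine[OF \<rho>(1), of "- 1" "\<lambda>i. 0"] pd_affine[OF \<rho>(1), of j k "- 1" "\<lambda>i. 0"] \<rho>(2)
    by (simp_all add: \<sigma>_def[abs_def] csupp_def)
  have swap0: "kernel_form N a b (product_kernel \<sigma> \<eta> \<eta>) = kernel_form N b a (product_kernel \<rho> \<eta> \<eta>)"
    if "square_int N a" "square_int N b" for a b
    by (subst kernel_form_swap[OF that product_kernel_measurable[OF \<sigma>(1) \<eta>(1) \<eta>(1)]]) (simp add: kernel_form_def product_kernel_def \<sigma>_def mult_ac)
  have swap2: "kernel_form N a b (product_kernel \<sigma> (pd j k \<eta>) \<eta>) = kernel_form N b a (product_kernel \<rho> \<eta> (pd j k \<eta>))"
    if "square_int N a" "square_int N b" for a b j k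
    by (subst kernel_form_swap[OF that product_kernel_measurable[OF \<sigma>(1) smooth_alg_pd[OF \<eta>(1)] \<eta>(1)]]) (simp add: kernel_form_def product_kernel_def \<sigma>_def mult_ac)
  have swap1: "kernel_form N a b (product_kernel (pd j k \<sigma>) \<eta> \<eta>) = - kernel_form N b a (product_kernel (pd j k \<rho>) \<eta> \<eta>)"
    if "square_int N a" "square_int N b" for a b j k
    by (subst kernel_form_swap[OF that product_kernel_measurable[OF smooth_alg_pd[OF \<sigma>(1)] \<eta>(1) \<eta>(1)]]) (simp add: kernel_form_def product_kernel_def \<sigma>(3) mult_ac)
  have E1: "(\<Sum>j<N. \<Sum>k\<in>UNIV. \<Sum>s\<in>?S. A j k s t * (D1 j k s t + D2 j k s t)) + (\<Sum>s\<in>?S. B s t * D0 s t)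
      = kernel_form N (\<lambda>x. cnj (v x t)) (\<lambda>y. u' y t) (product_kernel \<rho> \<eta> \<eta>)" if t: "t \<in> ?S" for t
    unfolding D0_def D1_def D2_def
    by (rule weak_at_kernel[OF L2(1,2) _ t weak \<rho> \<eta>]) (use L2 t in \<open>auto simp: L2_iff\<close>)
  have E2: "(\<Sum>j<N. \<Sum>k\<in>UNIV. \<Sum>t\<in>?S. A j k s t * (D1 j k s t - D3 j k s t)) + (\<Sum>t\<in>?S. B s t * D0 s t)
      = kernel_form N (\<lambda>x. cnj (u x s)) (\<lambda>y. v' y s) (product_kernel \<rho> \<eta> \<eta>)" if s: "s \<in> ?S" for s
  proof -
    have "(\<Sum>j<N. \<Sum>k\<in>UNIV. \<Sum>t\<in>?S. A j k t s *
        (kernel_form N (\<lambda>x. cnj (u' x t)) (\<lambda>x. u x s) (product_kernel (pd j k \<sigma>) \<eta> \<eta>)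
         + kernel_form N (\<lambda>x. cnj (u' x t)) (\<lambda>x. u x s) (product_kernel \<sigma> (pd j k \<eta>) \<eta>)))
      + (\<Sum>t\<in>?S. B t s * kernel_form N (\<lambda>x. cnj (u' x t)) (\<lambda>x. u x s) (product_kernel \<sigma> \<eta> \<eta>))
      = kernel_form N (\<lambda>x. cnj (v' x s)) (\<lambda>x. u x s) (product_kernel \<sigma> \<eta> \<eta>)"
      by (rule weak_at_kernel[OF L2(3,4) _ s weak' \<sigma>(1,2) \<rho>(3) \<eta>]) (use L2 s in \<open>auto simp: L2_iff\<close>)
    \<comment> \<open>Conjugation turns the coefficient \<open>A j k t s\<close> into
      \<open>- A j k s t\<close>. Combined with the sign from the reflection, \<open>D1\<close>
      appears exactly as in \<open>E1\<close>, while the term with a derivative of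
      \<open>\<eta>\<close> has the opposite sign. Subtraction therefore removes \<open>D1\<close>
      and leaves \<open>D2 + D3\<close>; the zeroth-order terms cancel because \<open>B\<close> is
      hermitian.\<close>
    from arg_cong[where f = cnj, OF this]
    have "(\<Sum>j<N. \<Sum>k\<in>UNIV. \<Sum>t\<in>?S. - A j k s t * (- D1 j k s t + D3 j k s t)) + (\<Sum>t\<in>?S. B s t * D0 s t)
        = kernel_form N (\<lambda>x. cnj (u x s)) (\<lambda>y. v' y s) (product_kernel \<rho> \<eta> \<eta>)"
      using su s by (simp add: kernel_form_cnj A_antihermitian B_hermitian swap0 swap1 swap2
          D0_def D1_def D3_def square_int_cnj cong: sum.cong)
    moreover have "- A j k s t * (- D1 j k s t + D3 j k s t) = A j k s t * (D1 j k s t - D3 j k s t)" for j k t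
      by (simp add: algebra_simps)
    ultimately show ?thesis
      by simp
  qed
  have "(\<Sum>t\<in>?S. kernel_form N (\<lambda>x. cnj (v x t)) (\<lambda>y. u' y t) (product_kernel \<rho> \<eta> \<eta>))
      = (\<Sum>t\<in>?S. \<Sum>j<N. \<Sum>k\<in>UNIV. \<Sum>s\<in>?S. A j k s t * (D1 j k s t + D2 j k s t)) + (\<Sum>t\<in>?S. \<Sum>s\<in>?S. B s t * D0 s t)"
    by (simp add: E1[symmetric] sum.distrib)
  moreover have "(\<Sum>s\<in>?S. kernel_form N (\<lambda>x. cnj (u x s)) (\<lambda>y. v' y s) (product_kernel \<rho> \<eta> \<eta>))
      = (\<Sum>t\<in>?S. \<Sum>j<N. \<Sum>k\<in>UNIV. \<Sum>s\<in>?S. A j k s t * (D1 j k s t - D3 j k s t)) + (\<Sum>t\<in>?S. \<Sum>s\<in>?S. B s t * D0 s t)"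
  proof -
    have "(\<Sum>s\<in>?S. kernel_form N (\<lambda>x. cnj (u x s)) (\<lambda>y. v' y s) (product_kernel \<rho> \<eta> \<eta>))
        = (\<Sum>s\<in>?S. (\<Sum>j<N. \<Sum>k\<in>UNIV. \<Sum>t\<in>?S. A j k s t * (D1 j k s t - D3 j k s t)) + (\<Sum>t\<in>?S. B s t * D0 s t))"
      by (intro sum.cong refl) (simp only: E2)
    also have "\<dots> = (\<Sum>s\<in>?S. \<Sum>j<N. \<Sum>k\<in>UNIV. \<Sum>t\<in>?S. A j k s t * (D1 j k s t - D3 j k s t)) + (\<Sum>s\<in>?S. \<Sum>t\<in>?S. B s t * D0 s t)"
      by (rule sum.distrib)
    also have "(\<Sum>s\<in>?S. \<Sum>t\<in>?S. B s t * D0 s t) = (\<Sum>t\<in>?S. \<Sum>s\<in>?S. B s t * D0 s t)"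
      by (rule sum.swap)
    finally show ?thesis
      by (subst (asm) sum4_swap)
  qed
  moreover have "A j k s t * (D1 j k s t + D2 j k s t) - A j k s t * (D1 j k s t - D3 j k s t)
      = A j k s t * (D2 j k s t + D3 j k s t)" for j k s t
    by (simp add: algebra_simps)
  ultimately show ?thesis
    unfolding D2_def[symmetric] D3_def[symmetric] by (simp flip: sum_subtractf)
qed

end

subsection \<open>Removing the cutoffs\<close>

text \<open>A cutoff at infinity, normalized to 1 at the origin. It need not be constant on any
  region: uniform boundedness, pointwise convergence to 1, and derivatives of order
  \<open>1 / Suc n\<close> are enough.\<close>

definition plateau :: "nat \<Rightarrow> nat \<Rightarrow> conf \<Rightarrow> real"
  where "plateau N n x = bump {..<N} (\<lambda>i. (1 / real (Suc n)) *\<^sub>R x i) / bump {..<N} (\<lambda>i. 0)"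

lemma plateau:
  shows "smooth_alg {..<N} (plateau N n)" and "csupp {..<N} (real (Suc n)) (plateau N n)"
    and "pd j k (plateau N n) = (\<lambda>x. 1 / real (Suc n) * (pd j k (bump {..<N}) (\<lambda>i. (1 / real (Suc n)) *\<^sub>R x i) / bump {..<N} (\<lambda>i. 0)))"
    and "(\<lambda>n. plateau N n x) \<longlonglongrightarrow> 1"
proof -
  let ?b = "bump {..<N} (\<lambda>i. 0)"
  have b: "?b > 0"
    by (intro bump_pos) auto
  have sm: "smooth_alg {..<N} (bump {..<N})"
    by (intro bump_smooth_alg) simp
  have sm': "smooth_alg {..<N} (\<lambda>x. bump {..<N} (\<lambda>i. (1 / real (Suc n)) *\<^sub>R x i))"
    and pd': "pd j k (\<lambda>x. bump {..<N} (\<lambda>i. (1 / real (Suc n)) *\<^sub>R x i)) =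
      (\<lambda>x. 1 / real (Suc n) * pd j k (bump {..<N}) (\<lambda>i. (1 / real (Suc n)) *\<^sub>R x i))"
    using smooth_alg_affine[OF sm, of "1 / real (Suc n)" "\<lambda>_. 0"]
      pd_affine[OF sm, of j k "1 / real (Suc n)" "\<lambda>_. 0"] by (simp_all only: add_0_right)
  have eq: "plateau N n = (\<lambda>x. inverse ?b * bump {..<N} (\<lambda>i. (1 / real (Suc n)) *\<^sub>R x i))"
    unfolding plateau_def[abs_def] divide_inverse[of _ ?b] by (rule ext) (rule mult.commute)
  show "smooth_alg {..<N} (plateau N n)"
    unfolding eq by (rule smooth_alg.mult[OF smooth_alg.const sm'])
  show "pd j k (plateau N n) = (\<lambda>x. 1 / real (Suc n) * (pd j k (bump {..<N}) (\<lambda>i. (1 / real (Suc n)) *\<^sub>R x i) / ?b))"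
  proof (rule pd_eqI)
    fix x
    from DERIV_cmult[OF smooth_alg_has_pd[OF sm', of x j k], of "inverse ?b"]
    show "((\<lambda>t. plateau N n (x(j := x j + t *\<^sub>R axis k 1))) has_real_derivative
        1 / real (Suc n) * (pd j k (bump {..<N}) (\<lambda>i. (1 / real (Suc n)) *\<^sub>R x i) / ?b)) (at 0)"
      unfolding eq pd' by (rule DERIV_cong) (simp add: divide_inverse mult_ac del: of_nat_Suc)
  qed
  show "csupp {..<N} (real (Suc n)) (plateau N n)"
    unfolding csupp_def
  proof (intro allI ballI impI)
    fix x :: conf and j and k :: 3 assume *: "j \<in> {..<N}" "real (Suc n) < \<bar>x j $ k\<bar>"
    then have "1 < \<bar>((1 / real (Suc n)) *\<^sub>R x j) $ k\<bar>"
      by (simp add: abs_mult pos_less_divide_eq del: of_nat_Suc)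
    then have "bump {..<N} (\<lambda>i. (1 / real (Suc n)) *\<^sub>R x i) = 0"
      using bump_csupp[of "{..<N}", unfolded csupp_def, simplified, THEN spec, of "\<lambda>i. (1 / real (Suc n)) *\<^sub>R x i"] *(1)
      by blast
    then show "plateau N n x = 0"
      by (simp add: plateau_def)
  qed
  have "(\<lambda>n. bump {..<N} (\<lambda>i. (1 / real (Suc n)) *\<^sub>R x i)) \<longlonglongrightarrow> ?b"
    unfolding bump_def
  proof (intro tendsto_prod)
    fix j and k :: 3
    have "(\<lambda>n. (1 / real (Suc n)) * x j $ k) \<longlonglongrightarrow> 0 * x j $ k"
      by (intro tendsto_mult tendsto_const LIMSEQ_Suc lim_inverse_n')
    then have "(\<lambda>n. bump1 ((1 / real (Suc n)) * x j $ k)) \<longlonglongrightarrow> bump1 0"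
      using isCont_tendsto_compose[OF bump1_continuous[of 0]] by simp
    then show "(\<lambda>n. bump1 (((1 / real (Suc n)) *\<^sub>R x j) $ k)) \<longlonglongrightarrow> bump1 (0 $ k)"
      by (simp del: of_nat_Suc)
  qed
  then have "(\<lambda>n. bump {..<N} (\<lambda>i. (1 / real (Suc n)) *\<^sub>R x i) / ?b) \<longlonglongrightarrow> ?b / ?b"
    by (rule tendsto_divide[OF _ tendsto_const]) (use b in simp)
  then show "(\<lambda>n. plateau N n x) \<longlonglongrightarrow> 1"
    using b by (simp add: plateau_def)
qed

lemma plateau_bounded: "\<exists>M>0. \<forall>n x. \<bar>plateau N n x\<bar> \<le> M"
proof -
  obtain M where M: "M > 0" "\<And>x. \<bar>bump {..<N} x\<bar> \<le> M"
    using smooth_alg_bounded[OF bump_smooth_alg bump_csupp, of "{..<N}"] by auto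
  have b: "bump {..<N} (\<lambda>i. 0) > 0"
    by (intro bump_pos) auto
  then show ?thesis
    using M by (intro exI[of _ "M / bump {..<N} (\<lambda>i. 0)"]) (auto simp: plateau_def abs_divide intro!: divide_right_mono)
qed

lemma pd_plateau_bounded: "\<exists>M. \<forall>n x. \<bar>pd j k (plateau N n) x\<bar> \<le> M / real (Suc n)"
proof -
  have sm: "smooth_alg {..<N} (bump {..<N})" and cs: "csupp {..<N} 1 (bump {..<N})"
    by (auto intro: bump_smooth_alg bump_csupp)
  obtain M where M: "\<And>x. \<bar>pd j k (bump {..<N}) x\<bar> \<le> M"
    using smooth_alg_bounded[OF smooth_alg_pd[OF sm] csupp_pd[OF sm cs]] by blast
  have b: "bump {..<N} (\<lambda>i. 0) > 0"
    by (intro bump_pos) auto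
  have "\<bar>pd j k (plateau N n) x\<bar> \<le> M / bump {..<N} (\<lambda>i. 0) / real (Suc n)" for n x
  proof -
    have "\<bar>pd j k (plateau N n) x\<bar> = \<bar>pd j k (bump {..<N}) (\<lambda>i. (1 / real (Suc n)) *\<^sub>R x i)\<bar> / bump {..<N} (\<lambda>i. 0) / real (Suc n)"
      unfolding plateau(3) using b by (simp add: abs_mult abs_divide del: of_nat_Suc)
    then show ?thesis
      using M b by (simp add: divide_right_mono del: of_nat_Suc)
  qed
  then show ?thesis by blast
qed

text \<open>The strip keeps its width \<open>r\<close>, so derivatives of order
  \<open>1 / Suc n\<close> make the second and third forms small at that rate. The first limit is
  dominated convergence, with a multiple of the integrand without cutoff as majorant.\<close>

lemma kernel_form_plateau_tendsto:
  assumes a: "square_int N a" and b: "square_int N b"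
    and \<rho>: "smooth_alg {..<N} \<rho>" "csupp {..<N} r \<rho>" "r \<ge> 0"
  shows "(\<lambda>n. kernel_form N a b (product_kernel \<rho> (plateau N n) (plateau N n))) \<longlonglongrightarrow>
      kernel_form N a b (\<lambda>p. \<rho> (\<lambda>i. fst p i - snd p i))"
    and "(\<lambda>n. kernel_form N a b (product_kernel \<rho> (pd j k (plateau N n)) (plateau N n))) \<longlonglongrightarrow> 0"
    and "(\<lambda>n. kernel_form N a b (product_kernel \<rho> (plateau N n) (pd j k (plateau N n)))) \<longlonglongrightarrow> 0"
proof -
  obtain C where C: "\<And>x. \<bar>\<rho> x\<bar> \<le> C"
    using smooth_alg_bounded[OF \<rho>(1,2)] by blast
  obtain M where M: "\<And>n x. \<bar>plateau N n x\<bar> \<le> M"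
    using plateau_bounded by blast
  obtain M' where M': "\<And>n x. \<bar>pd j k (plateau N n) x\<bar> \<le> M' / real (Suc n)"
    using pd_plateau_bounded by blast
  let ?V = "((2 * r) ^ 3) ^ N * (l2sq N a + l2sq N b)"
  have lim: "(\<lambda>n. D / real (Suc n)) \<longlonglongrightarrow> 0" for D
    using tendsto_mult[OF tendsto_const[of D] LIMSEQ_Suc[OF lim_inverse_n']] by simp
  have k2: "kernel N r (C * (M' / real (Suc n)) * M) (product_kernel \<rho> (pd j k (plateau N n)) (plateau N n))" for n
    by (intro product_kernel_kernel \<rho> plateau smooth_alg_pd C M M')
  have k3: "kernel N r (C * M * (M' / real (Suc n))) (product_kernel \<rho> (plateau N n) (pd j k (plateau N n)))" for n
    by (intro product_kernel_kernel \<rho> plateau smooth_alg_pd C M M')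
  have "norm (kernel_form N a b (product_kernel \<rho> (pd j k (plateau N n)) (plateau N n))) \<le> C * M' * M * ?V / real (Suc n)" for n
    using kernel_form_bound(2)[OF a b k2 \<rho>(3), of n] by (simp add: mult_ac del: of_nat_Suc)
  then show "(\<lambda>n. kernel_form N a b (product_kernel \<rho> (pd j k (plateau N n)) (plateau N n))) \<longlonglongrightarrow> 0"
    by (intro Lim_null_comparison[OF _ lim[of "C * M' * M * ?V"]]) simp
  have "norm (kernel_form N a b (product_kernel \<rho> (plateau N n) (pd j k (plateau N n)))) \<le> C * M' * M * ?V / real (Suc n)" for n
    using kernel_form_bound(2)[OF a b k3 \<rho>(3), of n] by (simp add: mult_ac del: of_nat_Suc)
  then show "(\<lambda>n. kernel_form N a b (product_kernel \<rho> (plateau N n) (pd j k (plateau N n)))) \<longlonglongrightarrow> 0"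
    by (intro Lim_null_comparison[OF _ lim[of "C * M' * M * ?V"]]) simp
  have one: "smooth_alg {..<N} (\<lambda>x. 1)" "\<bar>1::real\<bar> \<le> 1"
    by (auto intro: smooth_alg.const)
  have k0: "kernel N r (C * 1 * 1) (product_kernel \<rho> (\<lambda>x. 1) (\<lambda>x. 1))"
    by (intro product_kernel_kernel \<rho> one C)
  note int0 = kernel_form_bound(1)[OF a b k0 \<rho>(3)]
  have [measurable]: "a \<in> borel_measurable (lebN N)" "b \<in> borel_measurable (lebN N)"
    "product_kernel \<rho> (plateau N n) (plateau N n) \<in> borel_measurable (lebN2 N)" for n
    using a b product_kernel_measurable[OF \<rho>(1) plateau(1) plateau(1)] by (auto simp: square_int_def)
  have "(\<lambda>n. LINT p|lebN2 N. a (fst p) * b (snd p) * of_real (product_kernel \<rho> (plateau N n) (plateau N n) p))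
      \<longlonglongrightarrow> (LINT p|lebN2 N. a (fst p) * b (snd p) * of_real (product_kernel \<rho> (\<lambda>x. 1) (\<lambda>x. 1) p))"
  proof (rule integral_dominated_convergence[where
        w = "\<lambda>p. M\<^sup>2 * norm (a (fst p) * b (snd p) * of_real (product_kernel \<rho> (\<lambda>x. 1) (\<lambda>x. 1) p))"])
    show "(\<lambda>p. a (fst p) * b (snd p) * complex_of_real (product_kernel \<rho> (\<lambda>x. 1) (\<lambda>x. 1) p)) \<in> borel_measurable (lebN2 N)"
      using int0 by (rule borel_measurable_integrable)
    show "(\<lambda>p. a (fst p) * b (snd p) * complex_of_real (product_kernel \<rho> (plateau N n) (plateau N n) p)) \<in> borel_measurable (lebN2 N)" for n
      by measurable
    show "integrable (lebN2 N) (\<lambda>p. M\<^sup>2 * norm (a (fst p) * b (snd p) * of_real (product_kernel \<rho> (\<lambda>x. 1) (\<lambda>x. 1) p)))"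
      using int0 by (intro integrable_mult_right integrable_norm)
    have "(\<lambda>n. a (fst p) * b (snd p) * complex_of_real (product_kernel \<rho> (plateau N n) (plateau N n) p))
        \<longlonglongrightarrow> a (fst p) * b (snd p) * complex_of_real (\<rho> (\<lambda>i. fst p i - snd p i) * 1 * 1)" for p
      unfolding product_kernel_def by (intro tendsto_mult tendsto_const tendsto_of_real plateau(4))
    then show "AE p in lebN2 N. (\<lambda>n. a (fst p) * b (snd p) * complex_of_real (product_kernel \<rho> (plateau N n) (plateau N n) p))
        \<longlonglongrightarrow> a (fst p) * b (snd p) * complex_of_real (product_kernel \<rho> (\<lambda>x. 1) (\<lambda>x. 1) p)"
      by (simp add: product_kernel_def)
    have "norm (a (fst p) * b (snd p) * complex_of_real (product_kernel \<rho> (plateau N n) (plateau N n) p))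
        \<le> M\<^sup>2 * norm (a (fst p) * b (snd p) * complex_of_real (product_kernel \<rho> (\<lambda>x. 1) (\<lambda>x. 1) p))" for n p
    proof -
      have "0 \<le> M"
        using M[of 0 undefined] by auto
      then have "\<bar>plateau N n (fst p)\<bar> * \<bar>plateau N n (snd p)\<bar> \<le> M * M"
        by (intro mult_mono M) auto
      from mult_right_mono[OF this, of "norm (a (fst p) * b (snd p) * complex_of_real (\<rho> (\<lambda>i. fst p i - snd p i)))"]
      show ?thesis
        by (simp add: product_kernel_def norm_mult abs_mult power2_eq_square mult_ac)
    qed
    then show "AE p in lebN2 N. norm (a (fst p) * b (snd p) * complex_of_real (product_kernel \<rho> (plateau N n) (plateau N n) p))
        \<le> M\<^sup>2 * norm (a (fst p) * b (snd p) * complex_of_real (product_kernel \<rho> (\<lambda>x. 1) (\<lambda>x. 1) p))" for n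
      by simp
  qed
  then show "(\<lambda>n. kernel_form N a b (product_kernel \<rho> (plateau N n) (plateau N n))) \<longlonglongrightarrow>
      kernel_form N a b (\<lambda>p. \<rho> (\<lambda>i. fst p i - snd p i))"
    unfolding kernel_form_def by (simp add: product_kernel_def)
qed

section \<open>Mollification and convergence to the inner product\<close>

text \<open>Left unnormalized: the identity obtained by doubling is homogeneous in the kernel, so
  its integral \<open>mass\<close> can be divided out at the end.\<close>

definition mollifier :: "nat \<Rightarrow> nat \<Rightarrow> conf \<Rightarrow> real"
  where "mollifier N n x = bump {..<N} (\<lambda>i. real (Suc n) *\<^sub>R x i)"

lemma mollifier:
  shows "smooth_alg {..<N} (mollifier N n)" and "csupp {..<N} (1 / real (Suc n)) (mollifier N n)"
    and "mollifier N n x \<ge> 0" and "mollifier N n (\<lambda>i. - x i) = mollifier N n x"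
proof -
  have sm: "smooth_alg {..<N} (bump {..<N})"
    by (intro bump_smooth_alg) simp
  show "smooth_alg {..<N} (mollifier N n)"
    using smooth_alg_affine[OF sm, of "real (Suc n)" "\<lambda>_. 0"] by (simp add: mollifier_def[abs_def] del: of_nat_Suc)
  show "csupp {..<N} (1 / real (Suc n)) (mollifier N n)"
    unfolding csupp_def
  proof (intro allI ballI impI)
    fix x :: conf and j and k :: 3 assume *: "j \<in> {..<N}" "1 / real (Suc n) < \<bar>x j $ k\<bar>"
    then have "1 < \<bar>(real (Suc n) *\<^sub>R x j) $ k\<bar>"
      by (simp add: abs_mult pos_divide_less_eq mult.commute del: of_nat_Suc)
    then show "mollifier N n x = 0"
      using bump_csupp[of "{..<N}", unfolded csupp_def, simplified, THEN spec, of "\<lambda>i. real (Suc n) *\<^sub>R x i"] *(1)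
      unfolding mollifier_def by blast
  qed
  show "mollifier N n x \<ge> 0"
    by (simp add: mollifier_def bump_nonneg)
  show "mollifier N n (\<lambda>i. - x i) = mollifier N n x"
    by (simp add: mollifier_def bump_def bump1_minus del: of_nat_Suc)
qed

definition mass :: "nat \<Rightarrow> nat \<Rightarrow> real"
  where "mass N n = (LINT x|lebN N. mollifier N n x)"

lemma integrable_smooth:
  assumes "smooth_alg {..<N} f" "csupp {..<N} L f"
  shows "integrable (lebN N) f"
proof -
  obtain M where "\<And>x. \<bar>f x\<bar> \<le> M"
    using smooth_alg_bounded[OF assms] by blast
  then show ?thesis
    using csupp_cubeN[OF assms(2)] smooth_alg_measurable[OF assms(1), of N]
    by (intro integrable_bounded_support[where M = M and L = L]) auto
qed

lemma mass_pos: "mass N n > 0"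
proof -
  have int: "integrable (lebN N) (mollifier N n)"
    by (rule integrable_smooth[OF mollifier(1,2)])
  have "mass N n \<noteq> 0"
  proof
    assume "mass N n = 0"
    then have ae: "AE x in lebN N. mollifier N n x = 0"
      unfolding mass_def using integral_nonneg_eq_0_iff_AE[OF int] mollifier(3) by auto
    \<comment> \<open>Half the radius of the support, so every factor \<open>bump1\<close> is
      evaluated strictly inside the interval where it is positive.\<close>
    let ?r = "1 / (2 * real (Suc n))"
    have pos: "mollifier N n x > 0" if "x \<in> cubeN N ?r" for x
      unfolding mollifier_def
    proof (rule bump_pos)
      fix j and k :: 3 assume "j \<in> {..<N}"
      then have "\<bar>x j $ k\<bar> \<le> ?r"
        using that by (auto simp: mem_cubeN)
      then have "real (Suc n) * \<bar>x j $ k\<bar> \<le> real (Suc n) * ?r"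
        by (intro mult_left_mono) auto
      then show "\<bar>(real (Suc n) *\<^sub>R x j) $ k\<bar> < 1"
        by (simp add: abs_mult del: of_nat_Suc)
    qed simp
    have "AE x in lebN N. x \<notin> cubeN N ?r"
      using ae by (rule eventually_mono) (metis pos less_irrefl)
    then have "emeasure (lebN N) (cubeN N ?r) = 0"
      by (subst (asm) AE_iff_measurable[OF cubeN_sets]) (auto simp: mem_cubeN space_lebN)
    moreover have "emeasure (lebN N) (cubeN N ?r) = ennreal (((2 * ?r) ^ 3) ^ N)"
      by (rule emeasure_cubeN) simp
    moreover have "0 < ((2 * ?r) ^ 3) ^ N"
      by (intro zero_less_power) simp
    ultimately show False
      by (metis ennreal_eq_0_iff not_le)
  qed
  moreover have "mass N n \<ge> 0"
    unfolding mass_def by (intro integral_nonneg_AE AE_I2 mollifier(3))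
  ultimately show ?thesis by simp
qed

lemma small_if_mollifier:
  assumes "mollifier N n z \<noteq> 0"
  shows "small N (1 / real (Suc n)) z"
  unfolding small_def
proof (intro allI impI)
  fix j k assume "j < N"
  then show "\<bar>z j $ k\<bar> \<le> 1 / real (Suc n)"
    using assms mollifier(2)[of N n, unfolded csupp_def, THEN spec, of z, THEN bspec, of j, THEN spec, of k]
    by (auto simp: not_less[symmetric] simp del: of_nat_Suc)
qed

text \<open>The substitution \<open>y = x + z\<close> in a form that respects extensionality: the
  arguments agree only up to sign and only on \<open>{..<N}\<close>, and the mollifier is even and
  sees no other coordinates.\<close>

lemma mollifier_shift: "mollifier N n (\<lambda>i. x i - shift N x z i) = mollifier N n z"
proof -
  have "mollifier N n (\<lambda>i. x i - shift N x z i) = mollifier N n (\<lambda>i. - z i)"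
    by (rule smooth_alg_cong[OF mollifier(1)]) simp
  then show ?thesis
    by (simp add: mollifier(4))
qed

lemma integral_mollifier: "(LINT y|lebN N. mollifier N n (\<lambda>i. x i - y i)) = mass N n"
proof -
  have sm: "smooth_alg {..<N} (\<lambda>y. mollifier N n (\<lambda>i. x i - y i))"
    using smooth_alg_affine[OF mollifier(1), of N n "- 1" x] by simp
  have "(LINT z|lebN N. mollifier N n (\<lambda>i. x i - shift N x z i)) = (LINT y|lebN N. mollifier N n (\<lambda>i. x i - y i))"
    by (rule integral_shift[OF smooth_alg_measurable[OF sm]])
  then show ?thesis
    by (simp add: mollifier_shift mass_def)
qed

lemma shift_measurable2 [measurable]: "(\<lambda>p. shift N (snd p) (fst p)) \<in> measurable (lebN2 N) (lebN N)"
proof -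
  have "(\<lambda>p. \<lambda>i\<in>{..<N}. fst p i + snd p i) \<in> measurable (lebN2 N) (PiM {..<N} (\<lambda>_. borel))"
  proof (rule measurable_restrict)
    fix i assume "i \<in> {..<N}"
    have "(\<lambda>p. fst p i) \<in> borel_measurable (lebN2 N)" "(\<lambda>p. snd p i) \<in> borel_measurable (lebN2 N)"
      by (rule measurable_compose[OF measurable_fst lebN_coord_measurable],
          rule measurable_compose[OF measurable_snd lebN_coord_measurable])
    then show "(\<lambda>p. fst p i + snd p i) \<in> borel_measurable (lebN2 N)"
      by (rule borel_measurable_add)
  qed
  moreover have "sets (lebN N) = sets (PiM {..<N} (\<lambda>_. borel))"
    unfolding lebN_def by (rule sets_PiM_cong) auto
  ultimately show ?thesis
    unfolding shift_def using measurable_cong_sets by blast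
qed

text \<open>The substitution \<open>y = x + z\<close> exhibits the error as an average of
  translation differences of \<open>b\<close> over small \<open>z\<close>. Young's inequality with a
  free weight \<open>l\<close> separates \<open>a\<close> from these differences, so
  \<open>l\<close> can be fixed from \<open>a\<close>, and \<open>\<delta>\<close>
  afterwards.\<close>

lemma kernel_form_mollifier_error:
  assumes a: "square_int N a" and b: "square_int N b" and l: "l > 0" and \<delta>: "\<delta> \<ge> 0"
    and tr: "\<And>z. small N (1 / real (Suc n)) z \<Longrightarrow>
      (\<integral>\<^sup>+x. ennreal ((cmod (b (shift N z x) - b x))\<^sup>2) \<partial>lebN N) \<le> ennreal \<delta>"
  shows "norm (kernel_form N a b (\<lambda>p. mollifier N n (\<lambda>i. fst p i - snd p i))
      - of_real (mass N n) * (LINT x|lebN N. a x * b x)) \<le> mass N n * (l * l2sq N a + \<delta> / l)"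
proof -
  interpret pair_sigma_finite "lebN N" "lebN N"
    by (rule pair_sigma_finite_lebN)
  let ?\<rho> = "mollifier N n"
  have [measurable]: "a \<in> borel_measurable (lebN N)" "b \<in> borel_measurable (lebN N)"
    "?\<rho> \<in> borel_measurable (lebN N)"
    using a b smooth_alg_measurable[OF mollifier(1)] by (auto simp: square_int_def)
  obtain C where C: "\<And>x. \<bar>?\<rho> x\<bar> \<le> C"
    using smooth_alg_bounded[OF mollifier(1,2)] by blast
  have one: "smooth_alg {..<N} (\<lambda>x. 1)" "\<bar>1::real\<bar> \<le> 1"
    by (auto intro: smooth_alg.const)
  have "kernel N (1 / real (Suc n)) (C * 1 * 1) (product_kernel ?\<rho> (\<lambda>x. 1) (\<lambda>x. 1))"
    by (intro product_kernel_kernel mollifier one C)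
  then have k: "kernel N (1 / real (Suc n)) C (\<lambda>p. ?\<rho> (\<lambda>i. fst p i - snd p i))"
    by (simp add: product_kernel_def[abs_def])
  have r: "0 \<le> 1 / real (Suc n)"
    by simp
  note fub = kernel_form_fubini(3,4)[OF a b k r, simplified fst_conv snd_conv]
  have sm: "smooth_alg {..<N} (\<lambda>y. ?\<rho> (\<lambda>i. x i - y i))" for x
    using smooth_alg_affine[OF mollifier(1), of N n "- 1" x] by simp
  have cs: "csupp {..<N} L (\<lambda>y. ?\<rho> (\<lambda>i. x i - y i))" if "\<And>j k. j < N \<Longrightarrow> \<bar>x j $ k\<bar> + 1 \<le> L" for x L
    unfolding csupp_def
  proof (intro allI ballI impI)
    fix y :: conf and j and k :: 3 assume j: "j \<in> {..<N}" "L < \<bar>y j $ k\<bar>"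
    have "1 / real (Suc n) \<le> 1"
      by simp
    moreover have "\<bar>x j $ k\<bar> + 1 \<le> L"
      using that j by simp
    ultimately have "1 / real (Suc n) < \<bar>x j $ k - y j $ k\<bar>"
      using j(2) by linarith
    then show "?\<rho> (\<lambda>i. x i - y i) = 0"
      using mollifier(2)[of N n, unfolded csupp_def, THEN spec, of "\<lambda>i. x i - y i", THEN bspec, of j, THEN spec, of k] j(1)
      by simp
  qed
  have "\<exists>L. \<forall>j k. j < N \<longrightarrow> \<bar>x j $ k\<bar> + 1 \<le> L" for x :: conf
  proof -
    have "\<bar>x j $ k\<bar> + 1 \<le> (\<Sum>j<N. \<Sum>k\<in>UNIV. \<bar>x j $ k\<bar>) + 1" if "j < N" for j k
      using coord_le_sum[OF that, of x k] by simp
    then show ?thesis by blast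
  qed
  then have csx: "\<exists>L. csupp {..<N} L (\<lambda>y. ?\<rho> (\<lambda>i. x i - y i))" for x
    using cs by blast
  have int_b: "integrable (lebN N) (\<lambda>y. b y * of_real (?\<rho> (\<lambda>i. x i - y i)))" for x
    using csx integrable_square_int_real[OF b sm] by blast
  have int_\<rho>: "integrable (lebN N) (\<lambda>y. ?\<rho> (\<lambda>i. x i - y i))" for x
    using csx integrable_smooth[OF sm] by blast
  define F where "F x = a x * (LINT y|lebN N. (b y - b x) * of_real (?\<rho> (\<lambda>i. x i - y i)))" for x
  have F: "F x = a x * (LINT y|lebN N. b y * of_real (?\<rho> (\<lambda>i. x i - y i))) - of_real (mass N n) * (a x * b x)" for x
  proof -
    have "(LINT y|lebN N. (b y - b x) * of_real (?\<rho> (\<lambda>i. x i - y i)))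
        = (LINT y|lebN N. b y * of_real (?\<rho> (\<lambda>i. x i - y i)) - b x * of_real (?\<rho> (\<lambda>i. x i - y i)))"
      by (simp only: left_diff_distrib)
    also have "\<dots> = (LINT y|lebN N. b y * of_real (?\<rho> (\<lambda>i. x i - y i))) - (LINT y|lebN N. b x * of_real (?\<rho> (\<lambda>i. x i - y i)))"
      by (rule Bochner_Integration.integral_diff[OF int_b]) (intro integrable_mult_right integrable_of_real int_\<rho>)
    also have "(LINT y|lebN N. b x * of_real (?\<rho> (\<lambda>i. x i - y i))) = b x * of_real (mass N n)"
      by (simp add: integral_mollifier)
    finally show ?thesis
      by (simp add: F_def right_diff_distrib mult_ac)
  qed
  have int_ab: "integrable (lebN N) (\<lambda>x. of_real (mass N n) * (a x * b x))"
    by (intro integrable_mult_right integrable_square_int_mult a b)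
  have int_F: "integrable (lebN N) F"
    unfolding F[abs_def] by (intro Bochner_Integration.integrable_diff fub int_ab)
  have LF: "(LINT x|lebN N. F x) = kernel_form N a b (\<lambda>p. ?\<rho> (\<lambda>i. fst p i - snd p i)) - of_real (mass N n) * (LINT x|lebN N. a x * b x)"
    unfolding F Bochner_Integration.integral_diff[OF fub(1) int_ab] fub(2) by simp
  define G where "G x y = ennreal (l * (cmod (a x))\<^sup>2 + (cmod (b y - b x))\<^sup>2 / l)" for x y
  have FG: "ennreal (norm (F x)) \<le> (\<integral>\<^sup>+z. G x (shift N z x) * ennreal (?\<rho> z) \<partial>lebN N)" if x: "x \<in> confs N" for x
  proof -
    have [measurable]: "(\<lambda>y. ?\<rho> (\<lambda>i. x i - y i)) \<in> borel_measurable (lebN N)"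
      by (rule smooth_alg_measurable[OF sm])
    have pw: "cmod (a x) * norm ((b y - b x) * complex_of_real (?\<rho> (\<lambda>i. x i - y i)))
        \<le> (l * (cmod (a x))\<^sup>2 + (cmod (b y - b x))\<^sup>2 / l) * ?\<rho> (\<lambda>i. x i - y i)" for y
    proof -
      have "2 * ((sqrt l * cmod (a x)) * (cmod (b y - b x) / sqrt l)) \<le> (sqrt l * cmod (a x))\<^sup>2 + (cmod (b y - b x) / sqrt l)\<^sup>2"
        by (rule two_mult_le_squares)
      then have "2 * (cmod (a x) * cmod (b y - b x)) \<le> l * (cmod (a x))\<^sup>2 + (cmod (b y - b x))\<^sup>2 / l"
        using l by (simp add: power_mult_distrib power_divide)
      then have "cmod (a x) * cmod (b y - b x) \<le> l * (cmod (a x))\<^sup>2 + (cmod (b y - b x))\<^sup>2 / l"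
        using mult_nonneg_nonneg[OF norm_ge_zero norm_ge_zero, of "a x" "b y - b x"] by linarith
      from mult_right_mono[OF this mollifier(3)[of N n "\<lambda>i. x i - y i"]] show ?thesis
        using mollifier(3)[of N n "\<lambda>i. x i - y i"] by (simp add: norm_mult mult.assoc)
    qed
    have "ennreal (norm (F x)) = ennreal (cmod (a x)) * ennreal (norm (LINT y|lebN N. (b y - b x) * of_real (?\<rho> (\<lambda>i. x i - y i))))"
      by (simp add: F_def norm_mult ennreal_mult)
    also have "\<dots> \<le> ennreal (cmod (a x)) * (\<integral>\<^sup>+y. ennreal (norm ((b y - b x) * of_real (?\<rho> (\<lambda>i. x i - y i)))) \<partial>lebN N)"
    proof (intro mult_left_mono integral_norm_bound_ennreal)
      have "integrable (lebN N) (\<lambda>y. b y * of_real (?\<rho> (\<lambda>i. x i - y i)) - b x * of_real (?\<rho> (\<lambda>i. x i - y i)))"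
        by (intro Bochner_Integration.integrable_diff integrable_mult_right integrable_of_real int_b int_\<rho>)
      then show "integrable (lebN N) (\<lambda>y. (b y - b x) * complex_of_real (?\<rho> (\<lambda>i. x i - y i)))"
        by (simp only: left_diff_distrib)
    qed simp
    also have "\<dots> = (\<integral>\<^sup>+y. ennreal (cmod (a x)) * ennreal (norm ((b y - b x) * of_real (?\<rho> (\<lambda>i. x i - y i)))) \<partial>lebN N)"
      by (rule nn_integral_cmult[symmetric]) measurable
    also have "\<dots> \<le> (\<integral>\<^sup>+y. G x y * ennreal (?\<rho> (\<lambda>i. x i - y i)) \<partial>lebN N)"
    proof (rule nn_integral_mono)
      fix y
      have "0 \<le> l * (cmod (a x))\<^sup>2 + (cmod (b y - b x))\<^sup>2 / l"
        using l by simp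
      then have "G x y * ennreal (?\<rho> (\<lambda>i. x i - y i))
          = ennreal ((l * (cmod (a x))\<^sup>2 + (cmod (b y - b x))\<^sup>2 / l) * ?\<rho> (\<lambda>i. x i - y i))"
        unfolding G_def using mollifier(3) by (intro ennreal_mult[symmetric]) auto
      then show "ennreal (cmod (a x)) * ennreal (norm ((b y - b x) * of_real (?\<rho> (\<lambda>i. x i - y i))))
          \<le> G x y * ennreal (?\<rho> (\<lambda>i. x i - y i))"
        using pw[of y] by (simp add: ennreal_leI flip: ennreal_mult)
    qed
    also have "\<dots> = (\<integral>\<^sup>+z. G x (shift N x z) * ennreal (?\<rho> (\<lambda>i. x i - shift N x z i)) \<partial>lebN N)"
      by (rule nn_integral_shift[symmetric]) (unfold G_def, measurable)
    also have "\<dots> = (\<integral>\<^sup>+z. G x (shift N z x) * ennreal (?\<rho> z) \<partial>lebN N)"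
      unfolding mollifier_shift by (simp add: shift_def add.commute)
    finally show ?thesis .
  qed
  have mG: "(\<lambda>p. G (fst p) (shift N (snd p) (fst p)) * ennreal (?\<rho> (snd p))) \<in> borel_measurable (lebN2 N)"
    unfolding G_def by measurable
  have "ennreal (norm (LINT x|lebN N. F x)) \<le> (\<integral>\<^sup>+x. ennreal (norm (F x)) \<partial>lebN N)"
    by (rule integral_norm_bound_ennreal[OF int_F])
  also have "\<dots> \<le> (\<integral>\<^sup>+x. \<integral>\<^sup>+z. G x (shift N z x) * ennreal (?\<rho> z) \<partial>lebN N \<partial>lebN N)"
    by (intro nn_integral_mono FG) (simp add: space_lebN)
  \<comment> \<open>With \<open>z\<close> outermost, the assumption on translates applies to each
    \<open>z\<close> separately; where the mollifier vanishes nothing has to be estimated.\<close>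
  also have "\<dots> = (\<integral>\<^sup>+z. \<integral>\<^sup>+x. G x (shift N z x) * ennreal (?\<rho> z) \<partial>lebN N \<partial>lebN N)"
    using Fubini'[of "\<lambda>x z. G x (shift N z x) * ennreal (?\<rho> z)"] mG by (simp add: case_prod_unfold)
  also have "\<dots> \<le> (\<integral>\<^sup>+z. ennreal (l * l2sq N a + \<delta> / l) * ennreal (?\<rho> z) \<partial>lebN N)"
  proof (rule nn_integral_mono)
    fix z
    show "(\<integral>\<^sup>+x. G x (shift N z x) * ennreal (?\<rho> z) \<partial>lebN N) \<le> ennreal (l * l2sq N a + \<delta> / l) * ennreal (?\<rho> z)"
    proof (cases "?\<rho> z = 0")
      case False
      then have z: "small N (1 / real (Suc n)) z"
        by (rule small_if_mollifier)
      have "(\<integral>\<^sup>+x. G x (shift N z x) \<partial>lebN N)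
          = (\<integral>\<^sup>+x. ennreal l * ennreal ((cmod (a x))\<^sup>2) + ennreal (1 / l) * ennreal ((cmod (b (shift N z x) - b x))\<^sup>2) \<partial>lebN N)"
        unfolding G_def using l by (intro nn_integral_cong) (simp flip: ennreal_mult ennreal_plus)
      also have "\<dots> = ennreal l * (\<integral>\<^sup>+x. ennreal ((cmod (a x))\<^sup>2) \<partial>lebN N)
          + ennreal (1 / l) * (\<integral>\<^sup>+x. ennreal ((cmod (b (shift N z x) - b x))\<^sup>2) \<partial>lebN N)"
        by (subst nn_integral_add, measurable) (simp add: nn_integral_cmult)
      also have "\<dots> \<le> ennreal l * ennreal (l2sq N a) + ennreal (1 / l) * ennreal \<delta>"
        unfolding nn_integral_square[OF a] by (intro add_left_mono mult_left_mono tr z) simp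
      also have "\<dots> = ennreal (l * l2sq N a + \<delta> / l)"
        using l \<delta> l2sq_nonneg[of N a] by (simp flip: ennreal_mult ennreal_plus)
      finally have "(\<integral>\<^sup>+x. G x (shift N z x) \<partial>lebN N) \<le> ennreal (l * l2sq N a + \<delta> / l)" .
      moreover have "(\<integral>\<^sup>+x. G x (shift N z x) * ennreal (?\<rho> z) \<partial>lebN N) = (\<integral>\<^sup>+x. G x (shift N z x) \<partial>lebN N) * ennreal (?\<rho> z)"
        by (rule nn_integral_multc) (unfold G_def, measurable)
      ultimately show ?thesis
        by (simp add: mult_right_mono)
    qed simp
  qed
  also have "\<dots> = ennreal (l * l2sq N a + \<delta> / l) * ennreal (mass N n)"
    unfolding mass_def
    by (subst nn_integral_cmult, measurable, subst nn_integral_eq_integral)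
      (auto intro: integrable_smooth[OF mollifier(1,2)] mollifier(3))
  also have "\<dots> = ennreal (mass N n * (l * l2sq N a + \<delta> / l))"
  proof -
    have "ennreal (l * l2sq N a + \<delta> / l) * ennreal (mass N n) = ennreal ((l * l2sq N a + \<delta> / l) * mass N n)"
      using l \<delta> l2sq_nonneg[of N a] mass_pos[of N n] by (intro ennreal_mult[symmetric]) auto
    then show ?thesis
      by (simp only: mult.commute)
  qed
  finally show ?thesis
    using l \<delta> l2sq_nonneg[of N a] mass_pos[of N n] unfolding LF by (subst (asm) ennreal_le_iff) auto
qed

lemma kernel_form_mollifier_tendsto:
  assumes a: "square_int N a" and b: "square_int N b"
  shows "(\<lambda>n. kernel_form N a b (\<lambda>p. mollifier N n (\<lambda>i. fst p i - snd p i)) / of_real (mass N n)) \<longlonglongrightarrow>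
    (LINT x|lebN N. a x * b x)"
proof (rule LIMSEQ_I)
  fix \<epsilon> :: real assume \<epsilon>: "\<epsilon> > 0"
  let ?I = "LINT x|lebN N. a x * b x"
  \<comment> \<open>Together with \<open>\<delta> = l * (\<epsilon> / 3)\<close> both error terms
    are at most \<open>\<epsilon> / 3\<close>, so their sum stays strictly below
    \<open>\<epsilon>\<close>. The \<open>+ 1\<close> covers \<open>a = 0\<close>.\<close>
  define l where "l = \<epsilon> / 3 / (l2sq N a + 1)"
  have A: "l2sq N a + 1 > 0"
    using l2sq_nonneg[of N a] by simp
  then have l: "l > 0"
    using \<epsilon> by (simp add: l_def)
  have la: "l * l2sq N a \<le> \<epsilon> / 3"
  proof -
    have "l * l2sq N a \<le> l * (l2sq N a + 1)"
      using l by (intro mult_left_mono) auto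
    also have "\<dots> = \<epsilon> / 3"
      unfolding l_def by (rule nonzero_eq_divide_eq[THEN iffD1, OF _ refl]) (use A in simp)
    finally show ?thesis .
  qed
  define \<delta> where "\<delta> = l * (\<epsilon> / 3)"
  have \<delta>: "\<delta> > 0" "\<delta> / l = \<epsilon> / 3"
    using l \<epsilon> by (simp_all add: \<delta>_def)
  obtain r where r: "r > 0" "\<And>z. small N r z \<Longrightarrow>
      (\<integral>\<^sup>+x. ennreal ((cmod (b (shift N z x) - b x))\<^sup>2) \<partial>lebN N) \<le> ennreal \<delta>"
    using L2_translation_continuous[OF b \<delta>(1)] by blast
  obtain m where m: "inverse (real (Suc m)) < r"
    using reals_Archimedean[OF r(1)] by blast
  have "norm (kernel_form N a b (\<lambda>p. mollifier N n (\<lambda>i. fst p i - snd p i)) / of_real (mass N n) - ?I) < \<epsilon>"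
    if n: "n \<ge> m" for n
  proof -
    have "1 / real (Suc n) \<le> inverse (real (Suc m))"
      using n by (simp add: inverse_eq_divide frac_le)
    then have "1 / real (Suc n) \<le> r"
      using m by linarith
    then have "norm (kernel_form N a b (\<lambda>p. mollifier N n (\<lambda>i. fst p i - snd p i)) - of_real (mass N n) * ?I)
        \<le> mass N n * (l * l2sq N a + \<delta> / l)"
      by (intro kernel_form_mollifier_error[OF a b l] r(2)) (use \<delta> in \<open>auto elim: small_mono\<close>)
    also have "\<dots> \<le> mass N n * (2 * \<epsilon> / 3)"
      using la \<delta>(2) mass_pos[of N n] by (intro mult_left_mono) auto
    also have "\<dots> < mass N n * \<epsilon>"
      using mass_pos[of N n] \<epsilon> by simp
    finally have *: "norm (kernel_form N a b (\<lambda>p. mollifier N n (\<lambda>i. fst p i - snd p i)) - of_real (mass N n) * ?I) < mass N n * \<epsilon>" .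
    have "kernel_form N a b (\<lambda>p. mollifier N n (\<lambda>i. fst p i - snd p i)) / of_real (mass N n) - ?I
        = (kernel_form N a b (\<lambda>p. mollifier N n (\<lambda>i. fst p i - snd p i)) - of_real (mass N n) * ?I) / of_real (mass N n)"
      using mass_pos[of N n] by (simp add: diff_divide_distrib)
    then show ?thesis
      using * mass_pos[of N n] by (simp add: norm_divide pos_divide_less_eq mult.commute)
  qed
  then show "\<exists>m. \<forall>n\<ge>m. norm (kernel_form N a b (\<lambda>p. mollifier N n (\<lambda>i. fst p i - snd p i)) / of_real (mass N n) - ?I) < \<epsilon>"
    by blast
qed

context first_order_symbol
begin

text \<open>For each fixed mollifier the cutoff at infinity is removed, which gives an exact
  identity between the two kernel forms. It is divided by \<open>mass\<close>, and the mollifier is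
  concentrated only afterwards.\<close>

lemma weak_at_symmetric:
  assumes L2: "u \<in> L2 N" "v \<in> L2 N" "u' \<in> L2 N" "v' \<in> L2 N"
    and weak: "\<And>f L. smooth_alg {..<N} f \<Longrightarrow> csupp {..<N} L f \<Longrightarrow> weak_at u v f"
    and weak': "\<And>f L. smooth_alg {..<N} f \<Longrightarrow> csupp {..<N} L f \<Longrightarrow> weak_at u' v' f"
  shows "l2_inner N v u' = l2_inner N u v'"
proof -
  have sq: "square_int N (\<lambda>x. cnj (u x s))" "square_int N (\<lambda>x. cnj (v x s))"
    "square_int N (\<lambda>x. u' x s)" "square_int N (\<lambda>x. v' x s)" if "s \<in> spins N" for s
    using L2 that by (auto simp: L2_iff intro: square_int_cnj)
  have kernel_eq: "(\<Sum>t\<in>spins N. kernel_form N (\<lambda>x. cnj (v x t)) (\<lambda>y. u' y t) (\<lambda>p. \<rho> (\<lambda>i. fst p i - snd p i)))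
      = (\<Sum>s\<in>spins N. kernel_form N (\<lambda>x. cnj (u x s)) (\<lambda>y. v' y s) (\<lambda>p. \<rho> (\<lambda>i. fst p i - snd p i)))"
    if \<rho>: "smooth_alg {..<N} \<rho>" "csupp {..<N} r \<rho>" "r \<ge> 0" for \<rho> r
  proof -
    have "(\<lambda>n. (\<Sum>t\<in>spins N. kernel_form N (\<lambda>x. cnj (v x t)) (\<lambda>y. u' y t) (product_kernel \<rho> (plateau N n) (plateau N n)))
        - (\<Sum>s\<in>spins N. kernel_form N (\<lambda>x. cnj (u x s)) (\<lambda>y. v' y s) (product_kernel \<rho> (plateau N n) (plateau N n))))
        \<longlonglongrightarrow> (\<Sum>t\<in>spins N. kernel_form N (\<lambda>x. cnj (v x t)) (\<lambda>y. u' y t) (\<lambda>p. \<rho> (\<lambda>i. fst p i - snd p i)))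
        - (\<Sum>s\<in>spins N. kernel_form N (\<lambda>x. cnj (u x s)) (\<lambda>y. v' y s) (\<lambda>p. \<rho> (\<lambda>i. fst p i - snd p i)))"
      by (intro tendsto_diff tendsto_sum kernel_form_plateau_tendsto(1)[OF _ _ \<rho>] sq)
    moreover have "(\<lambda>n. \<Sum>t\<in>spins N. \<Sum>j<N. \<Sum>k\<in>UNIV. \<Sum>s\<in>spins N. A j k s t *
        (kernel_form N (\<lambda>x. cnj (u x s)) (\<lambda>y. u' y t) (product_kernel \<rho> (pd j k (plateau N n)) (plateau N n))
         + kernel_form N (\<lambda>x. cnj (u x s)) (\<lambda>y. u' y t) (product_kernel \<rho> (plateau N n) (pd j k (plateau N n)))))
        \<longlonglongrightarrow> (\<Sum>t\<in>spins N. \<Sum>j<N. \<Sum>k\<in>UNIV. \<Sum>s\<in>spins N. A j k s t * (0 + 0))"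
      by (intro tendsto_add tendsto_sum tendsto_mult tendsto_const kernel_form_plateau_tendsto(2,3)[OF _ _ \<rho>] sq)
    moreover have "(\<Sum>t\<in>spins N. kernel_form N (\<lambda>x. cnj (v x t)) (\<lambda>y. u' y t) (product_kernel \<rho> (plateau N n) (plateau N n)))
        - (\<Sum>s\<in>spins N. kernel_form N (\<lambda>x. cnj (u x s)) (\<lambda>y. v' y s) (product_kernel \<rho> (plateau N n) (plateau N n)))
        = (\<Sum>t\<in>spins N. \<Sum>j<N. \<Sum>k\<in>UNIV. \<Sum>s\<in>spins N. A j k s t *
        (kernel_form N (\<lambda>x. cnj (u x s)) (\<lambda>y. u' y t) (product_kernel \<rho> (pd j k (plateau N n)) (plateau N n))
         + kernel_form N (\<lambda>x. cnj (u x s)) (\<lambda>y. u' y t) (product_kernel \<rho> (plateau N n) (pd j k (plateau N n)))))" for n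
      by (rule doubling_identity[OF L2 weak weak' \<rho> plateau(1,2)])
    ultimately have "(\<Sum>t\<in>spins N. kernel_form N (\<lambda>x. cnj (v x t)) (\<lambda>y. u' y t) (\<lambda>p. \<rho> (\<lambda>i. fst p i - snd p i)))
        - (\<Sum>s\<in>spins N. kernel_form N (\<lambda>x. cnj (u x s)) (\<lambda>y. v' y s) (\<lambda>p. \<rho> (\<lambda>i. fst p i - snd p i)))
        = (\<Sum>t\<in>spins N. \<Sum>j<N. \<Sum>k\<in>UNIV. \<Sum>s\<in>spins N. A j k s t * (0 + 0))"
      by (intro LIMSEQ_unique) simp_all
    then show ?thesis
      by simp
  qed
  have "(\<lambda>n. \<Sum>t\<in>spins N. kernel_form N (\<lambda>x. cnj (v x t)) (\<lambda>y. u' y t) (\<lambda>p. mollifier N n (\<lambda>i. fst p i - snd p i)) / of_real (mass N n))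
      \<longlonglongrightarrow> l2_inner N v u'"
    unfolding l2_inner_def by (intro tendsto_sum kernel_form_mollifier_tendsto sq)
  moreover have "(\<lambda>n. \<Sum>s\<in>spins N. kernel_form N (\<lambda>x. cnj (u x s)) (\<lambda>y. v' y s) (\<lambda>p. mollifier N n (\<lambda>i. fst p i - snd p i)) / of_real (mass N n))
      \<longlonglongrightarrow> l2_inner N u v'"
    unfolding l2_inner_def by (intro tendsto_sum kernel_form_mollifier_tendsto sq)
  moreover have "(\<Sum>t\<in>spins N. kernel_form N (\<lambda>x. cnj (v x t)) (\<lambda>y. u' y t) (\<lambda>p. mollifier N n (\<lambda>i. fst p i - snd p i)) / of_real (mass N n))
      = (\<Sum>s\<in>spins N. kernel_form N (\<lambda>x. cnj (u x s)) (\<lambda>y. v' y s) (\<lambda>p. mollifier N n (\<lambda>i. fst p i - snd p i)) / of_real (mass N n))" for n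
    using kernel_eq[OF mollifier(1,2), of n] by (simp flip: sum_divide_distrib)
  ultimately show ?thesis
    using LIMSEQ_unique by fastforce
qed

end

subsection \<open>Symmetry of the adjoint and decoupling\<close>

text \<open>The matrix of \<open>dirac_alpha k\<close> acting on the \<open>j\<close>-th tensor
  factor and as the identity on the others: \<open>s(j := t j) = t\<close> says that
  \<open>s\<close> and \<open>t\<close> agree away from \<open>j\<close>.\<close>

definition dirac_A :: "real \<Rightarrow> real \<Rightarrow> nat \<Rightarrow> 3 \<Rightarrow> spin \<Rightarrow> spin \<Rightarrow> complex"
  where "dirac_A c hbar j k s t =
    (if s(j := t j) = t then - \<i> * of_real (c * hbar) * dirac_alpha k $ s j $ t j else 0)"

definition dirac_B :: "real \<Rightarrow> real \<Rightarrow> nat \<Rightarrow> spin \<Rightarrow> spin \<Rightarrow> complex"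
  where "dirac_B c m N s t =
    (\<Sum>j<N. if s(j := t j) = t then of_real (m * c\<^sup>2) * dirac_beta $ s j $ t j else 0)"

lemma vector4_nth:
  "(vector [a, b, d, e] :: 'a::zero^4) $ 1 = a" "(vector [a, b, d, e] :: 'a::zero^4) $ 2 = b"
  "(vector [a, b, d, e] :: 'a::zero^4) $ 3 = d" "(vector [a, b, d, e] :: 'a::zero^4) $ 4 = e"
  by (simp_all add: vector_def)

lemma dirac_alpha_hermitian: "cnj (dirac_alpha k $ a $ b) = dirac_alpha k $ b $ a"
  using exhaust_4[of a] exhaust_4[of b] by (auto simp: dirac_alpha_def vector4_nth)

lemma dirac_beta_hermitian: "cnj (dirac_beta $ a $ b) = dirac_beta $ b $ a"
  using exhaust_4[of a] exhaust_4[of b] by (auto simp: dirac_beta_def vector4_nth)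

lemma fun_upd_eq_sym: "s(j := t j) = t \<longleftrightarrow> t(j := s j) = s"
  by (auto simp: fun_eq_iff)

interpretation dirac: first_order_symbol N "dirac_A c hbar" "dirac_B c m N" for c hbar m N
proof
  fix j k s t
  show "cnj (dirac_A c hbar j k s t) = - dirac_A c hbar j k t s"
    by (simp add: dirac_A_def dirac_alpha_hermitian fun_upd_eq_sym[of t j s])
  show "cnj (dirac_B c m N s t) = dirac_B c m N t s"
    by (simp add: dirac_B_def dirac_beta_hermitian fun_upd_eq_sym[of t _ s] if_distrib[of cnj] cong: if_cong)
qed

definition spike :: "spin \<Rightarrow> (conf \<Rightarrow> real) \<Rightarrow> spin \<Rightarrow> conf \<Rightarrow> real"
  where "spike t f s x = (if s = t then f x else 0)"

lemma spike_test_field: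
  assumes "smooth_alg {..<N} f" "csupp {..<N} L f"
  shows "test_field N (spike t f)"
proof -
  have "smooth_alg {..<N} (spike t f s)" "csupp {..<N} L (spike t f s)" for s
    by (cases "s = t"; use assms in \<open>simp add: spike_def[abs_def] smooth_alg.const csupp_def\<close>)+
  then show ?thesis
    unfolding test_field_def by blast
qed

lemma pd_spike:
  assumes "smooth_alg J f"
  shows "pd j k (spike t f s) x = spike t (pd j k f) s x"
proof (cases "s = t")
  case False
  have "pd j k (\<lambda>x. 0) = (\<lambda>x. 0)"
    by (rule pd_eqI) simp
  then show ?thesis
    using False by (simp add: spike_def[abs_def])
qed (simp add: spike_def[abs_def])

text \<open>Only \<open>b = t j\<close> can turn \<open>s(j := b)\<close> into \<open>t\<close>, so
  the sum over the spin of particle \<open>j\<close> has at most one nonzero term.\<close>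

lemma sum_spike:
  "(\<Sum>b\<in>(UNIV :: 4 set). g b * of_real (spike t f (s(j := b)) x)) =
    (if s(j := t j) = t then g (t j) * of_real (f x) else (0::complex))"
proof -
  have "(\<Sum>b\<in>(UNIV :: 4 set). g b * of_real (spike t f (s(j := b)) x))
      = (\<Sum>b\<in>(UNIV :: 4 set). if b = t j then (if s(j := t j) = t then g (t j) * of_real (f x) else 0) else 0)"
    by (intro sum.cong refl) (auto simp: spike_def)
  then show ?thesis
    by simp
qed

lemma dirac_op_spike:
  assumes "smooth_alg J f"
  shows "dirac_op c hbar m N (spike t f) x s =
    (\<Sum>j<N. \<Sum>k\<in>UNIV. dirac_A c hbar j k s t * of_real (pd j k f x)) + dirac_B c m N s t * of_real (f x)"
proof -
  have "particle_op c hbar m j (spike t f) x s = (\<Sum>k\<in>UNIV. dirac_A c hbar j k s t * of_real (pd j k f x))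
      + (if s(j := t j) = t then of_real (m * c\<^sup>2) * dirac_beta $ s j $ t j else 0) * of_real (f x)" for j
    unfolding particle_op_eq pd_spike[OF assms] sum_spike dirac_A_def by (auto intro!: sum.cong)
  then show ?thesis
    by (simp add: dirac_op_def dirac_B_def sum.distrib sum_distrib_right)
qed

text \<open>Passes from spinor test fields to scalar test functions: a field with a single nonzero
  component \<open>t\<close> picks out column \<open>t\<close> of the coefficient matrices.\<close>

lemma weak_at_spike:
  assumes u: "u \<in> L2 N" and f: "smooth_alg {..<N} f" "csupp {..<N} L f"
    and eq: "\<And>t. t \<in> spins N \<Longrightarrow> l2_inner N u (dirac_op c hbar m N (spike t f)) = l2_inner N v (field (spike t f))"
  shows "dirac.weak_at N c hbar m u v f"
  unfolding dirac.weak_at_def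
proof
  fix t assume t: "t \<in> spins N"
  have su: "square_int N (\<lambda>x. cnj (u x s))" if "s \<in> spins N" for s
    using u that by (auto simp: L2_iff intro: square_int_cnj)
  have i0: "integrable (lebN N) (\<lambda>x. cnj (u x s) * of_real (f x))" if "s \<in> spins N" for s
    by (rule integrable_square_int_real[OF su[OF that] f])
  have i1: "integrable (lebN N) (\<lambda>x. cnj (u x s) * of_real (pd j k f x))" if "s \<in> spins N" for s j k
    by (rule integrable_square_int_real[OF su[OF that] smooth_alg_pd[OF f(1)] csupp_pd[OF f]])
  have "(LINT x|lebN N. cnj (u x s) * dirac_op c hbar m N (spike t f) x s)
      = (\<Sum>j<N. \<Sum>k\<in>UNIV. dirac_A c hbar j k s t * (LINT x|lebN N. cnj (u x s) * of_real (pd j k f x)))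
      + dirac_B c m N s t * (LINT x|lebN N. cnj (u x s) * of_real (f x))" if s: "s \<in> spins N" for s
  proof -
    have "(LINT x|lebN N. cnj (u x s) * dirac_op c hbar m N (spike t f) x s)
        = (LINT x|lebN N. (\<Sum>j<N. \<Sum>k\<in>UNIV. dirac_A c hbar j k s t * (cnj (u x s) * of_real (pd j k f x)))
          + dirac_B c m N s t * (cnj (u x s) * of_real (f x)))"
      unfolding dirac_op_spike[OF f(1)] by (simp add: distrib_left sum_distrib_left mult_ac)
    also have "\<dots> = (LINT x|lebN N. (\<Sum>j<N. \<Sum>k\<in>UNIV. dirac_A c hbar j k s t * (cnj (u x s) * of_real (pd j k f x))))
        + (LINT x|lebN N. dirac_B c m N s t * (cnj (u x s) * of_real (f x)))"
      by (intro Bochner_Integration.integral_add Bochner_Integration.integrable_sum integrable_mult_right i0 i1 s)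
    also have "(LINT x|lebN N. (\<Sum>j<N. \<Sum>k\<in>UNIV. dirac_A c hbar j k s t * (cnj (u x s) * of_real (pd j k f x))))
        = (\<Sum>j<N. LINT x|lebN N. (\<Sum>k\<in>UNIV. dirac_A c hbar j k s t * (cnj (u x s) * of_real (pd j k f x))))"
      by (intro Bochner_Integration.integral_sum Bochner_Integration.integrable_sum integrable_mult_right i1 s)
    also have "\<dots> = (\<Sum>j<N. \<Sum>k\<in>UNIV. LINT x|lebN N. dirac_A c hbar j k s t * (cnj (u x s) * of_real (pd j k f x)))"
      by (intro sum.cong refl Bochner_Integration.integral_sum integrable_mult_right i1 s)
    finally show ?thesis
      by simp
  qed
  then have "l2_inner N u (dirac_op c hbar m N (spike t f)) =
      (\<Sum>s\<in>spins N. \<Sum>j<N. \<Sum>k\<in>UNIV. dirac_A c hbar j k s t * (LINT x|lebN N. cnj (u x s) * of_real (pd j k f x)))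
      + (\<Sum>s\<in>spins N. dirac_B c m N s t * (LINT x|lebN N. cnj (u x s) * of_real (f x)))"
    unfolding l2_inner_def by (simp add: sum.distrib)
  also have "(\<Sum>s\<in>spins N. \<Sum>j<N. \<Sum>k\<in>UNIV. dirac_A c hbar j k s t * (LINT x|lebN N. cnj (u x s) * of_real (pd j k f x)))
      = (\<Sum>j<N. \<Sum>k\<in>UNIV. \<Sum>s\<in>spins N. dirac_A c hbar j k s t * (LINT x|lebN N. cnj (u x s) * of_real (pd j k f x)))"
    by (subst sum.swap) (intro sum.cong refl sum.swap)
  finally have 1: "l2_inner N u (dirac_op c hbar m N (spike t f)) = \<dots> +
      (\<Sum>s\<in>spins N. dirac_B c m N s t * (LINT x|lebN N. cnj (u x s) * of_real (f x)))" .
  have "l2_inner N v (field (spike t f)) = (\<Sum>s\<in>spins N. if s = t then LINT x|lebN N. cnj (v x t) * of_real (f x) else 0)"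
    unfolding l2_inner_def by (intro sum.cong refl) (auto simp: field_def spike_def)
  then have 2: "l2_inner N v (field (spike t f)) = (LINT x|lebN N. cnj (v x t) * of_real (f x))"
    using t finite_spins by simp
  show "(\<Sum>j<N. \<Sum>k\<in>UNIV. \<Sum>s\<in>spins N. dirac_A c hbar j k s t * (LINT x|lebN N. cnj (u x s) * of_real (pd j k f x)))
      + (\<Sum>s\<in>spins N. dirac_B c m N s t * (LINT x|lebN N. cnj (u x s) * of_real (f x)))
      = (LINT x|lebN N. cnj (v x t) * of_real (f x))"
    using eq[OF t] 1 2 by simp
qed

text \<open>The symmetry of \<open>W\<close>. Both pairs are reduced to single components, freed
  from the vanishing condition at the origins, and compared by doubling of variables.\<close>

lemma dirac_op_adjoint_symmetric:
  assumes L2: "u \<in> L2 N" "v \<in> L2 N" "u' \<in> L2 N" "v' \<in> L2 N"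
    and weak: "\<And>F. test_field N F \<Longrightarrow> (\<And>s. vanish_near_0 {..<N} (F s)) \<Longrightarrow>
      l2_inner N u (dirac_op c hbar m N F) = l2_inner N v (field F)"
    and weak': "\<And>F. test_field N F \<Longrightarrow> (\<And>s. vanish_near_0 {..<N} (F s)) \<Longrightarrow>
      l2_inner N u' (dirac_op c hbar m N F) = l2_inner N v' (field F)"
  shows "l2_inner N v u' = l2_inner N u v'"
proof -
  have van: "vanish_near_0 {..<N} (spike t f s)" if "vanish_near_0 {..<N} f" for t f s
    using that by (auto simp: vanish_near_0_def spike_def gt_ex)
  have w0: "dirac.weak_at N c hbar m u v f" if "smooth_alg {..<N} f" "csupp {..<N} L f" "vanish_near_0 {..<N} f" for f L
    by (rule weak_at_spike[OF L2(1) that(1,2)], rule weak) (use that van spike_test_field in blast)+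
  have w0': "dirac.weak_at N c hbar m u' v' f" if "smooth_alg {..<N} f" "csupp {..<N} L f" "vanish_near_0 {..<N} f" for f L
    by (rule weak_at_spike[OF L2(3) that(1,2)], rule weak') (use that van spike_test_field in blast)+
  have w1: "dirac.weak_at N c hbar m u v f" if "smooth_alg {..<N} f" "csupp {..<N} L f" for f L
    by (rule dirac.weak_at_remove_origin[OF L2(1,2) _ that], rule w0)
  have w1': "dirac.weak_at N c hbar m u' v' f" if "smooth_alg {..<N} f" "csupp {..<N} L f" for f L
    by (rule dirac.weak_at_remove_origin[OF L2(3,4) _ that], rule w0')
  show ?thesis
    by (rule dirac.weak_at_symmetric[OF L2 w1 w1'])
qed

section \<open>The top sector of Fock space\<close>

text \<open>Representatives have to be square-integrable in every sector, so any other function is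
  replaced by 0 to make the lifting total.\<close>

lift_definition single :: "nat \<Rightarrow> wavefun \<Rightarrow> fockvec"
  is "\<lambda>N \<psi> M. if M = N \<and> \<psi> \<in> L2 N then \<psi> else (\<lambda>x s. 0)"
  by (simp add: ae_eq_seq_def ae_eq_refl L2_zero)

lift_definition proj :: "nat \<Rightarrow> fockvec \<Rightarrow> fockvec"
  is "\<lambda>N \<Psi> M. if M = N then \<Psi> M else (\<lambda>x s. 0)"
  by (simp add: ae_eq_seq_def ae_eq_refl L2_zero)

lemma sector_single: "\<psi> \<in> L2 N \<Longrightarrow> sector (single N \<psi>) N \<psi>"
  by transfer (simp add: ae_eq_refl)

lemma sector_single_other: "M \<noteq> N \<Longrightarrow> sector (single N \<psi>) M (\<lambda>x s. 0)"
  by transfer (simp add: ae_eq_refl L2_zero)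

lemma sector_proj: "sector \<Psi> N \<psi> \<Longrightarrow> sector (proj N \<Psi>) N \<psi>"
  by transfer simp

lemma sector_proj_other: "M \<noteq> N \<Longrightarrow> sector (proj N \<Psi>) M (\<lambda>x s. 0)"
  by transfer (simp add: ae_eq_refl L2_zero)

lemma sector_diff_proj: "sector (\<Psi> - proj N \<Psi>) N (\<lambda>x s. 0)"
  by transfer (simp add: ae_eq_refl L2_zero)

lemma sector_diff_proj_other: "M \<noteq> N \<Longrightarrow> sector \<Psi> M \<psi> \<Longrightarrow> sector (\<Psi> - proj N \<Psi>) M \<psi>"
  by transfer simp

lemma sector_inner_eq: "sector \<Psi> N \<psi> \<Longrightarrow> sector \<Phi> N \<phi> \<Longrightarrow> sector_inner N \<Psi> \<Phi> = l2_inner N \<psi> \<phi>"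
  by transfer (auto simp: ae_eq_seq_def intro!: l2_inner_cong)

lemma sector_ex: "\<exists>\<psi>. sector \<Psi> N \<psi>"
  by transfer (auto simp: ae_eq_seq_def)

lemma sector_inner_zero:
  "sector \<Psi> N (\<lambda>x s. 0) \<Longrightarrow> sector_inner N \<Psi> \<Phi> = 0" "sector \<Phi> N (\<lambda>x s. 0) \<Longrightarrow> sector_inner N \<Psi> \<Phi> = 0"
proof -
  obtain \<psi> \<phi> where *: "sector \<Psi> N \<psi>" "sector \<Phi> N \<phi>"
    using sector_ex by blast
  show "sector \<Psi> N (\<lambda>x s. 0) \<Longrightarrow> sector_inner N \<Psi> \<Phi> = 0"
    using sector_inner_eq[OF _ *(2)] by (simp add: l2_inner_def)
  show "sector \<Phi> N (\<lambda>x s. 0) \<Longrightarrow> sector_inner N \<Psi> \<Phi> = 0"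
    using sector_inner_eq[OF *(1)] by (simp add: l2_inner_def)
qed

lemma fock_inner_left:
  assumes "\<And>M. M \<noteq> N \<Longrightarrow> sector \<Psi> M (\<lambda>x s. 0)"
  shows "fock_inner N \<Psi> \<Phi> = sector_inner N \<Psi> \<Phi>"
proof -
  have "(\<Sum>M\<in>{..N} - {N}. sector_inner M \<Psi> \<Phi>) = 0"
    by (intro sum.neutral ballI sector_inner_zero(1) assms) simp
  then show ?thesis
    unfolding fock_inner_def by (subst sum.remove[of _ N]) auto
qed

lemma fock_inner_right:
  assumes "\<And>M. M \<noteq> N \<Longrightarrow> sector \<Phi> M (\<lambda>x s. 0)"
  shows "fock_inner N \<Psi> \<Phi> = sector_inner N \<Psi> \<Phi>"
proof -
  have "(\<Sum>M\<in>{..N} - {N}. sector_inner M \<Psi> \<Phi>) = 0"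
    by (intro sum.neutral ballI sector_inner_zero(2) assms) simp
  then show ?thesis
    unfolding fock_inner_def by (subst sum.remove[of _ N]) auto
qed

lemma zero_in_symmetrize: "(\<lambda>x s. 0) \<in> symmetrize st N ` L2 N"
proof -
  have "symmetrize st N (\<lambda>x s. 0) = (\<lambda>x s. 0)"
    by (simp add: symmetrize_def)
  then show ?thesis
    using L2_zero by (metis image_eqI)
qed

lemma fock_sector: "\<Psi> \<in> fock st N \<Longrightarrow> M \<le> N \<Longrightarrow> \<exists>\<psi>\<in>L2 M. sector \<Psi> M (symmetrize st M \<psi>)"
  by (auto simp: fock_def)

lemma single_fock_top:
  assumes "\<psi> \<in> L2 N"
  shows "single N (symmetrize st N \<psi>) \<in> fock_top st N"
proof -
  have "\<exists>\<phi>\<in>symmetrize st M ` L2 M. sector (single N (symmetrize st N \<psi>)) M \<phi>" for M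
  proof (cases "M = N")
    case True
    then show ?thesis
      using sector_single[OF symmetrize_L2[OF assms, of st]] assms by blast
  next
    case False
    then show ?thesis
      using sector_single_other zero_in_symmetrize by blast
  qed
  then show ?thesis
    by (auto simp: fock_top_def fock_def intro!: sector_single_other)
qed

lemma proj_fock_top:
  assumes "\<Psi> \<in> fock st N"
  shows "proj N \<Psi> \<in> fock_top st N"
proof -
  have "\<exists>\<phi>\<in>symmetrize st M ` L2 M. sector (proj N \<Psi>) M \<phi>" for M
  proof (cases "M = N")
    case True
    then show ?thesis
      using fock_sector[OF assms, of N] sector_proj by auto
  next
    case False
    then show ?thesis
      using sector_proj_other zero_in_symmetrize by blast
  qed
  then show ?thesis
    by (auto simp: fock_top_def fock_def intro!: sector_proj_other)
qed

lemma diff_proj_fock_below: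
  assumes "\<Psi> \<in> fock st N"
  shows "\<Psi> - proj N \<Psi> \<in> fock_below st N"
proof -
  have "\<exists>\<phi>\<in>symmetrize st M ` L2 M. sector (\<Psi> - proj N \<Psi>) M \<phi>" if "M \<le> N" for M
  proof (cases "M = N")
    case True
    then show ?thesis
      using sector_diff_proj zero_in_symmetrize by blast
  next
    case False
    then show ?thesis
      using fock_sector[OF assms that] sector_diff_proj_other[OF False] by blast
  qed
  moreover have "sector (\<Psi> - proj N \<Psi>) M (\<lambda>x s. 0)" if "M > N" for M
    using assms that sector_diff_proj_other[of M N] by (simp add: fock_def)
  ultimately show ?thesis
    by (simp add: fock_below_def fock_def sector_diff_proj)
qed

text \<open>Supplies the test pairs. Symmetrizing a test field that stays away from the origins
  gives a vector in \<open>D_circ st N\<close>, and its image is computed through the commutation of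
  the Dirac operator with symmetrization.\<close>

lemma H_circ_test_field:
  assumes F: "test_field N F" and van: "\<And>s. vanish_near_0 {..<N} (F s)"
  shows "(single N (symmetrize st N (field F)), single N (symmetrize st N (dirac_op c hbar m N F))) \<in> H_circ c hbar m st N"
proof -
  let ?\<Psi> = "single N (symmetrize st N (field F))" and ?\<Phi> = "single N (symmetrize st N (dirac_op c hbar m N F))"
  have top: "?\<Psi> \<in> fock_top st N" "?\<Phi> \<in> fock_top st N"
    by (intro single_fock_top field_L2 dirac_op_L2 F)+
  have sec: "sector ?\<Psi> N (symmetrize st N (field F))" "sector ?\<Phi> N (symmetrize st N (dirac_op c hbar m N F))"
    by (intro sector_single symmetrize_L2 field_L2 dirac_op_L2 F)+
  have "\<exists>\<psi>\<in>symmetrize st M ` dirac_free_dom c hbar m M. \<exists>\<phi>. sector ?\<Psi> M \<psi> \<and> sector ?\<Phi> M \<phi> \<and> dirac_free c hbar m M \<psi> \<phi>" for M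
  proof (cases "M = N")
    case True
    \<comment> \<open>\<open>H_free\<close> asks for a function in the domain before symmetrization
      and for the action on the symmetrized function. The latter is available because the
      symmetrized field is again a test field.\<close>
    have "dirac_free c hbar m N (symmetrize st N (field F)) (symmetrize st N (dirac_op c hbar m N F))"
      using dirac_free_field[OF test_field_symmetrize[OF F, of st], of c hbar m]
      by (simp add: symmetrize_of_field dirac_op_symmetrize[OF F])
    moreover have "field F \<in> dirac_free_dom c hbar m N"
      unfolding dirac_free_dom_def using dirac_free_field[OF F] by blast
    ultimately show ?thesis
      using sec True by blast
  next
    case False
    let ?Z = "\<lambda>(s::spin) (x::conf). 0::real"
    have Z: "test_field M ?Z"
      by (auto simp: test_field_def csupp_def smooth_alg.const)
    have "pd j k (\<lambda>x. 0) = (\<lambda>x. 0)" for j k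
      by (rule pd_eqI) simp
    then have "dirac_op c hbar m M ?Z = (\<lambda>x s. 0)"
      by (simp add: dirac_op_def particle_op_eq fun_eq_iff)
    moreover have "field ?Z = (\<lambda>x s. 0)"
      by (simp add: field_def)
    ultimately have "dirac_free c hbar m M (\<lambda>x s. 0) (\<lambda>x s. 0)"
      using dirac_free_field[OF Z, of c hbar m] by simp
    moreover from this have "(\<lambda>x s. 0) \<in> symmetrize st M ` dirac_free_dom c hbar m M"
      by (intro image_eqI[of _ _ "\<lambda>x s. 0"]) (auto simp: symmetrize_def dirac_free_dom_def)
    ultimately show ?thesis
      using sector_single_other[OF False] by blast
  qed
  then have "(?\<Psi>, ?\<Phi>) \<in> H_free c hbar m st N"
    using top by (auto simp: H_free_def fock_top_def)
  moreover have "field F \<in> Cc_infty_spinor N (- {0})"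
    using F van Cc_infty_of_real unfolding Cc_infty_spinor_def test_field_def field_def by blast
  then have "?\<Psi> \<in> D_circ st N"
    unfolding D_circ_def using top sec(1) by blast
  ultimately show ?thesis
    by (simp add: H_circ_def restrict_to_def)
qed

lemma is_operator_diff:
  assumes "is_operator X G" "(\<Psi>, \<Phi>) \<in> G" "(\<Psi>', \<Phi>') \<in> G"
  shows "(\<Psi> - \<Psi>', \<Phi> - \<Phi>') \<in> G"
proof -
  have "fock_scale (- 1) \<Xi> = - \<Xi>" for \<Xi>
    by transfer (simp add: ae_eq_seq_def L2_uminus ae_eq_refl)
  then have "(- \<Psi>', - \<Phi>') \<in> G"
    using assms(1,3) unfolding is_operator_def by (metis (no_types, lifting) case_prodD)
  then have "(\<Psi> + - \<Psi>', \<Phi> + - \<Phi>') \<in> G"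
    using assms(1,2) unfolding is_operator_def by fast
  then show ?thesis
    by simp
qed

lemma ae_eq_add_zero:
  "ae_eq N \<psi> (\<lambda>x s. 0) \<Longrightarrow> ae_eq N \<phi> \<phi>' \<Longrightarrow> ae_eq N (\<lambda>x s. \<psi> x s + \<phi> x s) \<phi>'"
  using ae_eq_map2[of N \<psi> "\<lambda>x s. 0" \<phi> \<phi>' "(+)"] by simp

lemma sector_add: "sector \<Psi> N (\<lambda>x s. 0) \<Longrightarrow> sector \<Phi> N \<phi> \<Longrightarrow> sector (\<Psi> + \<Phi>) N \<phi>"
  by transfer (simp add: ae_eq_add_zero)

lemma sector_scale: "sector \<Psi> N \<psi> \<Longrightarrow> sector (fock_scale a \<Psi>) N (\<lambda>x s. a * \<psi> x s)"
  by transfer (simp add: ae_eq_map L2_scale)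

lemma sector_zero: "sector 0 N (\<lambda>x s. 0)"
  by transfer (simp add: ae_eq_refl L2_zero)

lemma zero_fock: "0 \<in> fock st N" "0 \<in> fock_below st N" "0 \<in> fock_top st N"
proof -
  show 0: "0 \<in> fock st N"
    unfolding fock_def using sector_zero zero_in_symmetrize by blast
  show "0 \<in> fock_below st N" "0 \<in> fock_top st N"
    using 0 by (auto simp: fock_below_def fock_top_def sector_zero)
qed

lemma fock_below_top_closed:
  "\<Psi> \<in> fock_below st N \<Longrightarrow> \<Phi> \<in> fock_below st N \<Longrightarrow> \<Psi> + \<Phi> \<in> fock st N \<Longrightarrow> \<Psi> + \<Phi> \<in> fock_below st N"
  "\<Psi> \<in> fock_below st N \<Longrightarrow> fock_scale a \<Psi> \<in> fock st N \<Longrightarrow> fock_scale a \<Psi> \<in> fock_below st N"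
  "\<Psi> \<in> fock_top st N \<Longrightarrow> \<Phi> \<in> fock_top st N \<Longrightarrow> \<Psi> + \<Phi> \<in> fock st N \<Longrightarrow> \<Psi> + \<Phi> \<in> fock_top st N"
  "\<Psi> \<in> fock_top st N \<Longrightarrow> fock_scale a \<Psi> \<in> fock st N \<Longrightarrow> fock_scale a \<Psi> \<in> fock_top st N"
  using sector_scale[of _ _ "\<lambda>x s. 0" a] by (auto simp: fock_below_def fock_top_def intro: sector_add)

text \<open>Closure of \<open>X\<close> is asked only for results that lie in \<open>Y\<close>, and
  membership in the graph \<open>G\<close> provides exactly this. So closure of the whole Fock space
  under linear combinations is never proved separately.\<close>

lemma is_operator_restrict:
  assumes op: "is_operator Y G" and X: "0 \<in> X"
    and add: "\<And>\<Psi> \<Phi>. \<Psi> \<in> X \<Longrightarrow> \<Phi> \<in> X \<Longrightarrow> \<Psi> + \<Phi> \<in> Y \<Longrightarrow> \<Psi> + \<Phi> \<in> X"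
    and scale: "\<And>a \<Psi>. \<Psi> \<in> X \<Longrightarrow> fock_scale a \<Psi> \<in> Y \<Longrightarrow> fock_scale a \<Psi> \<in> X"
  shows "is_operator X (G \<inter> X \<times> X)"
proof -
  have G: "G \<subseteq> Y \<times> Y" "single_valued G" "(0, 0) \<in> G"
    "\<And>\<Psi> \<Phi> \<Psi>' \<Phi>'. (\<Psi>, \<Phi>) \<in> G \<Longrightarrow> (\<Psi>', \<Phi>') \<in> G \<Longrightarrow> (\<Psi> + \<Psi>', \<Phi> + \<Phi>') \<in> G"
    "\<And>a \<Psi> \<Phi>. (\<Psi>, \<Phi>) \<in> G \<Longrightarrow> (fock_scale a \<Psi>, fock_scale a \<Phi>) \<in> G"
    using op unfolding is_operator_def by fast+
  have "(\<Psi> + \<Psi>', \<Phi> + \<Phi>') \<in> G \<inter> X \<times> X" if "(\<Psi>, \<Phi>) \<in> G \<inter> X \<times> X" "(\<Psi>', \<Phi>') \<in> G \<inter> X \<times> X" for \<Psi> \<Phi> \<Psi>' \<Phi>'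
    using that G(1) G(4)[of \<Psi> \<Phi> \<Psi>' \<Phi>'] add[of \<Psi> \<Psi>'] add[of \<Phi> \<Phi>'] by auto
  moreover have "(fock_scale a \<Psi>, fock_scale a \<Phi>) \<in> G \<inter> X \<times> X" if "(\<Psi>, \<Phi>) \<in> G \<inter> X \<times> X" for a \<Psi> \<Phi>
    using that G(1) G(5)[of \<Psi> \<Phi> a] scale[of \<Psi> a] scale[of \<Phi> a] by auto
  moreover have "single_valued (G \<inter> X \<times> X)"
    using G(2) by (auto simp: single_valued_def)
  ultimately show ?thesis
    unfolding is_operator_def using G(3) X by fast
qed

text \<open>Invariance of the graph under the projection to the top sector is enough: linearity
  gives the complementary part by subtraction, and the two restrictions of the graph to the blocks
  serve as the diagonal operators.\<close>

lemma block_diagonalI: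
  assumes op: "is_operator (fock st N) H"
    and proj: "\<And>\<Psi> \<Phi>. (\<Psi>, \<Phi>) \<in> H \<Longrightarrow> (proj N \<Psi>, proj N \<Phi>) \<in> H"
  shows "block_diagonal (fock_below st N) (fock_top st N) H"
proof -
  let ?A = "H \<inter> fock_below st N \<times> fock_below st N" and ?B = "H \<inter> fock_top st N \<times> fock_top st N"
  have "is_operator (fock_below st N) ?A" "is_operator (fock_top st N) ?B"
    by (intro is_operator_restrict[OF op] zero_fock fock_below_top_closed; assumption)+
  moreover have "H = {(\<Psi> + \<Psi>', \<Phi> + \<Phi>') |\<Psi> \<Psi>' \<Phi> \<Phi>'. (\<Psi>, \<Phi>) \<in> ?A \<and> (\<Psi>', \<Phi>') \<in> ?B}" (is "H = ?R")
  proof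
    show "H \<subseteq> ?R"
    proof (rule subrelI)
      fix \<Psi> \<Phi> assume H: "(\<Psi>, \<Phi>) \<in> H"
      then have f: "\<Psi> \<in> fock st N" "\<Phi> \<in> fock st N"
        using op unfolding is_operator_def by auto
      have "(\<Psi> - proj N \<Psi>, \<Phi> - proj N \<Phi>) \<in> ?A"
        using is_operator_diff[OF op H proj[OF H]] diff_proj_fock_below f by simp
      moreover have "(proj N \<Psi>, proj N \<Phi>) \<in> ?B"
        using proj[OF H] proj_fock_top f by simp
      moreover have "(\<Psi>, \<Phi>) = ((\<Psi> - proj N \<Psi>) + proj N \<Psi>, (\<Phi> - proj N \<Phi>) + proj N \<Phi>)"
        by simp
      ultimately show "(\<Psi>, \<Phi>) \<in> ?R"
        by blast
    qed
    show "?R \<subseteq> H"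
      using op unfolding is_operator_def by fast
  qed
  ultimately show ?thesis
    unfolding block_diagonal_def by blast
qed

theorem theorem1:
  fixes c hbar m :: real and st :: statistics and Nmax :: nat and H :: "fockvec rel"
  assumes "c > 0" and "hbar > 0" and "m \<ge> 0" and "Nmax \<ge> 1"
    and "self_adjoint_extension c hbar m st Nmax H"
  shows "block_diagonal (fock_below st Nmax) (fock_top st Nmax) H"
proof -
  have op: "is_operator (fock st Nmax) H" and adj: "adjoint_graph st Nmax H = H"
    and ext: "H_circ c hbar m st Nmax \<subseteq> H"
    using assms(5) unfolding self_adjoint_extension_def self_adjoint_def restrict_to_def by auto
  have top: "\<exists>u v. u \<in> L2 Nmax \<and> v \<in> L2 Nmax \<and> sector \<Psi> Nmax u \<and> sector \<Phi> Nmax v \<and>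
      (\<forall>F. test_field Nmax F \<longrightarrow> (\<forall>s. vanish_near_0 {..<Nmax} (F s)) \<longrightarrow>
        l2_inner Nmax u (dirac_op c hbar m Nmax F) = l2_inner Nmax v (field F))"
    if H: "(\<Psi>, \<Phi>) \<in> H" for \<Psi> \<Phi>
  proof -
    have "\<Psi> \<in> fock st Nmax" "\<Phi> \<in> fock st Nmax"
      using op H unfolding is_operator_def by auto
    then obtain u v where uv: "u \<in> L2 Nmax" "v \<in> L2 Nmax"
      "sector \<Psi> Nmax (symmetrize st Nmax u)" "sector \<Phi> Nmax (symmetrize st Nmax v)"
      using fock_sector by blast
    have "l2_inner Nmax (symmetrize st Nmax u) (dirac_op c hbar m Nmax F) = l2_inner Nmax (symmetrize st Nmax v) (field F)"
      if F: "test_field Nmax F" and van: "\<And>s. vanish_near_0 {..<Nmax} (F s)" for F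
    proof -
      let ?f = "single Nmax (symmetrize st Nmax (field F))"
      let ?g = "single Nmax (symmetrize st Nmax (dirac_op c hbar m Nmax F))"
      have "(?f, ?g) \<in> H"
        using H_circ_test_field[OF F van] ext by blast
      moreover have "(\<Psi>, \<Phi>) \<in> adjoint_graph st Nmax H"
        using adj H by simp
      ultimately have "fock_inner Nmax \<Psi> ?g = fock_inner Nmax \<Phi> ?f"
        unfolding adjoint_graph_def by blast
      then have "sector_inner Nmax \<Psi> ?g = sector_inner Nmax \<Phi> ?f"
        by (simp add: fock_inner_right sector_single_other)
      then have "l2_inner Nmax (symmetrize st Nmax u) (symmetrize st Nmax (dirac_op c hbar m Nmax F))
          = l2_inner Nmax (symmetrize st Nmax v) (symmetrize st Nmax (field F))"
        using sector_inner_eq[OF uv(3) sector_single[OF symmetrize_L2[OF dirac_op_L2[OF F]]]]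
          sector_inner_eq[OF uv(4) sector_single[OF symmetrize_L2[OF field_L2[OF F]]]] by simp
      \<comment> \<open>One symmetrization moves from the test field to the left argument, where
        idempotence absorbs it. Thus the weak equation holds against arbitrary test fields, not only
        symmetrized ones.\<close>
      then show ?thesis
        using uv F by (simp add: l2_inner_symmetrize[symmetric] symmetrize_idem symmetrize_L2 dirac_op_L2 field_L2)
    qed
    then show ?thesis
      using uv symmetrize_L2 by blast
  qed
  show ?thesis
  proof (rule block_diagonalI[OF op])
    fix \<Psi> \<Phi> assume H: "(\<Psi>, \<Phi>) \<in> H"
    have f: "proj Nmax \<Psi> \<in> fock st Nmax" "proj Nmax \<Phi> \<in> fock st Nmax"
      using op H proj_fock_top unfolding is_operator_def fock_top_def by fast+
    obtain u v where uv: "u \<in> L2 Nmax" "v \<in> L2 Nmax" "sector \<Psi> Nmax u" "sector \<Phi> Nmax v"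
      and weak: "\<And>F. test_field Nmax F \<Longrightarrow> (\<And>s. vanish_near_0 {..<Nmax} (F s)) \<Longrightarrow>
        l2_inner Nmax u (dirac_op c hbar m Nmax F) = l2_inner Nmax v (field F)"
      using top[OF H] by blast
    have "fock_inner Nmax (proj Nmax \<Psi>) \<Phi>' = fock_inner Nmax (proj Nmax \<Phi>) \<Psi>'" if H': "(\<Psi>', \<Phi>') \<in> H" for \<Psi>' \<Phi>'
    proof -
      obtain u' v' where uv': "u' \<in> L2 Nmax" "v' \<in> L2 Nmax" "sector \<Psi>' Nmax u'" "sector \<Phi>' Nmax v'"
        and weak': "\<And>F. test_field Nmax F \<Longrightarrow> (\<And>s. vanish_near_0 {..<Nmax} (F s)) \<Longrightarrow>
          l2_inner Nmax u' (dirac_op c hbar m Nmax F) = l2_inner Nmax v' (field F)"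
        using top[OF H'] by blast
      have "l2_inner Nmax v u' = l2_inner Nmax u v'"
        by (rule dirac_op_adjoint_symmetric[OF uv(1,2) uv'(1,2) weak weak'])
      then show ?thesis
        using sector_inner_eq[OF sector_proj[OF uv(3)] uv'(4)] sector_inner_eq[OF sector_proj[OF uv(4)] uv'(3)]
        by (simp add: fock_inner_left sector_proj_other)
    qed
    then have "(proj Nmax \<Psi>, proj Nmax \<Phi>) \<in> adjoint_graph st Nmax H"
      using f unfolding adjoint_graph_def by auto
    then show "(proj Nmax \<Psi>, proj Nmax \<Phi>) \<in> H"
      using adj by simp
  qed
qed

end
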